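(* Let $\alpha>1$ be a real number and $u_0\in L^2(\mathbb T)$. For every $\sigma>0$, the following limit exists in $\mathscr S'(\mathbb R\times\mathbb T)$: $$:\!\big\vert\langle D_x\rangle^{\sigma}(e^{it\vert D_x\vert^{\alpha}}u_0)\big\vert^2\!:\; = \lim_{N\rightarrow+\infty}\Big(\big\vert\langle D_x\rangle^{\sigma}(e^{it\vert D_x\vert^{\alpha}}\Pi_Nu_0)\big\vert^2 - \Vert\Pi_Nu_0\Vert^2_{H^{\sigma}(\mathbb T)}\Big).$$ Moreover, $$:\!\big\vert\langle D_x\rangle^{\sigma}(e^{it\vert D_x\vert^{\alpha}}u_0)\big\vert^2\!:\;\in W^{-s_1,\infty}(\mathbb R, H^{-s_2}(\mathbb T)),$$ where $s_1 = \frac{2\sigma}{\alpha-1}$ and where $s_2=2\sigma$ if $\sigma>\frac14-\frac1{4\alpha}$, while $s_2$ is any positive number such that $s_2>\frac12-\frac{2\sigma}{\alpha-1}$ if $\sigma\le\frac14-\frac1{4\alpha}$. The convergence of $\big\vert\langle D_x\rangle^{\sigma}(e^{it\vert D_x\vert^{\alpha}}\Pi_Nu_0)\big\vert^2 - \Vert\Pi_Nu_0\Vert^2_{H^{\sigma}(\mathbb T)}$ to $:\!\big\vert\langle D_x\rangle^{\sigma}(e^{it\vert D_x\vert^{\alpha}}u_0)\big\vert^2\!:$ as $N\rightarrow+\infty$ actually holds in the space $W^{-s_1,\infty}(\mathbb R, H^{-s_2}(\mathbb T))$.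
   Context: $\mathbb T=\mathbb R/2\pi\mathbb Z$, equipped with Lebesgue measure normalized to total mass $1$. $\mathscr S'(\mathbb T)=(C^\infty(\mathbb T))'$; for $f\in\mathscr S'(\mathbb T)$, $\widehat f(n)$, $n\in\mathbb Z$, denotes the $n$-th Fourier coefficient, so that $\widehat f(n)=\int_{\mathbb T}f(x)e^{-inx}\,\mathrm dx$ for $f\in L^1(\mathbb T)$, and $\Vert f\Vert_{L^2(\mathbb T)}^2=\sum_n|\widehat f(n)|^2$. For $\sigma\in\mathbb R$, $\langle D_x\rangle^\sigma$ is the Fourier multiplier $\widehat{\langle D_x\rangle^{\sigma}f}(n)=\langle n\rangle^\sigma\widehat f(n)$ with $\langle y\rangle=(1+y^2)^{1/2}$ for $y\in\mathbb R$, and $\Vert f\Vert_{H^\sigma(\mathbb T)}=\Vert\langle D_x\rangle^\sigma f\Vert_{L^2(\mathbb T)}$ defines the Sobolev space $H^\sigma(\mathbb T)$. For $t\in\mathbb R$ and $u_0\in\mathscr S'(\mathbb T)$, $$(e^{it\vert D_x\vert^{\alpha}}u_0)(x)=\sum_{n\in\mathbb Z}\widehat{u_0}(n)e^{it|n|^\alpha}e^{inx},$$ and for $N\ge0$, $(\Pi_Nu_0)(x)=\sum_{|n|\le N}\widehat{u_0}(n)e^{inx}$. $\mathscr S(\mathbb R\times\mathbb T)$ is the space of smooth functions on $\mathbb R\times\mathbb T$ that are rapidly decreasing in $t$ together with all their derivatives, and $\mathscr S'(\mathbb R\times\mathbb T)$ is its dual. For $s\in\mathbb R$, $\langle D_t\rangle^s$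 is the Fourier multiplier by $\langle\tau\rangle^s$ in the time variable ($\tau\in\mathbb R$ being the frequency dual to $t$). For $s_1,s_2\in\mathbb R$, $$W^{-s_1,\infty}(\mathbb R, H^{-s_2}(\mathbb T)) = \big\{\varphi\in\mathscr S'(\mathbb R\times\mathbb T) : \langle D_t\rangle^{-s_1}\varphi\in L^{\infty}(\mathbb R,H^{-s_2}(\mathbb T))\big\},$$ with norm $\sup_{t\in\mathbb R}\Vert\langle D_t\rangle^{-s_1}\varphi(t,\cdot)\Vert_{H^{-s_2}(\mathbb T)}$ (essential supremum). *)

theory Defs
  imports "HOL-Analysis.Analysis" "HOL-Probability.Essential_Supremum"
begin

text \<open>
  Functions on the torus are \<open>2 * pi\<close>-periodic functions on the real line; functions on
  the product of the line with the torus are curried, \<open>\<phi> t x\<close>, and periodic in \<open>x\<close>.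
  A distribution is a HOL function on all functions, but only its values on test functions are
  meaningful: distributions are equal when they agree on the test functions.  The dual pairings
  are bilinear (no complex conjugation).
\<close>

definition japanese :: "real \<Rightarrow> real" where
  "japanese y = sqrt (1 + y\<^sup>2)"

definition periodic :: "(real \<Rightarrow> complex) \<Rightarrow> bool" where
  "periodic f \<longleftrightarrow> (\<forall>x. f (x + 2 * pi) = f x)"

definition torus_integral :: "(real \<Rightarrow> complex) \<Rightarrow> complex" where
  "torus_integral f = (LINT x:{0..2 * pi}|lebesgue. f x) / of_real (2 * pi)"

definition L2_torus :: "(real \<Rightarrow> complex) set" where
  "L2_torus = {u. periodic u \<and> u \<in> borel_measurable lebesgue \<and>
     set_integrable lebesgue {0..2 * pi} (\<lambda>x. (cmod (u x))\<^sup>2)}"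

definition fourier_coeff :: "(real \<Rightarrow> complex) \<Rightarrow> int \<Rightarrow> complex" where
  "fourier_coeff f n = torus_integral (\<lambda>x. f x * cis (- (of_int n * x)))"

text \<open>
  Fourier multipliers in \<open>x\<close>, acting on functions.  The series is summed pointwise; below
  it is only formed for trigonometric polynomials, where it has finitely many nonzero terms.
\<close>

definition Dx_multiplier :: "(int \<Rightarrow> complex) \<Rightarrow> (real \<Rightarrow> complex) \<Rightarrow> real \<Rightarrow> complex" where
  "Dx_multiplier m f x = (\<Sum>\<^sub>\<infinity>n\<in>UNIV. m n * fourier_coeff f n * cis (of_int n * x))"

definition Dx_bracket :: "real \<Rightarrow> (real \<Rightarrow> complex) \<Rightarrow> real \<Rightarrow> complex" where
  "Dx_bracket \<sigma> = Dx_multiplier (\<lambda>n. of_real (japanese (of_int n) powr \<sigma>))"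

definition propagator :: "real \<Rightarrow> real \<Rightarrow> (real \<Rightarrow> complex) \<Rightarrow> real \<Rightarrow> complex" where
  "propagator \<alpha> t = Dx_multiplier (\<lambda>n. cis (t * \<bar>of_int n\<bar> powr \<alpha>))"

definition freq_proj :: "nat \<Rightarrow> (real \<Rightarrow> complex) \<Rightarrow> real \<Rightarrow> complex" where
  "freq_proj N f x = (\<Sum>n\<in>{- int N..int N}. fourier_coeff f n * cis (of_int n * x))"


subsection \<open>Distributions and Sobolev spaces on the torus\<close>

definition vderiv :: "(real \<Rightarrow> complex) \<Rightarrow> real \<Rightarrow> complex" where
  "vderiv f x = vector_derivative f (at x)"

definition torus_smooth :: "(real \<Rightarrow> complex) set" where
  "torus_smooth = {\<psi>. periodic \<psi> \<and> (\<forall>k. (vderiv ^^ k) \<psi> differentiable_on UNIV)}"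

definition torus_distributions :: "((real \<Rightarrow> complex) \<Rightarrow> complex) set" where
  "torus_distributions = {f.
     (\<forall>\<psi>\<in>torus_smooth. \<forall>\<eta>\<in>torus_smooth. \<forall>c.
        f (\<lambda>x. c * \<psi> x + \<eta> x) = c * f \<psi> + f \<eta>) \<and>
     (\<exists>C K. \<forall>\<psi>\<in>torus_smooth.
        cmod (f \<psi>) \<le> C * (\<Sum>k\<le>K. SUP x. cmod ((vderiv ^^ k) \<psi> x)))}"

definition torus_dist :: "(real \<Rightarrow> complex) \<Rightarrow> (real \<Rightarrow> complex) \<Rightarrow> complex" where
  "torus_dist f \<psi> = torus_integral (\<lambda>x. f x * \<psi> x)"

definition dist_coeff :: "((real \<Rightarrow> complex) \<Rightarrow> complex) \<Rightarrow> int \<Rightarrow> complex" where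
  "dist_coeff f n = f (\<lambda>x. cis (- (of_int n * x)))"

definition sobolev :: "real \<Rightarrow> ((real \<Rightarrow> complex) \<Rightarrow> complex) set" where
  "sobolev \<sigma> = {f \<in> torus_distributions.
     (\<lambda>n. (japanese (of_int n) powr \<sigma> * cmod (dist_coeff f n))\<^sup>2) summable_on UNIV}"

definition sobolev_norm :: "real \<Rightarrow> ((real \<Rightarrow> complex) \<Rightarrow> complex) \<Rightarrow> real" where
  "sobolev_norm \<sigma> f =
     sqrt (\<Sum>\<^sub>\<infinity>n\<in>UNIV. (japanese (of_int n) powr \<sigma> * cmod (dist_coeff f n))\<^sup>2)"


subsection \<open>Distributions on the product of the line with the torus\<close>

definition Dt :: "(real \<Rightarrow> real \<Rightarrow> complex) \<Rightarrow> real \<Rightarrow> real \<Rightarrow> complex" where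
  "Dt \<phi> t x = vderiv (\<lambda>t'. \<phi> t' x) t"

definition Dx :: "(real \<Rightarrow> real \<Rightarrow> complex) \<Rightarrow> real \<Rightarrow> real \<Rightarrow> complex" where
  "Dx \<phi> t x = vderiv (\<phi> t) x"

definition schwartz_weight ::
  "nat \<Rightarrow> nat \<Rightarrow> nat \<Rightarrow> (real \<Rightarrow> real \<Rightarrow> complex) \<Rightarrow> real \<times> real \<Rightarrow> real" where
  "schwartz_weight k a b \<phi> = (\<lambda>(t, x). \<bar>t\<bar> ^ k * cmod ((Dt ^^ a) ((Dx ^^ b) \<phi>) t x))"

text \<open>
  It suffices to consider the derivatives taken first in \<open>x\<close> and then in \<open>t\<close>: if all of
  them are totally differentiable on the plane, then the mixed partial derivatives commute and
  the function is smooth.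
\<close>

definition schwartz :: "(real \<Rightarrow> real \<Rightarrow> complex) set" where
  "schwartz = {\<phi>. (\<forall>t. periodic (\<phi> t)) \<and>
     (\<forall>a b. (\<lambda>(t, x). (Dt ^^ a) ((Dx ^^ b) \<phi>) t x) differentiable_on UNIV) \<and>
     (\<forall>k a b. bdd_above (range (schwartz_weight k a b \<phi>)))}"

definition schwartz_seminorm ::
  "nat \<Rightarrow> nat \<Rightarrow> nat \<Rightarrow> (real \<Rightarrow> real \<Rightarrow> complex) \<Rightarrow> real" where
  "schwartz_seminorm k a b \<phi> = (SUP p. schwartz_weight k a b \<phi> p)"

definition tempered :: "((real \<Rightarrow> real \<Rightarrow> complex) \<Rightarrow> complex) set" where
  "tempered = {T.
     (\<forall>\<phi>\<in>schwartz. \<forall>\<eta>\<in>schwartz. \<forall>c.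
        T (\<lambda>t x. c * \<phi> t x + \<eta> t x) = c * T \<phi> + T \<eta>) \<and>
     (\<exists>C K. \<forall>\<phi>\<in>schwartz.
        cmod (T \<phi>) \<le> C * (\<Sum>k\<le>K. \<Sum>a\<le>K. \<Sum>b\<le>K. schwartz_seminorm k a b \<phi>))}"

definition tempered_tendsto ::
  "(nat \<Rightarrow> (real \<Rightarrow> real \<Rightarrow> complex) \<Rightarrow> complex) \<Rightarrow>
   ((real \<Rightarrow> real \<Rightarrow> complex) \<Rightarrow> complex) \<Rightarrow> bool" where
  "tempered_tendsto T_seq T \<longleftrightarrow> (\<forall>\<phi>\<in>schwartz. (\<lambda>N. T_seq N \<phi>) \<longlonglongrightarrow> T \<phi>)"

text \<open>The distribution defined by a family \<open>g t\<close> of distributions on the torus.\<close>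

definition time_dist ::
  "(real \<Rightarrow> (real \<Rightarrow> complex) \<Rightarrow> complex) \<Rightarrow> (real \<Rightarrow> real \<Rightarrow> complex) \<Rightarrow> complex" where
  "time_dist g \<phi> = (LINT t|lebesgue. g t (\<phi> t))"

definition fun_dist ::
  "(real \<Rightarrow> real \<Rightarrow> complex) \<Rightarrow> (real \<Rightarrow> real \<Rightarrow> complex) \<Rightarrow> complex" where
  "fun_dist w = time_dist (\<lambda>t. torus_dist (w t))"

definition time_fourier :: "(real \<Rightarrow> real \<Rightarrow> complex) \<Rightarrow> real \<Rightarrow> real \<Rightarrow> complex" where
  "time_fourier \<phi> \<tau> x = (LINT t|lebesgue. \<phi> t x * cis (- (t * \<tau>)))"

definition Dt_bracket_test ::
  "real \<Rightarrow> (real \<Rightarrow> real \<Rightarrow> complex) \<Rightarrow> real \<Rightarrow> real \<Rightarrow> complex" where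
  "Dt_bracket_test s \<phi> t x =
     (LINT \<tau>|lebesgue. of_real (japanese \<tau> powr s) * time_fourier \<phi> \<tau> x * cis (t * \<tau>))
       / of_real (2 * pi)"

text \<open>
  The multiplier is extended to distributions by duality; the symbol is even, so the operator is
  its own transpose.
\<close>

definition Dt_bracket ::
  "real \<Rightarrow> ((real \<Rightarrow> real \<Rightarrow> complex) \<Rightarrow> complex) \<Rightarrow> (real \<Rightarrow> real \<Rightarrow> complex) \<Rightarrow> complex" where
  "Dt_bracket s T \<phi> = T (Dt_bracket_test s \<phi>)"


subsection \<open>The spaces of essentially bounded functions of time\<close>

text \<open>Strong (Bochner) measurability with respect to the norm of the Sobolev space.\<close>

definition sobolev_measurable :: "real \<Rightarrow> (real \<Rightarrow> (real \<Rightarrow> complex) \<Rightarrow> complex) \<Rightarrow> bool" where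
  "sobolev_measurable \<sigma> g \<longleftrightarrow>
     (\<exists>h :: nat \<Rightarrow> real \<Rightarrow> (real \<Rightarrow> complex) \<Rightarrow> complex.
        (\<forall>k. simple_function lebesgue (h k) \<and> range (h k) \<subseteq> sobolev \<sigma>) \<and>
        (AE t in lebesgue. (\<lambda>k. sobolev_norm \<sigma> (\<lambda>\<psi>. g t \<psi> - h k t \<psi>)) \<longlonglongrightarrow> 0))"

definition Linf_norm :: "real \<Rightarrow> (real \<Rightarrow> (real \<Rightarrow> complex) \<Rightarrow> complex) \<Rightarrow> ereal" where
  "Linf_norm \<sigma> g = esssup lebesgue (\<lambda>t. ereal (sobolev_norm \<sigma> (g t)))"

definition Linf_sobolev :: "real \<Rightarrow> (real \<Rightarrow> (real \<Rightarrow> complex) \<Rightarrow> complex) set" where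
  "Linf_sobolev \<sigma> =
     {g. (\<forall>t. g t \<in> sobolev \<sigma>) \<and> sobolev_measurable \<sigma> g \<and> Linf_norm \<sigma> g < \<infinity>}"

text \<open>
  \<open>Dt_density r \<sigma> T\<close> consists of the functions that represent the distribution
  \<open>Dt_bracket r T\<close>; they agree almost everywhere, so the infimum in \<open>W_norm\<close> is over
  equal values.  The indices \<open>r\<close> and \<open>\<sigma>\<close> of \<open>W_space\<close> are the signed
  regularities in \<open>t\<close> and \<open>x\<close>.
\<close>

definition Dt_density ::
  "real \<Rightarrow> real \<Rightarrow> ((real \<Rightarrow> real \<Rightarrow> complex) \<Rightarrow> complex) \<Rightarrow>
   (real \<Rightarrow> (real \<Rightarrow> complex) \<Rightarrow> complex) set" where
  "Dt_density r \<sigma> T =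
     {g \<in> Linf_sobolev \<sigma>. \<forall>\<phi>\<in>schwartz. Dt_bracket r T \<phi> = time_dist g \<phi>}"

definition W_space ::
  "real \<Rightarrow> real \<Rightarrow> ((real \<Rightarrow> real \<Rightarrow> complex) \<Rightarrow> complex) set" where
  "W_space r \<sigma> = {T \<in> tempered. Dt_density r \<sigma> T \<noteq> {}}"

definition W_norm ::
  "real \<Rightarrow> real \<Rightarrow> ((real \<Rightarrow> real \<Rightarrow> complex) \<Rightarrow> complex) \<Rightarrow> ereal" where
  "W_norm r \<sigma> T = (INF g\<in>Dt_density r \<sigma> T. Linf_norm \<sigma> g)"

definition W_tendsto ::
  "real \<Rightarrow> real \<Rightarrow> (nat \<Rightarrow> (real \<Rightarrow> real \<Rightarrow> complex) \<Rightarrow> complex) \<Rightarrow>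
   ((real \<Rightarrow> real \<Rightarrow> complex) \<Rightarrow> complex) \<Rightarrow> bool" where
  "W_tendsto r \<sigma> T_seq T \<longleftrightarrow>
     (\<forall>N. T_seq N \<in> W_space r \<sigma>) \<and> T \<in> W_space r \<sigma> \<and>
     (\<lambda>N. W_norm r \<sigma> (\<lambda>\<phi>. T_seq N \<phi> - T \<phi>)) \<longlonglongrightarrow> 0"


subsection \<open>The renormalized square\<close>

definition renorm_square ::
  "real \<Rightarrow> real \<Rightarrow> (real \<Rightarrow> complex) \<Rightarrow> nat \<Rightarrow> real \<Rightarrow> real \<Rightarrow> complex" where
  "renorm_square \<alpha> \<sigma> u\<^sub>0 N t x =
     of_real ((cmod (Dx_bracket \<sigma> (propagator \<alpha> t (freq_proj N u\<^sub>0)) x))\<^sup>2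
       - (sobolev_norm \<sigma> (torus_dist (freq_proj N u\<^sub>0)))\<^sup>2)"

end

theory Submission
  imports Defs "HOL-Probability.Probability"
begin

text \<open>
  Write \<open>c n\<close> for the Fourier coefficients of \<open>u\<^sub>0\<close> and \<open>\<langle>y\<rangle>\<close> for \<open>japanese y\<close>.  Expanding the
  modulus squared, the subtracted Sobolev norm is exactly the diagonal \<open>m = n\<close>, and the rest is a
  superposition of plane waves \<open>exp (i t \<omega>) * exp (i k x)\<close> indexed by the pairs \<open>m \<noteq> n\<close>, with
  frequency \<open>k = m - n\<close>, phase \<open>\<omega> = |m| powr \<alpha> - |n| powr \<alpha>\<close> and amplitude
  \<open>\<langle>m\<rangle> powr \<sigma> * \<langle>n\<rangle> powr \<sigma> * c m * cnj (c n)\<close> (\<open>renorm_square_waves\<close>).  On such a wave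
  \<open>\<langle>D_t\<rangle> powr (- s1)\<close> is multiplication by \<open>\<langle>\<omega>\<rangle> powr (- s1)\<close>.

  Dispersion pays for the derivatives.  If \<open>|m| > |n|\<close>, then
  \<open>\<omega> \<ge> |m| powr (\<alpha> - 1) * (|m| - |n|)\<close>; with \<open>s1 = 2 \<sigma> / (\<alpha> - 1)\<close> the first factor
  cancels the growth \<open>\<langle>m\<rangle> powr \<sigma> * \<langle>n\<rangle> powr \<sigma>\<close>, and the second one leaves the decay
  \<open>(|m| - |n|) powr (- s1)\<close>.  The pairs \<open>n = - m\<close> do not oscillate in time, and there the weight
  \<open>\<langle>m - n\<rangle> powr (- s2)\<close> in space must do the work, which needs \<open>s2 \<ge> 2 \<sigma>\<close>.  Altogether the
  weighted amplitude is at most a constant times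
  \<open>|c m| |c n| (\<langle>m - n\<rangle> powr (- p) + \<langle>m + n\<rangle> powr (- p))\<close> with \<open>p = s1 + s2\<close>
  (\<open>dispersive_weight\<close>).  If \<open>p > 1/2\<close>, the Cauchy-Schwarz inequality makes the absolute sums over
  the pairs with \<open>m - n = j\<close> square summable in \<open>j\<close> (\<open>convolution_amplitudes\<close>).  Both alternatives
  for \<open>s2\<close> in the theorem imply that \<open>s2 \<ge> 2 \<sigma>\<close> and \<open>p > 1/2\<close>.
  Absolute values do not see the phases, so the Sobolev norm in \<open>x\<close> is bounded uniformly in time
  (\<open>wave_slice_sobolev\<close>), and the contribution of the pairs outside a large box tends to zero by
  dominated convergence (\<open>amplitudes_tendsto_0\<close>).

  It remains to connect the waves with distributions.  Since \<open>\<langle>\<tau>\<rangle> powr (- s)\<close> is the characteristic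
  function of a probability measure, a Gaussian with a random Gamma distributed variance
  (\<open>bessel_measure_exists\<close>), the operator \<open>\<langle>D_t\<rangle> powr (- s)\<close> is convolution with that measure, by
  Fourier inversion for Schwartz functions; Fubini's theorem then gives its action on plane waves
  (\<open>Dt_bracket_test_regular\<close>).  Temperedness of the limit and its convergence on test
  functions follow from the decay of the pairing of a Schwartz function with a plane wave in
  both frequencies (\<open>plane_wave_decay\<close>), by integration by parts.
\<close>

section \<open>Unconditional sums\<close>

lemma norm_dominated_summable:
  fixes f :: "'i \<Rightarrow> 'a::banach"
  assumes "h summable_on A" and "\<And>i. i \<in> A \<Longrightarrow> norm (f i) \<le> h i"
  shows "(\<lambda>i. norm (f i)) summable_on A" and "f summable_on A"
proof -
  show "(\<lambda>i. norm (f i)) summable_on A"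
    by (rule summable_on_comparison_test[OF assms(1)]) (use assms(2) in auto)
  then show "f summable_on A"
    by (rule abs_summable_summable)
qed

lemma infsum_diff:
  fixes f g :: "'i \<Rightarrow> 'a::real_normed_vector"
  assumes "f summable_on A" "g summable_on A"
  shows "infsum (\<lambda>i. f i - g i) A = infsum f A - infsum g A"
  using infsum_add[OF assms(1) summable_on_uminus[THEN iffD2, OF assms(2)]]
  by (simp add: infsum_uminus)

text \<open>
  Outside a finite set the dominating sum is small, uniformly along the filter; on the finite set
  the terms converge.  The filter is arbitrary because the lemma serves both for truncations, along
  \<open>sequentially\<close>, and for continuity in time, along \<open>at t\<close>.
\<close>

lemma infsum_dominated_convergence:
  fixes f :: "'b \<Rightarrow> 'i \<Rightarrow> 'a::banach"
  assumes bound: "\<And>n i. i \<in> A \<Longrightarrow> norm (f n i) \<le> h i"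
    and h: "h summable_on A"
    and lim: "\<And>i. i \<in> A \<Longrightarrow> ((\<lambda>n. f n i) \<longlongrightarrow> g i) F"
  shows "((\<lambda>n. infsum (f n) A) \<longlongrightarrow> infsum g A) F"
proof (cases "F = bot")
  case nontriv: False
  have gb: "norm (g i) \<le> h i" if "i \<in> A" for i
    by (rule tendsto_upperbound[OF tendsto_norm[OF lim[OF that]]]) (use bound that nontriv in auto)
  have fs: "f n summable_on A" for n
    by (rule norm_dominated_summable(2)[OF h bound])
  have gs: "g summable_on A"
    by (rule norm_dominated_summable(2)[OF h gb])
  have "((\<lambda>n. infsum (f n) A - infsum g A) \<longlongrightarrow> 0) F"
  proof (rule tendstoI)
    fix e :: real assume e: "e > 0"
    obtain S where S: "finite S" "S \<subseteq> A" "dist (sum h S) (infsum h A) \<le> e / 6"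
      using infsum_finite_approximation[OF h, of "e/6"] e by auto
    have hS: "h summable_on (A - S)"
      by (rule summable_on_subset_banach[OF h]) auto
    have hsplit: "infsum h A = sum h S + infsum h (A - S)"
      using infsum_Un_disjoint[of h S "A - S"] S hS by (simp add: Un_absorb1)
    have tail: "infsum h (A - S) \<le> e / 6"
      using S(3) hsplit by (simp add: dist_real_def abs_if split: if_splits)
    have "((\<lambda>n. \<Sum>i\<in>S. norm (f n i - g i)) \<longlongrightarrow> (\<Sum>i\<in>S. norm (g i - g i))) F"
      by (intro tendsto_sum tendsto_norm tendsto_diff lim tendsto_const) (use S in auto)
    then have "eventually (\<lambda>n. dist (\<Sum>i\<in>S. norm (f n i - g i)) 0 < e / 3) F"
      using e by (auto dest!: tendstoD[where e = "e / 3"])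
    then show "eventually (\<lambda>n. dist (infsum (f n) A - infsum g A) 0 < e) F"
    proof eventually_elim
      case (elim n)
      have b2: "norm (f n i - g i) \<le> 2 * h i" if "i \<in> A" for i
        using norm_triangle_ineq4[of "f n i" "g i"] bound[OF that, of n] gb[OF that] by linarith
      have h2: "(\<lambda>i. 2 * h i) summable_on (A - S)"
        using hS by (rule summable_on_cmult_right)
      have ds: "(\<lambda>i. norm (f n i - g i)) summable_on (A - S)"
        by (rule norm_dominated_summable(1)[OF h2, of "\<lambda>i. f n i - g i"]) (use b2 in auto)
      have "norm (infsum (\<lambda>i. f n i - g i) (A - S)) \<le> infsum (\<lambda>i. norm (f n i - g i)) (A - S)"
        by (rule norm_infsum_bound[OF ds])
      also have "\<dots> \<le> infsum (\<lambda>i. 2 * h i) (A - S)"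
        by (rule infsum_mono[OF ds h2]) (use b2 in auto)
      also have "\<dots> = 2 * infsum h (A - S)"
        by (rule infsum_cmult_right')
      finally have t: "norm (infsum (\<lambda>i. f n i - g i) (A - S)) \<le> e / 3"
        using tail by linarith
      have "(\<lambda>i. f n i - g i) summable_on (A - S)"
        by (rule abs_summable_summable[OF ds])
      then have "infsum (\<lambda>i. f n i - g i) A
          = sum (\<lambda>i. f n i - g i) S + infsum (\<lambda>i. f n i - g i) (A - S)"
        using infsum_Un_disjoint[of "\<lambda>i. f n i - g i" S "A - S"] S by (simp add: Un_absorb1)
      moreover have "infsum (\<lambda>i. f n i - g i) A = infsum (f n) A - infsum g A"
        by (rule infsum_diff[OF fs gs])
      moreover have "norm (sum (\<lambda>i. f n i - g i) S) < e / 3"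
        using elim norm_sum[of "\<lambda>i. f n i - g i" S] by (simp add: dist_real_def)
      ultimately show ?case
        using t e norm_triangle_ineq[of "sum (\<lambda>i. f n i - g i) S" "infsum (\<lambda>i. f n i - g i) (A - S)"]
        by simp
    qed
  qed
  then show ?thesis by (simp add: LIM_zero_iff)
qed simp

lemma infsum_Cauchy_Schwarz:
  fixes f g :: "'i \<Rightarrow> real"
  assumes f: "\<And>i. f i \<ge> 0" "(\<lambda>i. (f i)\<^sup>2) summable_on A"
    and g: "\<And>i. g i \<ge> 0" "(\<lambda>i. (g i)\<^sup>2) summable_on A"
  shows "(\<lambda>i. f i * g i) summable_on A"
    and "(infsum (\<lambda>i. f i * g i) A)\<^sup>2 \<le> infsum (\<lambda>i. (f i)\<^sup>2) A * infsum (\<lambda>i. (g i)\<^sup>2) A"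
proof -
  have "norm (f i * g i) \<le> (f i)\<^sup>2 + (g i)\<^sup>2" for i
  proof -
    have "f i * g i \<le> (f i)\<^sup>2 + (g i)\<^sup>2"
      using sum_squares_bound[of "f i" "g i"] mult_nonneg_nonneg[OF f(1)[of i] g(1)[of i]] by linarith
    then show ?thesis using f(1)[of i] g(1)[of i] by simp
  qed
  then show s: "(\<lambda>i. f i * g i) summable_on A"
    by (rule norm_dominated_summable(2)[OF summable_on_add[OF f(2) g(2)]])
  have n: "0 \<le> infsum (\<lambda>i. (f i)\<^sup>2) A * infsum (\<lambda>i. (g i)\<^sup>2) A"
    by (simp add: infsum_nonneg)
  have "infsum (\<lambda>i. f i * g i) A \<le> sqrt (infsum (\<lambda>i. (f i)\<^sup>2) A * infsum (\<lambda>i. (g i)\<^sup>2) A)"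
  proof (rule infsum_le_finite_sums[OF s])
    fix S assume S: "finite S" "S \<subseteq> A"
    have "(\<Sum>i\<in>S. f i * g i)\<^sup>2 \<le> (\<Sum>i\<in>S. (f i)\<^sup>2) * (\<Sum>i\<in>S. (g i)\<^sup>2)"
      by (rule Cauchy_Schwarz_ineq_sum)
    also have "\<dots> \<le> infsum (\<lambda>i. (f i)\<^sup>2) A * infsum (\<lambda>i. (g i)\<^sup>2) A"
      by (intro mult_mono finite_sum_le_infsum f g S) (auto intro!: sum_nonneg infsum_nonneg)
    finally show "(\<Sum>i\<in>S. f i * g i) \<le> sqrt (infsum (\<lambda>i. (f i)\<^sup>2) A * infsum (\<lambda>i. (g i)\<^sup>2) A)"
      by (rule real_le_rsqrt)
  qed
  then have "(infsum (\<lambda>i. f i * g i) A)\<^sup>2 \<le> (sqrt (infsum (\<lambda>i. (f i)\<^sup>2) A * infsum (\<lambda>i. (g i)\<^sup>2) A))\<^sup>2"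
    by (intro power_mono infsum_nonneg mult_nonneg_nonneg f(1) g(1))
  then show "(infsum (\<lambda>i. f i * g i) A)\<^sup>2 \<le> infsum (\<lambda>i. (f i)\<^sup>2) A * infsum (\<lambda>i. (g i)\<^sup>2) A"
    using n by simp
qed

section \<open>The Japanese bracket\<close>

lemma japanese_ge_1: "1 \<le> japanese y"
  by (simp add: japanese_def)

lemma japanese_pos [simp]: "0 < japanese y" "0 \<le> japanese y" "japanese y \<noteq> 0"
  using japanese_ge_1[of y] by linarith+

lemma japanese_ge_abs: "\<bar>y\<bar> \<le> japanese y"
  unfolding japanese_def by (rule real_le_rsqrt) simp

lemma japanese_le: "japanese y \<le> 1 + \<bar>y\<bar>"
  unfolding japanese_def by (rule real_le_lsqrt) (simp_all add: power2_eq_square algebra_simps)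

lemma japanese_mono: "\<bar>x\<bar> \<le> \<bar>y\<bar> \<Longrightarrow> japanese x \<le> japanese y"
  unfolding japanese_def by (simp add: abs_le_square_iff)

lemma japanese_minus [simp]: "japanese (- y) = japanese y"
  by (simp add: japanese_def)

lemma japanese_zero [simp]: "japanese 0 = 1"
  by (simp add: japanese_def)

lemma continuous_on_japanese [continuous_intros]:
  "continuous_on S f \<Longrightarrow> continuous_on S (\<lambda>x. japanese (f x))"
  unfolding japanese_def by (intro continuous_intros)

lemma borel_measurable_japanese [measurable]: "japanese \<in> borel_measurable borel"
  by (intro borel_measurable_continuous_onI continuous_intros)

lemma summable_on_japanese:
  assumes q: "q > 1"
  shows "(\<lambda>j::int. japanese (of_int j) powr (- q)) summable_on UNIV"
proof -
  let ?f = "\<lambda>j::int. japanese (of_int j) powr (- q)"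
  have N: "(\<lambda>n::nat. ?f (int n)) summable_on UNIV"
  proof (rule summable_nonneg_imp_summable_on)
    have "summable (\<lambda>n. real n powr (- q))"
      using q by (simp add: summable_real_powr_iff)
    moreover have "norm (?f (int n)) \<le> real n powr (- q)" if "n \<ge> 1" for n
      using that q japanese_ge_abs[of "real n"] by (auto intro!: powr_mono2')
    ultimately show "summable (\<lambda>n. ?f (int n))"
      by (rule summable_comparison_test'[where N = 1])
  qed auto
  have "?f summable_on (range int)"
    using N by (subst summable_on_reindex) (auto simp: o_def)
  moreover have "?f summable_on (range (\<lambda>n. - int n))"
    using N by (subst summable_on_reindex) (auto simp: o_def inj_on_def)
  ultimately have "?f summable_on (range int \<union> range (\<lambda>n. - int n))"
    by (rule summable_on_union)
  moreover have "range int \<union> range (\<lambda>n. - int n) = UNIV"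
  proof -
    have "x \<in> range int \<union> range (\<lambda>n. - int n)" for x
      by (cases x rule: int_cases2) auto
    then show ?thesis by blast
  qed
  ultimately show ?thesis by simp
qed

section \<open>Integration on the circle and Fourier coefficients of test functions\<close>

text \<open>
  The normalized measure of the torus as a probability measure on the Borel sets of the line, so
  that the product measure with the time line and Fubini's theorem are at hand.
\<close>

definition circle_measure :: "real measure" where
  "circle_measure = uniform_measure lborel {0..2 * pi}"

lemma sets_circle_measure [measurable_cong, simp]: "sets circle_measure = sets borel"
  by (simp add: circle_measure_def)

lemma space_circle_measure [simp]: "space circle_measure = UNIV"
  by (simp add: circle_measure_def)

lemma prob_space_circle_measure: "prob_space circle_measure"
  unfolding circle_measure_def by (rule prob_space_uniform_measure) auto

interpretation circle: prob_space circle_measure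
  by (rule prob_space_circle_measure)

interpretation line_circle: pair_sigma_finite lborel circle_measure ..

lemma torus_integral_circle:
  assumes [measurable]: "f \<in> borel_measurable borel"
  shows "torus_integral f = (LINT x|circle_measure. f x)"
proof -
  have dens: "circle_measure = density lborel (\<lambda>x. ennreal (indicator {0..2 * pi} x / (2 * pi)))"
    unfolding circle_measure_def uniform_measure_def
    by (intro density_cong) (auto simp: indicator_def divide_ennreal ennreal_1[symmetric] simp del: ennreal_1)
  have "(LINT x|circle_measure. f x)
      = (LINT x|lborel. (indicator {0..2 * pi} x / (2 * pi)) *\<^sub>R f x)"
    unfolding dens by (rule integral_density) auto
  also have "\<dots> = (LINT x|lborel. (indicator {0..2 * pi} x *\<^sub>R f x) / of_real (2 * pi))"
    by (intro Bochner_Integration.integral_cong) (auto simp: indicator_def scaleR_conv_of_real)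
  also have "\<dots> = torus_integral f"
    unfolding torus_integral_def set_lebesgue_integral_def
    by (simp add: integral_completion)
  finally show ?thesis by simp
qed

lemma torus_integral_bound:
  assumes [measurable]: "f \<in> borel_measurable borel" and b: "\<And>x. cmod (f x) \<le> B"
  shows "cmod (torus_integral f) \<le> B"
proof -
  have "integrable circle_measure f"
    by (rule circle.integrable_const_bound[where B = B]) (use b in auto)
  then have "(LINT x|circle_measure. cmod (f x)) \<le> B"
    by (intro circle.integral_le_const) (use b in \<open>auto intro: integrable_norm\<close>)
  moreover have "cmod (torus_integral f) \<le> (LINT x|circle_measure. cmod (f x))"
    by (simp add: torus_integral_circle)
  ultimately show ?thesis by simp
qed

lemma set_integrable_circle:
  fixes f :: "real \<Rightarrow> complex"
  assumes "continuous_on UNIV f"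
  shows "set_integrable lebesgue {0..2 * pi} f"
  by (rule absolutely_integrable_continuous_real) (use assms continuous_on_subset in blast)

lemma torus_integral_add:
  assumes "continuous_on UNIV f" "continuous_on UNIV g"
  shows "torus_integral (\<lambda>x. f x + g x) = torus_integral f + torus_integral g"
  using set_integral_add(2)[OF set_integrable_circle[OF assms(1)] set_integrable_circle[OF assms(2)]]
  by (simp add: torus_integral_def add_divide_distrib)

lemma torus_integral_cmult: "torus_integral (\<lambda>x. c * f x) = c * torus_integral f"
  by (simp add: torus_integral_def)

lemma torus_integral_sum:
  assumes "\<And>i. i \<in> I \<Longrightarrow> continuous_on UNIV (f i)"
  shows "torus_integral (\<lambda>x. \<Sum>i\<in>I. f i x) = (\<Sum>i\<in>I. torus_integral (f i))"
  using assms
proof (induction I rule: infinite_finite_induct)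
  case (insert i I)
  then show ?case
    by (simp add: torus_integral_add continuous_on_sum)
qed (simp_all add: torus_integral_def)

text \<open>
  The source of both the orthogonality of the characters and integration by parts on the torus.
\<close>

lemma torus_integral_derivative:
  assumes "periodic F" and "\<And>x. (F has_vector_derivative f x) (at x)" and "continuous_on UNIV f"
  shows "torus_integral f = 0"
proof -
  have "(f has_integral (F (2 * pi) - F 0)) {0..2 * pi}"
    by (rule fundamental_theorem_of_calculus)
      (auto intro: assms(2) has_vector_derivative_at_within)
  moreover have "F (2 * pi) = F 0"
    using assms(1) by (metis add_0 periodic_def)
  ultimately have "integral {0..2 * pi} f = 0"
    by (simp add: integral_unique)
  then show ?thesis
    using set_lebesgue_integral_eq_integral(2)[OF set_integrable_circle[OF assms(3)]]
    by (simp add: torus_integral_def)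
qed

lemma continuous_on_cis [continuous_intros]:
  "continuous_on S f \<Longrightarrow> continuous_on S (\<lambda>x. cis (f x))"
  unfolding cis_conv_exp by (intro continuous_intros)

lemma borel_measurable_cis [measurable]: "cis \<in> borel_measurable borel"
  by (intro borel_measurable_continuous_onI continuous_intros)

lemma has_vector_derivative_cis_mult:
  "((\<lambda>x. cis (c * x)) has_vector_derivative \<i> * of_real c * cis (c * x)) (at x)"
  unfolding has_vector_derivative_def
  by (rule has_derivative_eq_rhs, rule has_derivative_cis, rule derivative_intros,
      rule derivative_intros) (auto simp: scaleR_conv_of_real)

lemma cis_int_periodic: "cis (of_int k * (x + 2 * pi)) = cis (of_int k * x)"
proof -
  have "cis (of_int k * (2 * pi)) = 1"
    using cos_int_2pin[of k] sin_int_2pin[of k]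
    by (simp add: complex_eq_iff mult.commute[of "2 * pi"])
  then show ?thesis
    by (simp add: distrib_left flip: cis_mult)
qed

lemma torus_integral_cis:
  "torus_integral (\<lambda>x. cis (of_int k * x)) = (if k = 0 then 1 else 0)"
proof (cases "k = 0")
  case True
  then show ?thesis
    by (simp add: torus_integral_circle circle.prob_space[unfolded space_circle_measure])
next
  case False
  have "((\<lambda>x. cis (of_int k * x) / (\<i> * of_int k)) has_vector_derivative cis (of_int k * x)) (at x)" for x
    using has_vector_derivative_cis_mult[of "of_int k" x,
        THEN has_vector_derivative_mult_left[where a = "1 / (\<i> * of_int k)"]] False
    by simp
  then show ?thesis
    using False torus_integral_derivative[of "\<lambda>x. cis (of_int k * x) / (\<i> * of_int k)"
        "\<lambda>x. cis (of_int k * x)"]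
    by (simp add: periodic_def cis_int_periodic continuous_on_cis continuous_on_mult_left)
qed

text \<open>
  The pairing with the character of frequency \<open>k\<close>; it is the Fourier coefficient of \<open>\<psi>\<close>
  at \<open>- k\<close>, since the dual pairing is bilinear.
\<close>

definition test_coeff :: "int \<Rightarrow> (real \<Rightarrow> complex) \<Rightarrow> complex" where
  "test_coeff k \<psi> = torus_integral (\<lambda>x. cis (of_int k * x) * \<psi> x)"

lemma continuous_on_cis_times:
  "continuous_on UNIV \<psi> \<Longrightarrow> continuous_on UNIV (\<lambda>x::real. cis (c * x) * \<psi> x)"
  by (intro continuous_intros)

lemma test_coeff_bound:
  assumes "continuous_on UNIV \<psi>" and "\<And>x. cmod (\<psi> x) \<le> B"
  shows "cmod (test_coeff k \<psi>) \<le> B"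
  unfolding test_coeff_def
  by (rule torus_integral_bound)
    (use assms in \<open>auto simp: norm_mult intro!: borel_measurable_continuous_onI continuous_on_cis_times\<close>)

lemma test_coeff_linear:
  assumes "continuous_on UNIV \<psi>" "continuous_on UNIV \<eta>"
  shows "test_coeff k (\<lambda>x. c * \<psi> x + \<eta> x) = c * test_coeff k \<psi> + test_coeff k \<eta>"
proof -
  have "test_coeff k (\<lambda>x. c * \<psi> x + \<eta> x)
      = torus_integral (\<lambda>x. c * (cis (of_int k * x) * \<psi> x) + cis (of_int k * x) * \<eta> x)"
    by (simp add: test_coeff_def algebra_simps)
  also have "\<dots> = c * test_coeff k \<psi> + test_coeff k \<eta>"
    unfolding test_coeff_def using assms
    by (simp add: torus_integral_add torus_integral_cmult continuous_on_cis_times continuous_on_mult_left)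
  finally show ?thesis .
qed

lemma test_coeff_cis:
  "test_coeff k (\<lambda>x. cis (- (of_int n * x))) = (if k = n then 1 else 0)"
proof -
  have "test_coeff k (\<lambda>x. cis (- (of_int n * x))) = torus_integral (\<lambda>x. cis (of_int (k - n) * x))"
    by (simp add: test_coeff_def cis_mult algebra_simps)
  then show ?thesis using torus_integral_cis[of "k - n"] by simp
qed

lemma torus_smooth_continuous: "\<psi> \<in> torus_smooth \<Longrightarrow> continuous_on UNIV \<psi>"
  by (auto simp: torus_smooth_def dest!: spec[of _ 0] intro: differentiable_imp_continuous_on)

lemma torus_smooth_derivative:
  assumes "\<psi> \<in> torus_smooth"
  shows "(\<psi> has_vector_derivative vderiv \<psi> x) (at x)"
proof -
  have "\<psi> differentiable at x"
    using assms unfolding torus_smooth_def differentiable_on_def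
    by simp (metis funpow_0)
  then show ?thesis
    by (simp add: vderiv_def vector_derivative_works)
qed

text \<open>
  The derivative of a periodic function is periodic because derivatives are unique.
\<close>

lemma torus_smooth_vderiv:
  assumes "\<psi> \<in> torus_smooth"
  shows "vderiv \<psi> \<in> torus_smooth"
proof -
  have per: "\<psi> = (\<lambda>x. \<psi> (x + 2 * pi))"
    using assms by (auto simp: torus_smooth_def periodic_def)
  have "((\<lambda>y. \<psi> (y + 2 * pi)) has_vector_derivative vderiv \<psi> (x + 2 * pi)) (at x)" for x
    using vector_diff_chain_at[OF has_vector_derivative_add_const[THEN iffD2,
          OF has_vector_derivative_id] torus_smooth_derivative[OF assms], of "2 * pi" x]
    by (simp add: o_def)
  then have "vderiv \<psi> (x + 2 * pi) = vderiv \<psi> x" for x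
    using vector_derivative_unique_at[OF torus_smooth_derivative[OF assms, of x]] per by metis
  moreover have "(vderiv ^^ k) (vderiv \<psi>) differentiable_on UNIV" for k
    using assms by (auto simp: torus_smooth_def funpow_swap1 dest!: spec[of _ "Suc k"])
  ultimately show ?thesis
    by (simp add: torus_smooth_def periodic_def)
qed

lemma torus_smooth_funpow_vderiv: "\<psi> \<in> torus_smooth \<Longrightarrow> (vderiv ^^ l) \<psi> \<in> torus_smooth"
  by (induction l) (auto intro: torus_smooth_vderiv)

lemma test_coeff_vderiv:
  assumes "\<psi> \<in> torus_smooth"
  shows "test_coeff k (vderiv \<psi>) = - (\<i> * of_int k) * test_coeff k \<psi>"
proof -
  let ?e = "\<lambda>x. cis (of_int k * x)"
  have c: "continuous_on UNIV \<psi>" "continuous_on UNIV (vderiv \<psi>)"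
    using assms torus_smooth_vderiv torus_smooth_continuous by auto
  have "torus_integral (\<lambda>x. \<i> * of_int k * (?e x * \<psi> x) + ?e x * vderiv \<psi> x) = 0"
  proof (rule torus_integral_derivative)
    show "periodic (\<lambda>x. ?e x * \<psi> x)"
      using assms by (simp add: periodic_def cis_int_periodic torus_smooth_def)
    show "((\<lambda>x. ?e x * \<psi> x) has_vector_derivative
        \<i> * of_int k * (?e x * \<psi> x) + ?e x * vderiv \<psi> x) (at x)" for x
      using has_vector_derivative_mult[OF has_vector_derivative_cis_mult[of "of_int k"]
          torus_smooth_derivative[OF assms]]
      by (simp add: algebra_simps)
    show "continuous_on UNIV (\<lambda>x. \<i> * of_int k * (?e x * \<psi> x) + ?e x * vderiv \<psi> x)"
      by (intro continuous_intros c)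
  qed
  then show ?thesis
    using c by (simp add: test_coeff_def torus_integral_add torus_integral_cmult
        continuous_on_cis_times continuous_on_mult_left add_eq_0_iff)
qed

lemma test_coeff_funpow_vderiv:
  "\<psi> \<in> torus_smooth \<Longrightarrow>
    test_coeff k ((vderiv ^^ l) \<psi>) = (- (\<i> * of_int k)) ^ l * test_coeff k \<psi>"
  by (induction l) (simp_all add: test_coeff_vderiv torus_smooth_funpow_vderiv)

lemma japanese_power_le: "japanese y ^ l \<le> 2 ^ l * (1 + \<bar>y\<bar> ^ l)"
proof -
  have "japanese y ^ l \<le> (2 * max 1 \<bar>y\<bar>) ^ l"
    by (intro power_mono) (use japanese_le[of y] in auto)
  also have "\<dots> = 2 ^ l * (max 1 \<bar>y\<bar>) ^ l"
    by (rule power_mult_distrib)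
  also have "(max 1 \<bar>y\<bar>) ^ l \<le> 1 + \<bar>y\<bar> ^ l"
    by (auto simp: max_def)
  finally show ?thesis by simp
qed

text \<open>
  Integrating by parts \<open>l\<close> times gains the factor \<open>|k| ^ l\<close>; the bound on \<open>\<psi>\<close> itself takes care
  of small \<open>k\<close>.  The two bounds enter as free constants, because they will carry the decay in time
  when \<open>\<psi>\<close> is a time slice of a Schwartz function.
\<close>

lemma test_coeff_decay:
  assumes "\<psi> \<in> torus_smooth" and "\<And>x. cmod (\<psi> x) \<le> B0" and "\<And>x. cmod ((vderiv ^^ l) \<psi> x) \<le> B"
  shows "cmod (test_coeff k \<psi>) \<le> 2 ^ l * (B0 + B) / japanese (of_int k) ^ l"
proof -
  have "\<bar>of_int k\<bar> ^ l * cmod (test_coeff k \<psi>) = cmod (test_coeff k ((vderiv ^^ l) \<psi>))"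
    using assms(1) by (simp add: test_coeff_funpow_vderiv norm_mult norm_power)
  also have "\<dots> \<le> B"
    by (rule test_coeff_bound)
      (use assms torus_smooth_continuous torus_smooth_funpow_vderiv in auto)
  finally have B: "\<bar>of_int k\<bar> ^ l * cmod (test_coeff k \<psi>) \<le> B" .
  have "japanese (of_int k) ^ l * cmod (test_coeff k \<psi>)
      \<le> 2 ^ l * (1 + \<bar>of_int k\<bar> ^ l) * cmod (test_coeff k \<psi>)"
    by (rule mult_right_mono[OF japanese_power_le]) simp
  also have "\<dots> = 2 ^ l * (cmod (test_coeff k \<psi>) + \<bar>of_int k\<bar> ^ l * cmod (test_coeff k \<psi>))"
    by (simp add: algebra_simps)
  also have "\<dots> \<le> 2 ^ l * (B0 + B)"
    using B test_coeff_bound[OF torus_smooth_continuous[OF assms(1)] assms(2)]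
    by (intro mult_left_mono add_mono) auto
  finally show ?thesis
    by (simp add: pos_le_divide_eq mult.commute)
qed

text \<open>
  Makes the suprema in the seminorms of smooth functions on the torus suprema of bounded sets.
\<close>

lemma periodic_bounded:
  assumes "periodic f" "continuous_on UNIV f"
  shows "bdd_above (range (\<lambda>x. cmod (f x)))"
proof -
  have "compact (f ` {0..2 * pi})"
    by (rule compact_continuous_image) (use assms(2) continuous_on_subset in auto)
  then have "bounded (f ` {0..2 * pi})"
    by (rule compact_imp_bounded)
  then obtain B where B: "\<And>x. x \<in> {0..2 * pi} \<Longrightarrow> cmod (f x) \<le> B"
    unfolding bounded_iff by blast
  have shift: "f (x + of_int n * (2 * pi)) = f x" for x n
  proof (induction n rule: int_induct[where k = 0])
    case (step1 i)
    then show ?case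
      using assms(1)[unfolded periodic_def, rule_format, of "x + of_int i * (2 * pi)"]
      by (simp add: algebra_simps)
  next
    case (step2 i)
    then show ?case
      using assms(1)[unfolded periodic_def, rule_format, of "x + of_int (i - 1) * (2 * pi)"]
      by (simp add: algebra_simps)
  qed simp
  have "cmod (f x) \<le> B" for x
  proof -
    define n where "n = \<lfloor>x / (2 * pi)\<rfloor>"
    have "of_int n \<le> x / (2 * pi)" "x / (2 * pi) < of_int n + 1"
      unfolding n_def by linarith+
    then have "x - of_int n * (2 * pi) \<in> {0..2 * pi}"
      by (simp add: field_simps)
    then show ?thesis
      using B[of "x - of_int n * (2 * pi)"] shift[of "x - of_int n * (2 * pi)" n] by simp
  qed
  then show ?thesis by (intro bdd_aboveI[where M = B]) auto
qed

lemma torus_smooth_le_SUP: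
  "\<psi> \<in> torus_smooth \<Longrightarrow> cmod ((vderiv ^^ l) \<psi> x) \<le> (SUP x. cmod ((vderiv ^^ l) \<psi> x))"
  by (rule cSUP_upper) (use torus_smooth_funpow_vderiv[of \<psi> l] torus_smooth_continuous in
    \<open>auto intro!: periodic_bounded simp: torus_smooth_def\<close>)

text \<open>
  The value at time \<open>t\<close> of the superposition of the waves \<open>a i * exp (i t \<omega>_i) * exp (i \<kappa>_i x)\<close>,
  as a distribution on the torus.  The index set is abstract; in the application it consists
  of pairs of frequencies.
\<close>

section \<open>Superpositions of plane waves with values in a Sobolev space\<close>

definition wave_slice ::
  "('i \<Rightarrow> int) \<Rightarrow> ('i \<Rightarrow> real) \<Rightarrow> ('i \<Rightarrow> complex) \<Rightarrow> real \<Rightarrow> (real \<Rightarrow> complex) \<Rightarrow> complex" where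
  "wave_slice \<kappa> \<omega> a t \<psi> = (\<Sum>\<^sub>\<infinity>i\<in>UNIV. a i * cis (t * \<omega> i) * test_coeff (\<kappa> i) \<psi>)"

text \<open>
  The waves with the same frequency \<open>j\<close> in space add up to the Fourier coefficient at \<open>j\<close>, which
  this absolute sum bounds at every time.
\<close>

definition fibre_mass :: "('i \<Rightarrow> int) \<Rightarrow> ('i \<Rightarrow> complex) \<Rightarrow> int \<Rightarrow> real" where
  "fibre_mass \<kappa> a j = (\<Sum>\<^sub>\<infinity>i\<in>\<kappa> -` {j}. cmod (a i))"

text \<open>
  The condition under which the superposition lies in the Sobolev space of order \<open>r\<close> whatever the
  phases are.
\<close>

definition sobolev_amplitudes :: "real \<Rightarrow> ('i \<Rightarrow> int) \<Rightarrow> ('i \<Rightarrow> complex) \<Rightarrow> bool" where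
  "sobolev_amplitudes r \<kappa> a \<longleftrightarrow>
     (\<forall>j. (\<lambda>i. cmod (a i)) summable_on \<kappa> -` {j}) \<and>
     (\<lambda>j. (japanese (of_int j) powr r * fibre_mass \<kappa> a j)\<^sup>2) summable_on UNIV"

lemma fibre_mass_nonneg [simp]: "0 \<le> fibre_mass \<kappa> a j"
  by (simp add: fibre_mass_def infsum_nonneg)

lemma sobolev_amplitudes_mono:
  assumes "sobolev_amplitudes r \<kappa> a" and "\<And>i. cmod (b i) \<le> cmod (a i)"
  shows "sobolev_amplitudes r \<kappa> b" and "fibre_mass \<kappa> b j \<le> fibre_mass \<kappa> a j"
proof -
  have s: "(\<lambda>i. cmod (b i)) summable_on \<kappa> -` {j}" for j
    by (rule norm_dominated_summable(1)[where h = "\<lambda>i. cmod (a i)"])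
      (use assms in \<open>auto simp: sobolev_amplitudes_def\<close>)
  have m: "fibre_mass \<kappa> b j \<le> fibre_mass \<kappa> a j" for j
    unfolding fibre_mass_def
    by (rule infsum_mono) (use assms s in \<open>auto simp: sobolev_amplitudes_def\<close>)
  show "fibre_mass \<kappa> b j \<le> fibre_mass \<kappa> a j"
    by (rule m)
  have "(\<lambda>j. (japanese (of_int j) powr r * fibre_mass \<kappa> b j)\<^sup>2) summable_on UNIV"
  proof (rule summable_on_comparison_test)
    show "(\<lambda>j. (japanese (of_int j) powr r * fibre_mass \<kappa> a j)\<^sup>2) summable_on UNIV"
      using assms(1) by (simp add: sobolev_amplitudes_def)
  qed (auto intro!: power_mono mult_left_mono m)
  then show "sobolev_amplitudes r \<kappa> b"
    using s by (simp add: sobolev_amplitudes_def)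
qed

text \<open>
  A finite set of indices meets finitely many fibres, so its sum is at most the sum of \<open>G\<close>.
\<close>

lemma summable_on_fibres:
  fixes g :: "'i \<Rightarrow> real" and \<kappa> :: "'i \<Rightarrow> 'j"
  assumes nonneg: "\<And>i. 0 \<le> g i"
    and fibres: "\<And>j. g summable_on \<kappa> -` {j}" "\<And>j. infsum g (\<kappa> -` {j}) \<le> G j"
    and G: "G summable_on UNIV"
  shows "g summable_on UNIV"
proof (rule nonneg_bdd_above_summable_on)
  have Gnonneg: "0 \<le> G j" for j
    using infsum_nonneg[of "\<kappa> -` {j}" g] nonneg fibres(2)[of j] by (meson order_trans)
  have "sum g F \<le> infsum G UNIV" if "finite F" for F
  proof -
    have "sum g F = (\<Sum>j\<in>\<kappa> ` F. sum g {i\<in>F. \<kappa> i = j})"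
      by (rule sum.image_gen[OF that])
    also have "\<dots> \<le> (\<Sum>j\<in>\<kappa> ` F. G j)"
    proof (rule sum_mono)
      fix j
      have "sum g {i\<in>F. \<kappa> i = j} \<le> infsum g (\<kappa> -` {j})"
        by (rule finite_sum_le_infsum) (use fibres nonneg that in auto)
      with fibres(2)[of j] show "sum g {i\<in>F. \<kappa> i = j} \<le> G j" by simp
    qed
    also have "\<dots> \<le> infsum G UNIV"
      by (rule finite_sum_le_infsum) (use G Gnonneg that in auto)
    finally show ?thesis .
  qed
  then show "bdd_above (sum g ` {F. F \<subseteq> UNIV \<and> finite F})"
    by (intro bdd_aboveI[where M = "infsum G UNIV"]) auto
qed (use nonneg in auto)

text \<open>
  Square summability bounds \<open>\<langle>j\<rangle> powr r * fibre_mass j\<close>, so dividing by at least \<open>2 - r\<close> powers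
  of \<open>\<langle>j\<rangle>\<close> leaves the summable weight \<open>\<langle>j\<rangle> powr (- 2)\<close>.
\<close>

lemma amplitudes_summable:
  assumes a: "sobolev_amplitudes r \<kappa> a" and l: "real l \<ge> 2 - r"
  shows "(\<lambda>i. cmod (a i) / japanese (of_int (\<kappa> i)) ^ l) summable_on UNIV"
proof -
  let ?q = "\<lambda>j. (japanese (of_int j) powr r * fibre_mass \<kappa> a j)\<^sup>2"
  have q: "?q summable_on UNIV" and fib: "\<And>j. (\<lambda>i. cmod (a i)) summable_on \<kappa> -` {j}"
    using a by (auto simp: sobolev_amplitudes_def)
  define C where "C = sqrt (infsum ?q UNIV)"
  have C: "japanese (of_int j) powr r * fibre_mass \<kappa> a j \<le> C" for j
  proof -
    have "?q j \<le> infsum ?q UNIV"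
      using finite_sum_le_infsum[OF q, of "{j}"] by auto
    then show ?thesis
      unfolding C_def by (rule real_le_rsqrt)
  qed
  show ?thesis
  proof (rule summable_on_fibres[where \<kappa> = \<kappa>])
    show "(\<lambda>i. cmod (a i) / japanese (of_int (\<kappa> i)) ^ l) summable_on \<kappa> -` {j}" for j
      using summable_on_cmult_left[OF fib[of j], of "1 / japanese (of_int j) ^ l"]
      by (rule summable_on_cong[THEN iffD1, rotated]) auto
    show "infsum (\<lambda>i. cmod (a i) / japanese (of_int (\<kappa> i)) ^ l) (\<kappa> -` {j})
      \<le> C * japanese (of_int j) powr (- 2)" for j
    proof -
      have "infsum (\<lambda>i. cmod (a i) / japanese (of_int (\<kappa> i)) ^ l) (\<kappa> -` {j})
          = infsum (\<lambda>i. cmod (a i) * (1 / japanese (of_int j) ^ l)) (\<kappa> -` {j})"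
        by (rule infsum_cong) auto
      also have "\<dots> = fibre_mass \<kappa> a j * (1 / japanese (of_int j) ^ l)"
        unfolding fibre_mass_def by (rule infsum_cmult_left')
      also have "\<dots> = fibre_mass \<kappa> a j * japanese (of_int j) powr (- real l)"
        by (simp add: powr_minus powr_realpow divide_inverse)
      also have "\<dots> \<le> fibre_mass \<kappa> a j * japanese (of_int j) powr (r + (- 2))"
        using l japanese_ge_1 by (intro mult_left_mono powr_mono) auto
      also have "\<dots> = (japanese (of_int j) powr r * fibre_mass \<kappa> a j) * japanese (of_int j) powr (- 2)"
        by (simp only: powr_add mult_ac)
      also have "\<dots> \<le> C * japanese (of_int j) powr (- 2)"
        by (rule mult_right_mono[OF C]) simp
      finally show ?thesis .
    qed
    show "(\<lambda>j. C * japanese (of_int j) powr (- 2)) summable_on UNIV"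
      by (rule summable_on_cmult_right) (rule summable_on_japanese, simp)
  qed simp
qed

lemma wave_slice_summable:
  assumes a: "sobolev_amplitudes r \<kappa> a" and l: "real l \<ge> 2 - r"
    and d: "\<And>k. cmod (test_coeff k \<psi>) \<le> C / japanese (of_int k) ^ l"
  shows "(\<lambda>i. a i * cis (t * \<omega> i) * test_coeff (\<kappa> i) \<psi>) summable_on UNIV"
    and "cmod (wave_slice \<kappa> \<omega> a t \<psi>)
      \<le> C * (\<Sum>\<^sub>\<infinity>i\<in>UNIV. cmod (a i) / japanese (of_int (\<kappa> i)) ^ l)"
proof -
  have s: "(\<lambda>i. C * (cmod (a i) / japanese (of_int (\<kappa> i)) ^ l)) summable_on UNIV"
    by (rule summable_on_cmult_right[OF amplitudes_summable[OF a l]])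
  have b: "cmod (a i * cis (t * \<omega> i) * test_coeff (\<kappa> i) \<psi>)
      \<le> C * (cmod (a i) / japanese (of_int (\<kappa> i)) ^ l)" for i
    using mult_left_mono[OF d[of "\<kappa> i"], of "cmod (a i)"] by (simp add: norm_mult mult_ac)
  show "(\<lambda>i. a i * cis (t * \<omega> i) * test_coeff (\<kappa> i) \<psi>) summable_on UNIV"
    by (rule norm_dominated_summable(2)[OF s b])
  have "cmod (wave_slice \<kappa> \<omega> a t \<psi>)
      \<le> (\<Sum>\<^sub>\<infinity>i\<in>UNIV. C * (cmod (a i) / japanese (of_int (\<kappa> i)) ^ l))"
    unfolding wave_slice_def
    by (rule norm_infsum_le[OF has_sum_infsum[OF norm_dominated_summable(2)[OF s b]] has_sum_infsum[OF s] b])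
  then show "cmod (wave_slice \<kappa> \<omega> a t \<psi>)
      \<le> C * (\<Sum>\<^sub>\<infinity>i\<in>UNIV. cmod (a i) / japanese (of_int (\<kappa> i)) ^ l)"
    by (simp only: infsum_cmult_right')
qed

text \<open>
  The Fourier coefficients of a smooth function decay faster than the amplitudes can grow.
\<close>

lemma wave_slice_distribution:
  assumes a: "sobolev_amplitudes r \<kappa> a"
  shows "wave_slice \<kappa> \<omega> a t \<in> torus_distributions"
proof -
  obtain l :: nat where l: "real l \<ge> 2 - r"
    using real_arch_simple by blast
  define S where "S = (\<lambda>\<psi>. \<Sum>k\<le>l. SUP x. cmod ((vderiv ^^ k) \<psi> x))"
  have nonneg: "0 \<le> (SUP x. cmod ((vderiv ^^ k) \<psi> x))" if "\<psi> \<in> torus_smooth" for \<psi> k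
    by (rule order_trans[OF norm_ge_zero torus_smooth_le_SUP[OF that]])
  have le: "(SUP x. cmod ((vderiv ^^ k) \<psi> x)) \<le> S \<psi>" if "\<psi> \<in> torus_smooth" "k \<le> l" for \<psi> k
    unfolding S_def by (rule member_le_sum) (use that nonneg in auto)
  have decay: "cmod (test_coeff k \<psi>) \<le> 2 ^ l * (2 * S \<psi>) / japanese (of_int k) ^ l"
    if "\<psi> \<in> torus_smooth" for \<psi> k
  proof -
    have "cmod (test_coeff k \<psi>) \<le> 2 ^ l * (S \<psi> + S \<psi>) / japanese (of_int k) ^ l"
    proof (rule test_coeff_decay[OF that])
      show "cmod (\<psi> x) \<le> S \<psi>" for x
        using torus_smooth_le_SUP[OF that, of 0 x] le[OF that, of 0] by simp
      show "cmod ((vderiv ^^ l) \<psi> x) \<le> S \<psi>" for x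
        using torus_smooth_le_SUP[OF that, of l x] le[OF that, of l] by simp
    qed
    then show ?thesis by simp
  qed
  have lin: "wave_slice \<kappa> \<omega> a t (\<lambda>x. c * \<psi> x + \<eta> x)
      = c * wave_slice \<kappa> \<omega> a t \<psi> + wave_slice \<kappa> \<omega> a t \<eta>"
    if "\<psi> \<in> torus_smooth" "\<eta> \<in> torus_smooth" for \<psi> \<eta> c
  proof -
    have "wave_slice \<kappa> \<omega> a t (\<lambda>x. c * \<psi> x + \<eta> x) = (\<Sum>\<^sub>\<infinity>i\<in>UNIV.
        c * (a i * cis (t * \<omega> i) * test_coeff (\<kappa> i) \<psi>) + a i * cis (t * \<omega> i) * test_coeff (\<kappa> i) \<eta>)"
      unfolding wave_slice_def using that
      by (intro infsum_cong, subst test_coeff_linear)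
        (auto simp: torus_smooth_continuous distrib_left mult_ac)
    also have "\<dots> = c * wave_slice \<kappa> \<omega> a t \<psi> + wave_slice \<kappa> \<omega> a t \<eta>"
      unfolding wave_slice_def
      by (subst infsum_add)
        (auto simp: infsum_cmult_right' intro!: summable_on_cmult_right
          wave_slice_summable(1)[OF a l decay] that)
    finally show ?thesis .
  qed
  define K where "K = (\<Sum>\<^sub>\<infinity>i\<in>UNIV. cmod (a i) / japanese (of_int (\<kappa> i)) ^ l)"
  have "cmod (wave_slice \<kappa> \<omega> a t \<psi>) \<le> 2 ^ l * 2 * K * (\<Sum>k\<le>l. SUP x. cmod ((vderiv ^^ k) \<psi> x))"
    if "\<psi> \<in> torus_smooth" for \<psi>
    using wave_slice_summable(2)[OF a l decay[OF that], of \<omega> t] by (simp add: K_def S_def mult_ac)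
  then show ?thesis
    unfolding torus_distributions_def using lin by blast
qed

lemma wave_slice_coeff:
  "dist_coeff (wave_slice \<kappa> \<omega> a t) n = (\<Sum>\<^sub>\<infinity>i\<in>\<kappa> -` {n}. a i * cis (t * \<omega> i))"
  unfolding dist_coeff_def wave_slice_def
  by (rule infsum_cong_neutral) (auto simp: test_coeff_cis)

lemma wave_slice_coeff_bound:
  assumes "sobolev_amplitudes r \<kappa> a"
  shows "cmod (dist_coeff (wave_slice \<kappa> \<omega> a t) n) \<le> fibre_mass \<kappa> a n"
  unfolding wave_slice_coeff fibre_mass_def
  by (rule order_trans[OF norm_infsum_bound])
    (use assms in \<open>auto simp: norm_mult sobolev_amplitudes_def\<close>)

lemma wave_slice_sobolev:
  assumes a: "sobolev_amplitudes r \<kappa> a"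
  shows "wave_slice \<kappa> \<omega> a t \<in> sobolev r"
    and "sobolev_norm r (wave_slice \<kappa> \<omega> a t)
      \<le> sqrt (\<Sum>\<^sub>\<infinity>j\<in>UNIV. (japanese (of_int j) powr r * fibre_mass \<kappa> a j)\<^sup>2)"
proof -
  let ?f = "\<lambda>n. (japanese (of_int n) powr r * cmod (dist_coeff (wave_slice \<kappa> \<omega> a t) n))\<^sup>2"
  let ?q = "\<lambda>j. (japanese (of_int j) powr r * fibre_mass \<kappa> a j)\<^sup>2"
  have q: "?q summable_on UNIV"
    using a by (auto simp: sobolev_amplitudes_def)
  have le: "?f n \<le> ?q n" for n
    by (intro power_mono mult_left_mono wave_slice_coeff_bound[OF a]) auto
  have s: "?f summable_on UNIV"
    by (rule summable_on_comparison_test[OF q]) (use le in auto)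
  then show "wave_slice \<kappa> \<omega> a t \<in> sobolev r"
    using wave_slice_distribution[OF a] by (simp add: sobolev_def)
  show "sobolev_norm r (wave_slice \<kappa> \<omega> a t) \<le> sqrt (infsum ?q UNIV)"
    unfolding sobolev_norm_def by (intro real_sqrt_le_mono infsum_mono s q le)
qed

text \<open>
  Dominated convergence is applied twice: within each fibre, and then to the sum over the
  frequencies.  Continuity in the norm replaces the approximation of vector-valued functions when
  strong measurability is proved.
\<close>

lemma wave_slice_norm_continuous:
  assumes a: "sobolev_amplitudes r \<kappa> a"
  shows "continuous_on UNIV (\<lambda>t. sobolev_norm r (wave_slice \<kappa> \<omega> a t))"
    and "((\<lambda>t'. sobolev_norm r (\<lambda>\<psi>. wave_slice \<kappa> \<omega> a t \<psi> - wave_slice \<kappa> \<omega> a t' \<psi>)) \<longlongrightarrow> 0) (at t)"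
proof -
  have q: "(\<lambda>j. (japanese (of_int j) powr r * fibre_mass \<kappa> a j)\<^sup>2) summable_on UNIV"
    and fib: "\<And>j. (\<lambda>i. cmod (a i)) summable_on \<kappa> -` {j}"
    using a by (auto simp: sobolev_amplitudes_def)
  let ?c = "\<lambda>t n. dist_coeff (wave_slice \<kappa> \<omega> a t) n"
  have c: "((\<lambda>t'. ?c t' n) \<longlongrightarrow> ?c t n) (at t)" for t n
    unfolding wave_slice_coeff
  proof (rule infsum_dominated_convergence[OF _ fib])
    show "((\<lambda>t'. a i * cis (t' * \<omega> i)) \<longlongrightarrow> a i * cis (t * \<omega> i)) (at t)" for i
      unfolding cis_conv_exp by (intro tendsto_intros)
  qed (simp add: norm_mult)
  have "((\<lambda>t'. \<Sum>\<^sub>\<infinity>n\<in>UNIV. (japanese (of_int n) powr r * cmod (?c t' n))\<^sup>2)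
      \<longlongrightarrow> (\<Sum>\<^sub>\<infinity>n\<in>UNIV. (japanese (of_int n) powr r * cmod (?c t n))\<^sup>2)) (at t)" for t
  proof (rule infsum_dominated_convergence[OF _ q])
    show "norm ((japanese (of_int n) powr r * cmod (?c t' n))\<^sup>2)
      \<le> (japanese (of_int n) powr r * fibre_mass \<kappa> a n)\<^sup>2" for t' n
      by (subst real_norm_def, subst abs_of_nonneg)
        (auto intro!: power_mono mult_left_mono wave_slice_coeff_bound[OF a])
  qed (intro tendsto_intros c)
  then show "continuous_on UNIV (\<lambda>t. sobolev_norm r (wave_slice \<kappa> \<omega> a t))"
    unfolding sobolev_norm_def continuous_on_def by (auto intro!: tendsto_real_sqrt)
  have q4: "(\<lambda>j. 4 * (japanese (of_int j) powr r * fibre_mass \<kappa> a j)\<^sup>2) summable_on UNIV"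
    by (rule summable_on_cmult_right[OF q])
  have "((\<lambda>t'. \<Sum>\<^sub>\<infinity>n\<in>UNIV. (japanese (of_int n) powr r * cmod (?c t n - ?c t' n))\<^sup>2)
      \<longlongrightarrow> (\<Sum>\<^sub>\<infinity>n\<in>(UNIV::int set). (japanese (of_int n) powr r * cmod (?c t n - ?c t n))\<^sup>2)) (at t)"
  proof (rule infsum_dominated_convergence[OF _ q4])
    fix t' n
    have "cmod (?c t n - ?c t' n) \<le> 2 * fibre_mass \<kappa> a n"
      using norm_triangle_ineq4[of "?c t n" "?c t' n"] wave_slice_coeff_bound[OF a, of \<omega> _ n]
      by (smt (verit))
    then have "(japanese (of_int n) powr r * cmod (?c t n - ?c t' n))\<^sup>2
      \<le> (japanese (of_int n) powr r * (2 * fibre_mass \<kappa> a n))\<^sup>2"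
      by (intro power_mono mult_left_mono) auto
    then show "norm ((japanese (of_int n) powr r * cmod (?c t n - ?c t' n))\<^sup>2)
      \<le> 4 * (japanese (of_int n) powr r * fibre_mass \<kappa> a n)\<^sup>2"
      by (simp add: power_mult_distrib)
  qed (intro tendsto_intros c)
  then show "((\<lambda>t'. sobolev_norm r (\<lambda>\<psi>. wave_slice \<kappa> \<omega> a t \<psi> - wave_slice \<kappa> \<omega> a t' \<psi>)) \<longlongrightarrow> 0) (at t)"
    unfolding sobolev_norm_def
    by (auto simp: dist_coeff_def intro!: tendsto_eq_intros)
qed

text \<open>
  Evaluating the continuous map at a simple approximation of the identity of the line gives simple
  functions with values in the Sobolev space that converge at every time.
\<close>

lemma wave_slice_Linf:
  assumes a: "sobolev_amplitudes r \<kappa> a"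
  shows "wave_slice \<kappa> \<omega> a \<in> Linf_sobolev r"
    and "Linf_norm r (wave_slice \<kappa> \<omega> a)
      \<le> ereal (sqrt (\<Sum>\<^sub>\<infinity>j\<in>UNIV. (japanese (of_int j) powr r * fibre_mass \<kappa> a j)\<^sup>2))"
proof -
  have "(\<lambda>t. sobolev_norm r (wave_slice \<kappa> \<omega> a t)) \<in> borel_measurable borel"
    by (rule borel_measurable_continuous_onI[OF wave_slice_norm_continuous(1)[OF a]])
  then have [measurable]: "(\<lambda>t. sobolev_norm r (wave_slice \<kappa> \<omega> a t)) \<in> borel_measurable lebesgue"
    by (intro measurable_completion) simp
  show le: "Linf_norm r (wave_slice \<kappa> \<omega> a)
      \<le> ereal (sqrt (\<Sum>\<^sub>\<infinity>j\<in>UNIV. (japanese (of_int j) powr r * fibre_mass \<kappa> a j)\<^sup>2))"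
    unfolding Linf_norm_def
    by (rule esssup_I) (use wave_slice_sobolev(2)[OF a] in auto)
  have "sobolev_measurable r (wave_slice \<kappa> \<omega> a)"
  proof -
    have meas: "(\<lambda>x::real. x) \<in> borel_measurable lebesgue"
      by (rule measurable_completion) simp
    obtain \<rho> :: "nat \<Rightarrow> real \<Rightarrow> real"
      where "\<forall>k. simple_function lebesgue (\<rho> k)" "\<forall>t\<in>space lebesgue. (\<lambda>k. \<rho> k t) \<longlonglongrightarrow> t"
      using borel_measurable_implies_sequence_metric[OF meas, of 0]
      by (elim exE conjE) (rule that)
    then have \<rho>: "\<And>k. simple_function lebesgue (\<rho> k)" "\<And>t. (\<lambda>k. \<rho> k t) \<longlonglongrightarrow> t"
      by simp_all
    have "(\<lambda>k. sobolev_norm r (\<lambda>\<psi>. wave_slice \<kappa> \<omega> a t \<psi> - wave_slice \<kappa> \<omega> a (\<rho> k t) \<psi>)) \<longlonglongrightarrow> 0" for t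
    proof (rule filterlim_compose[OF _ \<rho>(2)[of t]])
      have "sobolev_norm r (\<lambda>\<psi>. 0) = 0"
        by (simp add: sobolev_norm_def dist_coeff_def)
      then show "((\<lambda>t'. sobolev_norm r (\<lambda>\<psi>. wave_slice \<kappa> \<omega> a t \<psi> - wave_slice \<kappa> \<omega> a t' \<psi>)) \<longlongrightarrow> 0) (nhds t)"
        using wave_slice_norm_continuous(2)[OF a, of \<omega> t] by (simp add: tendsto_nhds_iff)
    qed
    then show ?thesis
      unfolding sobolev_measurable_def
      by (intro exI[of _ "\<lambda>k t. wave_slice \<kappa> \<omega> a (\<rho> k t)"])
        (auto intro!: simple_function_compose1 \<rho>(1) wave_slice_sobolev(1)[OF a])
  qed
  then show "wave_slice \<kappa> \<omega> a \<in> Linf_sobolev r"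
    using le wave_slice_sobolev(1)[OF a] by (auto simp: Linf_sobolev_def)
qed

section \<open>Integration over the time line\<close>

lemma integrable_inverse_square: "integrable lborel (\<lambda>t::real. 1 / (1 + t\<^sup>2))"
  using integrable_inverse_1_plus_square by (simp add: set_integrable_def inverse_eq_divide)

lemma integral_inverse_square: "(LINT t|lborel. 1 / (1 + t\<^sup>2)) = pi"
  using LBINT_inverse_1_plus_square
  by (simp add: interval_lebesgue_integral_def set_lebesgue_integral_def inverse_eq_divide)

text \<open>
  The weight \<open>1 / (1 + t\<^sup>2)\<close> is the integrable majorant used for all functions of time below.
\<close>

lemma decaying_integrable:
  fixes f :: "real \<Rightarrow> complex"
  assumes "f \<in> borel_measurable borel" and "\<And>t. cmod (f t) \<le> C / (1 + t\<^sup>2)"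
  shows "integrable lborel f" and "cmod (LINT t|lborel. f t) \<le> pi * C"
proof -
  have i: "integrable lborel (\<lambda>t::real. C / (1 + t\<^sup>2))"
    using integrable_mult_right[OF integrable_inverse_square, of C] by simp
  have C: "0 \<le> C / (1 + t\<^sup>2)" for t :: real
    using assms(2)[of t] norm_ge_zero order_trans by blast
  show f: "integrable lborel f"
  proof (rule Bochner_Integration.integrable_bound[OF i])
    show "AE t in lborel. norm (f t) \<le> norm (C / (1 + t\<^sup>2))"
      using assms(2) C by (simp only: real_norm_def abs_of_nonneg) simp
  qed (use assms in simp)
  have "cmod (LINT t|lborel. f t) \<le> (LINT t|lborel. C / (1 + t\<^sup>2))"
    by (rule Bochner_Integration.integral_norm_bound_integral[OF f i]) (use assms in auto)
  also have "\<dots> = (LINT t|lborel. C * (1 / (1 + t\<^sup>2)))"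
    by simp
  also have "\<dots> = pi * C"
    by (subst integral_mult_right_zero) (simp add: integral_inverse_square)
  finally show "cmod (LINT t|lborel. f t) \<le> pi * C" .
qed

lemma decaying_tendsto_0:
  fixes f :: "real \<Rightarrow> complex"
  assumes "\<And>t. cmod (f t) \<le> C / (1 + t\<^sup>2)"
  shows "(f \<longlongrightarrow> 0) at_top" and "(f \<longlongrightarrow> 0) at_bot"
proof -
  have "((\<lambda>t::real. C / (1 + t\<^sup>2)) \<longlongrightarrow> 0) at_top" "((\<lambda>t::real. C / (1 + t\<^sup>2)) \<longlongrightarrow> 0) at_bot"
    by real_asymp+
  then show "(f \<longlongrightarrow> 0) at_top" "(f \<longlongrightarrow> 0) at_bot"
    by (auto intro!: Lim_null_comparison[where g = "\<lambda>t. C / (1 + t\<^sup>2)"] always_eventually assms)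
qed

text \<open>
  Integration by parts over the whole line; the boundary terms vanish by the decay of \<open>f\<close>.
\<close>

lemma integral_cis_derivative:
  fixes f f' :: "real \<Rightarrow> complex"
  assumes der: "\<And>t. (f has_vector_derivative f' t) (at t)"
    and cont: "continuous_on UNIV f'"
    and f: "\<And>t. cmod (f t) \<le> C / (1 + t\<^sup>2)" and f': "\<And>t. cmod (f' t) \<le> C' / (1 + t\<^sup>2)"
  shows "(LINT t|lborel. cis (t * w) * f' t) = - (\<i> * of_real w) * (LINT t|lborel. cis (t * w) * f t)"
proof -
  have cf: "continuous_on UNIV f"
    using der by (auto intro!: continuous_at_imp_continuous_on has_vector_derivative_continuous)
  have i: "integrable lborel (\<lambda>t. cis (t * w) * f t)" "integrable lborel (\<lambda>t. cis (t * w) * f' t)"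
    using f f' by (auto intro!: decaying_integrable borel_measurable_continuous_onI continuous_intros cf cont
        simp: norm_mult)
  let ?g = "\<lambda>t. \<i> * of_real w * (cis (t * w) * f t) + cis (t * w) * f' t"
  have cg: "continuous_on UNIV ?g"
    by (intro continuous_intros cf cont)
  have "(LBINT t=-\<infinity>..\<infinity>. ?g t) = 0 - 0"
  proof (rule interval_integral_FTC_integrable[where F = "\<lambda>t. cis (t * w) * f t"])
    show "((\<lambda>t. cis (t * w) * f t) has_vector_derivative ?g t) (at t)" for t
      using has_vector_derivative_mult[OF has_vector_derivative_cis_mult[of w t] der[of t]]
      by (simp add: algebra_simps)
    show "isCont ?g t" for t
      using cg by (simp add: continuous_on_eq_continuous_at)
    show "set_integrable lborel (einterval (- \<infinity>) \<infinity>) ?g"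
      using i by (simp add: set_integrable_def)
    have "\<And>t. cmod (cis (t * w) * f t) \<le> C / (1 + t\<^sup>2)"
      using f by (simp add: norm_mult)
    note lim = decaying_tendsto_0[OF this]
    show "(((\<lambda>t. cis (t * w) * f t) \<circ> real_of_ereal) \<longlongrightarrow> 0) (at_right (- \<infinity>))"
      "(((\<lambda>t. cis (t * w) * f t) \<circ> real_of_ereal) \<longlongrightarrow> 0) (at_left \<infinity>)"
      using lim by (simp_all add: ereal_tendsto_simps)
  qed simp
  then have "(LINT t|lborel. ?g t) = 0"
    by (simp add: interval_lebesgue_integral_def set_lebesgue_integral_def)
  then show ?thesis
    using i by (simp add: add_eq_0_iff)
qed

text \<open>
  Integrability for Fubini's theorem: a majorant that depends on time only is integrable over the
  product with any probability space.
\<close>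

lemma integrable_prob_pair:
  fixes F :: "real \<times> 'b \<Rightarrow> complex"
  assumes "prob_space M" and F: "F \<in> borel_measurable (lborel \<Otimes>\<^sub>M M)"
    and b: "\<And>t y. cmod (F (t, y)) \<le> g t" and g: "integrable lborel g"
  shows "integrable (lborel \<Otimes>\<^sub>M M) F"
proof -
  interpret M: prob_space M by fact
  interpret P: pair_sigma_finite lborel M ..
  have [measurable]: "g \<in> borel_measurable lborel"
    using g by simp
  have "integrable (lborel \<Otimes>\<^sub>M M) (\<lambda>p. g (fst p))"
  proof (rule P.Fubini_integrable)
    show "integrable lborel (\<lambda>x. LINT y|M. norm (g (fst (x, y))))"
      using g by (simp add: M.prob_space)
  qed auto
  then show ?thesis
    by (rule Bochner_Integration.integrable_bound) (use F b in \<open>auto simp: split_paired_all intro!: AE_I2 order_trans[OF b]\<close>)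
qed

section \<open>Schwartz functions and their pairing with plane waves\<close>

lemma schwartz_weight_le_seminorm:
  assumes "\<phi> \<in> schwartz"
  shows "\<bar>t\<bar> ^ k * cmod ((Dt ^^ a) ((Dx ^^ b) \<phi>) t x) \<le> schwartz_seminorm k a b \<phi>"
  using cSUP_upper[of "(t, x)" UNIV "schwartz_weight k a b \<phi>"] assms
  by (simp add: schwartz_def schwartz_seminorm_def schwartz_weight_def)

text \<open>
  The seminorm that controls \<open>(1 + t\<^sup>2)\<close> times a derivative.
\<close>

definition decay_seminorm :: "nat \<Rightarrow> nat \<Rightarrow> (real \<Rightarrow> real \<Rightarrow> complex) \<Rightarrow> real" where
  "decay_seminorm a b \<phi> = schwartz_seminorm 0 a b \<phi> + schwartz_seminorm 2 a b \<phi>"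

lemma schwartz_decay:
  assumes "\<phi> \<in> schwartz"
  shows "cmod ((Dt ^^ a) ((Dx ^^ b) \<phi>) t x) \<le> decay_seminorm a b \<phi> / (1 + t\<^sup>2)"
proof -
  have "(1 + t\<^sup>2) * cmod ((Dt ^^ a) ((Dx ^^ b) \<phi>) t x) \<le> decay_seminorm a b \<phi>"
    using schwartz_weight_le_seminorm[OF assms, of t 0 a b x]
      schwartz_weight_le_seminorm[OF assms, of t 2 a b x]
    by (simp add: decay_seminorm_def algebra_simps)
  then show ?thesis
    by (simp add: pos_le_divide_eq add_pos_nonneg mult.commute)
qed

lemma schwartz_seminorm_nonneg:
  assumes "\<phi> \<in> schwartz"
  shows "0 \<le> schwartz_seminorm k a b \<phi>"
  by (rule order_trans[OF _ schwartz_weight_le_seminorm[OF assms, of 0 _ _ _ 0]]) simp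

lemma schwartz_bounded:
  assumes "\<phi> \<in> schwartz"
  shows "cmod ((Dt ^^ a) ((Dx ^^ b) \<phi>) t x) \<le> decay_seminorm a b \<phi>"
  using schwartz_weight_le_seminorm[OF assms, of t 0 a b x] schwartz_seminorm_nonneg[OF assms, of 2 a b]
  by (simp add: decay_seminorm_def)

lemma schwartz_differentiable:
  assumes "\<phi> \<in> schwartz"
  shows "(\<lambda>(t, x). (Dt ^^ a) ((Dx ^^ b) \<phi>) t x) differentiable at (t, x)"
  using assms by (simp add: schwartz_def differentiable_on_def)

lemma schwartz_continuous:
  assumes "\<phi> \<in> schwartz"
  shows "continuous_on UNIV (\<lambda>(t, x). (Dt ^^ a) ((Dx ^^ b) \<phi>) t x)"
  using assms by (auto simp: schwartz_def intro: differentiable_imp_continuous_on)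

lemma schwartz_continuous_compose:
  assumes "\<phi> \<in> schwartz" "continuous_on S f" "continuous_on S g"
  shows "continuous_on S (\<lambda>z. (Dt ^^ a) ((Dx ^^ b) \<phi>) (f z) (g z))"
  using continuous_on_compose2[OF schwartz_continuous[OF assms(1), of a b]
      continuous_on_Pair[OF assms(2,3)]] by simp

text \<open>
  Total differentiability in the plane gives differentiability along the time axis.  The derivatives
  in \<open>t\<close> come after those in \<open>x\<close>, so differentiating in time stays within the family.
\<close>

lemma schwartz_Dt:
  assumes "\<phi> \<in> schwartz"
  shows "((\<lambda>t. (Dt ^^ a) ((Dx ^^ b) \<phi>) t x) has_vector_derivative (Dt ^^ Suc a) ((Dx ^^ b) \<phi>) t x) (at t)"
proof -
  have "(\<lambda>p. (Dt ^^ a) ((Dx ^^ b) \<phi>) (fst p) (snd p)) differentiable at (t, x)"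
    using schwartz_differentiable[OF assms, of a b t x] by (simp add: case_prod_unfold)
  then have "((\<lambda>p. (Dt ^^ a) ((Dx ^^ b) \<phi>) (fst p) (snd p)) \<circ> (\<lambda>t. (t, x))) differentiable at t"
    by (intro differentiable_chain_at) (auto intro!: derivative_intros)
  then show ?thesis
    by (simp add: Dt_def vderiv_def vector_derivative_works o_def)
qed

lemma Dx_funpow: "(Dx ^^ b) \<phi> t = (vderiv ^^ b) (\<phi> t)"
proof (induction b arbitrary: t)
  case (Suc b)
  have "Dx ((Dx ^^ b) \<phi>) t = vderiv ((Dx ^^ b) \<phi> t)"
    by (simp add: Dx_def fun_eq_iff)
  then show ?case
    by (simp add: Suc)
qed simp

lemma schwartz_slice_smooth:
  assumes "\<phi> \<in> schwartz"
  shows "\<phi> t \<in> torus_smooth"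
proof -
  have "(vderiv ^^ b) (\<phi> t) differentiable at x" for b x
  proof -
    have "(\<lambda>p. (Dx ^^ b) \<phi> (fst p) (snd p)) differentiable at (t, x)"
      using schwartz_differentiable[OF assms, of 0 b t x] by (simp add: case_prod_unfold)
    then have "((\<lambda>p. (Dx ^^ b) \<phi> (fst p) (snd p)) \<circ> (\<lambda>x. (t, x))) differentiable at x"
      by (intro differentiable_chain_at) (auto intro!: derivative_intros)
    then show ?thesis
      by (simp add: o_def Dx_funpow)
  qed
  then show ?thesis
    using assms by (simp add: torus_smooth_def schwartz_def differentiable_on_def)
qed

text \<open>
  The pairing of \<open>\<phi>\<close> with \<open>exp (i t w) * exp (i k x)\<close>, normalized on the torus.
\<close>

definition plane_wave :: "real \<Rightarrow> int \<Rightarrow> (real \<Rightarrow> real \<Rightarrow> complex) \<Rightarrow> complex" where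
  "plane_wave w k \<phi> = (LINT t|lebesgue. cis (t * w) * test_coeff k (\<phi> t))"

lemma Fubini_torus:
  fixes F :: "real \<Rightarrow> real \<Rightarrow> complex"
  assumes c: "continuous_on UNIV (\<lambda>(t, x). F t x)" and b: "\<And>t x. cmod (F t x) \<le> C / (1 + t\<^sup>2)"
  shows "integrable lborel (\<lambda>t. torus_integral (F t))"
    and "(\<lambda>x. LINT t|lborel. F t x) \<in> borel_measurable borel"
    and "(LINT t|lborel. torus_integral (F t)) = torus_integral (\<lambda>x. LINT t|lborel. F t x)"
proof -
  have "(\<lambda>(t, x). F t x) \<in> borel_measurable (borel \<Otimes>\<^sub>M borel)"
    using borel_measurable_continuous_onI[OF c] by (simp add: borel_prod)
  then have meas: "(\<lambda>(t, x). F t x) \<in> borel_measurable (lborel \<Otimes>\<^sub>M circle_measure)"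
    by (simp cong: measurable_cong_sets)
  have i: "integrable lborel (\<lambda>t::real. C / (1 + t\<^sup>2))"
    using integrable_mult_right[OF integrable_inverse_square, of C] by simp
  have int: "integrable (lborel \<Otimes>\<^sub>M circle_measure) (\<lambda>(t, x). F t x)"
    by (rule integrable_prob_pair[OF prob_space_circle_measure meas _ i]) (simp add: b)
  have "continuous_on UNIV (F t)" for t
    using continuous_on_compose2[OF c, of UNIV "\<lambda>x. (t, x)"]
      continuous_on_Pair[OF continuous_on_const continuous_on_id, of UNIV t] by simp
  then have eq: "torus_integral (F t) = (LINT x|circle_measure. F t x)" for t
    by (simp add: torus_integral_circle borel_measurable_continuous_onI)
  show "integrable lborel (\<lambda>t. torus_integral (F t))"
    using line_circle.integrable_fst'[OF int] by (simp add: eq)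
  show m: "(\<lambda>x. LINT t|lborel. F t x) \<in> borel_measurable borel"
    using borel_measurable_integrable[OF line_circle.integrable_snd[OF int]] by (simp cong: measurable_cong_sets)
  show "(LINT t|lborel. torus_integral (F t)) = torus_integral (\<lambda>x. LINT t|lborel. F t x)"
    using line_circle.Fubini_integral[OF int] by (simp add: eq torus_integral_circle[OF m])
qed

lemma plane_wave_lborel:
  assumes "integrable lborel (\<lambda>t. test_coeff k (\<phi> t))"
  shows "plane_wave w k \<phi> = (LINT t|lborel. cis (t * w) * test_coeff k (\<phi> t))"
  unfolding plane_wave_def
proof (rule integral_completion)
  have [measurable]: "(\<lambda>t. test_coeff k (\<phi> t)) \<in> borel_measurable borel"
    using borel_measurable_integrable[OF assms] by simp
  have [measurable]: "(\<lambda>t. cis (t * w)) \<in> borel_measurable borel"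
    by (intro borel_measurable_continuous_onI continuous_intros)
  show "(\<lambda>t. cis (t * w) * test_coeff k (\<phi> t)) \<in> borel_measurable lborel"
    by simp
qed

text \<open>
  Integrating in time first allows integration by parts in time for each fixed \<open>x\<close>, without
  differentiating under the integral over the torus.
\<close>

lemma plane_wave_swap:
  assumes \<phi>: "\<phi> \<in> schwartz"
  shows "integrable lborel (\<lambda>t. test_coeff k ((Dx ^^ b) \<phi> t))"
    and "(\<lambda>x. LINT t|lborel. cis (t * w) * (Dt ^^ a) ((Dx ^^ b) \<phi>) t x) \<in> borel_measurable borel"
    and "plane_wave w k ((Dx ^^ b) \<phi>)
      = torus_integral (\<lambda>x. cis (of_int k * x) * (LINT t|lborel. cis (t * w) * (Dx ^^ b) \<phi> t x))"
proof -
  have c: "continuous_on UNIV (\<lambda>(t, x). (Dx ^^ b) \<phi> t x)"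
    using schwartz_continuous[OF \<phi>, of 0 b] by simp
  show i: "integrable lborel (\<lambda>t. test_coeff k ((Dx ^^ b) \<phi> t))"
    unfolding test_coeff_def
    by (rule Fubini_torus(1)[where C = "decay_seminorm 0 b \<phi>"])
      (use schwartz_decay[OF \<phi>, of 0 b] c in
        \<open>auto simp: norm_mult case_prod_unfold intro!: continuous_intros\<close>)
  show "(\<lambda>x. LINT t|lborel. cis (t * w) * (Dt ^^ a) ((Dx ^^ b) \<phi>) t x) \<in> borel_measurable borel"
    by (rule Fubini_torus(2)[where C = "decay_seminorm a b \<phi>"])
      (use schwartz_decay[OF \<phi>, of a b] schwartz_continuous[OF \<phi>, of a b] in
        \<open>auto simp: norm_mult case_prod_unfold intro!: continuous_intros\<close>)
  have "plane_wave w k ((Dx ^^ b) \<phi>)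
      = (LINT t|lborel. torus_integral (\<lambda>x. cis (t * w) * (cis (of_int k * x) * (Dx ^^ b) \<phi> t x)))"
    by (simp add: plane_wave_lborel[OF i] test_coeff_def torus_integral_cmult)
  also have "\<dots> = torus_integral (\<lambda>x. LINT t|lborel. cis (t * w) * (cis (of_int k * x) * (Dx ^^ b) \<phi> t x))"
    by (rule Fubini_torus(3)[where C = "decay_seminorm 0 b \<phi>"])
      (use schwartz_decay[OF \<phi>, of 0 b] c in
        \<open>auto simp: norm_mult case_prod_unfold intro!: continuous_intros\<close>)
  also have "\<dots> = torus_integral (\<lambda>x. cis (of_int k * x) * (LINT t|lborel. cis (t * w) * (Dx ^^ b) \<phi> t x))"
    by (simp add: mult.left_commute flip: integral_mult_right_zero)
  finally show "plane_wave w k ((Dx ^^ b) \<phi>)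
      = torus_integral (\<lambda>x. cis (of_int k * x) * (LINT t|lborel. cis (t * w) * (Dx ^^ b) \<phi> t x))" .
qed

lemma time_integral_Dt:
  assumes \<phi>: "\<phi> \<in> schwartz"
  shows "(LINT t|lborel. cis (t * w) * (Dt ^^ a) ((Dx ^^ b) \<phi>) t x)
    = (- (\<i> * of_real w)) ^ a * (LINT t|lborel. cis (t * w) * (Dx ^^ b) \<phi> t x)"
proof (induction a)
  case (Suc a)
  have "continuous_on UNIV (\<lambda>t. (Dt ^^ Suc a) ((Dx ^^ b) \<phi>) t x)"
    by (rule schwartz_continuous_compose[OF \<phi>]) (auto intro!: continuous_intros)
  from integral_cis_derivative[OF schwartz_Dt[OF \<phi>] this schwartz_decay[OF \<phi>] schwartz_decay[OF \<phi>]]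
  have "(LINT t|lborel. cis (t * w) * (Dt ^^ Suc a) ((Dx ^^ b) \<phi>) t x)
      = - (\<i> * of_real w) * (LINT t|lborel. cis (t * w) * (Dt ^^ a) ((Dx ^^ b) \<phi>) t x)" .
  then show ?case
    by (simp only: Suc power_Suc mult.assoc)
qed simp

lemma time_integral_bound:
  assumes \<phi>: "\<phi> \<in> schwartz"
  shows "\<bar>w\<bar> ^ a * cmod (LINT t|lborel. cis (t * w) * (Dx ^^ b) \<phi> t x) \<le> pi * decay_seminorm a b \<phi>"
proof -
  have "\<bar>w\<bar> ^ a * cmod (LINT t|lborel. cis (t * w) * (Dx ^^ b) \<phi> t x)
      = cmod (LINT t|lborel. cis (t * w) * (Dt ^^ a) ((Dx ^^ b) \<phi>) t x)"
    by (simp only: time_integral_Dt[OF \<phi>]) (simp add: norm_mult norm_power)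
  also have "\<dots> \<le> pi * decay_seminorm a b \<phi>"
    by (rule decaying_integrable(2))
      (use schwartz_decay[OF \<phi>, of a b] in \<open>auto simp: norm_mult intro!: borel_measurable_continuous_onI
        continuous_intros schwartz_continuous_compose[OF \<phi>]\<close>)
  finally show ?thesis .
qed

lemma plane_wave_Dx:
  assumes "\<phi> \<in> schwartz"
  shows "plane_wave w k ((Dx ^^ b) \<phi>) = (- (\<i> * of_int k)) ^ b * plane_wave w k \<phi>"
proof -
  have "cis (t * w) * test_coeff k ((Dx ^^ b) \<phi> t)
      = (- (\<i> * of_int k)) ^ b * (cis (t * w) * test_coeff k (\<phi> t))" for t
    using test_coeff_funpow_vderiv[OF schwartz_slice_smooth[OF assms], of k b t]
    by (simp add: Dx_funpow)
  then show ?thesis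
    by (simp only: plane_wave_def integral_mult_right_zero)
qed

lemma plane_wave_weighted_bound:
  assumes "\<phi> \<in> schwartz"
  shows "\<bar>w\<bar> ^ a * (\<bar>of_int k\<bar> ^ b * cmod (plane_wave w k \<phi>)) \<le> pi * decay_seminorm a b \<phi>"
proof -
  let ?L = "\<lambda>x. LINT t|lborel. cis (t * w) * (Dx ^^ b) \<phi> t x"
  have [measurable]: "?L \<in> borel_measurable borel"
    using plane_wave_swap(2)[OF assms, of w 0 b] by simp
  have [measurable]: "(\<lambda>x. cis (of_int k * x)) \<in> borel_measurable borel"
    by (intro borel_measurable_continuous_onI continuous_intros)
  have "\<bar>w\<bar> ^ a * (\<bar>of_int k\<bar> ^ b * cmod (plane_wave w k \<phi>)) = \<bar>w\<bar> ^ a * cmod (plane_wave w k ((Dx ^^ b) \<phi>))"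
    by (simp add: plane_wave_Dx[OF assms] norm_mult norm_power)
  also have "\<dots> = cmod (of_real (\<bar>w\<bar> ^ a) * torus_integral (\<lambda>x. cis (of_int k * x) * ?L x))"
    by (simp add: plane_wave_swap(3)[OF assms] norm_mult norm_power)
  also have "\<dots> = cmod (torus_integral (\<lambda>x. of_real (\<bar>w\<bar> ^ a) * (cis (of_int k * x) * ?L x)))"
    by (simp only: torus_integral_cmult)
  also have "\<dots> \<le> pi * decay_seminorm a b \<phi>"
    by (rule torus_integral_bound)
      (use time_integral_bound[OF assms, of w a b] in \<open>auto simp: norm_mult norm_power\<close>)
  finally show ?thesis .
qed

text \<open>
  Integration by parts \<open>b\<close> times in \<open>x\<close> and then \<open>a\<close> times in \<open>t\<close>; the other three seminorms
  cover the small frequencies.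
\<close>

lemma plane_wave_decay:
  assumes "\<phi> \<in> schwartz"
  shows "cmod (plane_wave w k \<phi>) \<le> 2 ^ a * 2 ^ b * pi *
      (decay_seminorm 0 0 \<phi> + decay_seminorm 0 b \<phi> + decay_seminorm a 0 \<phi> + decay_seminorm a b \<phi>)
      / (japanese w ^ a * japanese (of_int k) ^ b)"
proof -
  let ?p = "cmod (plane_wave w k \<phi>)"
  have "japanese w ^ a * japanese (of_int k) ^ b * ?p
      \<le> 2 ^ a * (1 + \<bar>w\<bar> ^ a) * (2 ^ b * (1 + \<bar>of_int k\<bar> ^ b)) * ?p"
    by (intro mult_right_mono mult_mono japanese_power_le) auto
  also have "\<dots> = 2 ^ a * 2 ^ b * (\<bar>w\<bar> ^ 0 * (\<bar>of_int k\<bar> ^ 0 * ?p) + \<bar>w\<bar> ^ 0 * (\<bar>of_int k\<bar> ^ b * ?p)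
      + \<bar>w\<bar> ^ a * (\<bar>of_int k\<bar> ^ 0 * ?p) + \<bar>w\<bar> ^ a * (\<bar>of_int k\<bar> ^ b * ?p))"
    by (simp add: algebra_simps)
  also have "\<dots> \<le> 2 ^ a * 2 ^ b * (pi * decay_seminorm 0 0 \<phi> + pi * decay_seminorm 0 b \<phi>
      + pi * decay_seminorm a 0 \<phi> + pi * decay_seminorm a b \<phi>)"
    by (intro mult_left_mono add_mono plane_wave_weighted_bound[OF assms]) auto
  finally show ?thesis
    by (simp add: pos_le_divide_eq algebra_simps)
qed

lemma schwartz_test_coeff_integrable:
  "\<phi> \<in> schwartz \<Longrightarrow> integrable lborel (\<lambda>t. test_coeff k (\<phi> t))"
  using plane_wave_swap(1)[of \<phi> k 0] by simp

lemma integrable_cis_times: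
  assumes "integrable lborel f"
  shows "integrable lborel (\<lambda>t. cis (t * w) * f t)"
proof (rule Bochner_Integration.integrable_bound[OF assms])
  have [measurable]: "f \<in> borel_measurable borel"
    using borel_measurable_integrable[OF assms] by simp
  have [measurable]: "(\<lambda>t. cis (t * w)) \<in> borel_measurable borel"
    by (intro borel_measurable_continuous_onI continuous_intros)
  show "(\<lambda>t. cis (t * w) * f t) \<in> borel_measurable lborel"
    by simp
qed (simp add: norm_mult)

lemma plane_wave_linear:
  assumes "\<phi> \<in> schwartz" "\<eta> \<in> schwartz"
  shows "plane_wave w k (\<lambda>t x. c * \<phi> t x + \<eta> t x) = c * plane_wave w k \<phi> + plane_wave w k \<eta>"
proof -
  note i = schwartz_test_coeff_integrable[OF assms(1), of k] schwartz_test_coeff_integrable[OF assms(2), of k]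
  have tc: "test_coeff k (\<lambda>x. c * \<phi> t x + \<eta> t x) = c * test_coeff k (\<phi> t) + test_coeff k (\<eta> t)" for t
    using assms by (intro test_coeff_linear) (auto intro: torus_smooth_continuous schwartz_slice_smooth)
  have "plane_wave w k (\<lambda>t x. c * \<phi> t x + \<eta> t x)
      = (LINT t|lborel. c * (cis (t * w) * test_coeff k (\<phi> t)) + cis (t * w) * test_coeff k (\<eta> t))"
    by (subst plane_wave_lborel) (use i in \<open>auto simp: tc distrib_left mult.left_commute\<close>)
  also have "\<dots> = c * plane_wave w k \<phi> + plane_wave w k \<eta>"
    using i by (simp add: plane_wave_lborel integrable_cis_times)
  finally show ?thesis .
qed

section \<open>Series of plane waves as tempered distributions\<close>

definition plane_wave_series ::
  "('i \<Rightarrow> int) \<Rightarrow> ('i \<Rightarrow> real) \<Rightarrow> ('i \<Rightarrow> complex) \<Rightarrow> (real \<Rightarrow> real \<Rightarrow> complex) \<Rightarrow> complex" where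
  "plane_wave_series \<kappa> \<omega> A \<phi> = (\<Sum>\<^sub>\<infinity>i\<in>UNIV. A i * plane_wave (\<omega> i) (\<kappa> i) \<phi>)"

text \<open>
  The amplitudes may grow polynomially in both frequencies, because the decay of the pairing with
  a Schwartz function compensates any power.
\<close>

lemma plane_wave_series_tempered:
  assumes s: "(\<lambda>i. cmod (A i) / (japanese (\<omega> i) ^ a * japanese (of_int (\<kappa> i)) ^ b)) summable_on UNIV"
  shows "\<phi> \<in> schwartz \<Longrightarrow> (\<lambda>i. A i * plane_wave (\<omega> i) (\<kappa> i) \<phi>) summable_on UNIV"
    and "plane_wave_series \<kappa> \<omega> A \<in> tempered"
proof -
  let ?m = "\<lambda>i. cmod (A i) / (japanese (\<omega> i) ^ a * japanese (of_int (\<kappa> i)) ^ b)"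
  define c where "c = (2 ^ a * 2 ^ b * pi :: real)"
  define K where "K = max 2 (max a b)"
  define S where "S = (\<lambda>\<phi>. \<Sum>k\<le>K. \<Sum>a\<le>K. \<Sum>b\<le>K. schwartz_seminorm k a b \<phi>)"
  have sem: "schwartz_seminorm k i j \<phi> \<le> S \<phi>"
    if "\<phi> \<in> schwartz" "k \<le> K" "i \<le> K" "j \<le> K" for \<phi> k i j
  proof -
    have "schwartz_seminorm k i j \<phi> \<le> (\<Sum>b\<le>K. schwartz_seminorm k i b \<phi>)"
      by (rule member_le_sum) (use that schwartz_seminorm_nonneg in auto)
    also have "\<dots> \<le> (\<Sum>a\<le>K. \<Sum>b\<le>K. schwartz_seminorm k a b \<phi>)"
      by (rule member_le_sum) (use that schwartz_seminorm_nonneg in \<open>auto intro!: sum_nonneg\<close>)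
    also have "\<dots> \<le> S \<phi>"
      unfolding S_def
      by (rule member_le_sum) (use that schwartz_seminorm_nonneg in \<open>auto intro!: sum_nonneg\<close>)
    finally show ?thesis .
  qed
  have K: "0 \<le> K" "2 \<le> K" "a \<le> K" "b \<le> K"
    by (auto simp: K_def)
  have dec: "decay_seminorm i j \<phi> \<le> 2 * S \<phi>" if "\<phi> \<in> schwartz" "i \<le> K" "j \<le> K" for \<phi> i j
    unfolding decay_seminorm_def
    using sem[OF that(1) K(1) that(2,3)] sem[OF that(1) K(2) that(2,3)] by simp
  have b: "cmod (A i * plane_wave (\<omega> i) (\<kappa> i) \<phi>) \<le> 8 * c * S \<phi> * ?m i" if \<phi>: "\<phi> \<in> schwartz" for \<phi> i
  proof -
    let ?d = "japanese (\<omega> i) ^ a * japanese (of_int (\<kappa> i)) ^ b"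
    have "cmod (plane_wave (\<omega> i) (\<kappa> i) \<phi>) \<le> c * (decay_seminorm 0 0 \<phi> + decay_seminorm 0 b \<phi>
        + decay_seminorm a 0 \<phi> + decay_seminorm a b \<phi>) / ?d"
      unfolding c_def by (rule plane_wave_decay[OF \<phi>])
    also have "\<dots> \<le> c * (8 * S \<phi>) / ?d"
      using dec[OF \<phi>, of 0 0] dec[OF \<phi>, of 0 b] dec[OF \<phi>, of a 0] dec[OF \<phi>, of a b] K
      by (intro divide_right_mono mult_left_mono) (auto simp: c_def)
    finally have "cmod (A i) * cmod (plane_wave (\<omega> i) (\<kappa> i) \<phi>) \<le> cmod (A i) * (c * (8 * S \<phi>) / ?d)"
      by (rule mult_left_mono) simp
    then show ?thesis
      by (simp add: norm_mult mult_ac)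
  qed
  have s': "(\<lambda>i. 8 * c * S \<phi> * ?m i) summable_on UNIV" for \<phi>
    by (rule summable_on_cmult_right[OF s])
  show sum: "(\<lambda>i. A i * plane_wave (\<omega> i) (\<kappa> i) \<phi>) summable_on UNIV" if "\<phi> \<in> schwartz" for \<phi>
    by (rule norm_dominated_summable(2)[OF s' b[OF that]])
  have bound: "cmod (\<Sum>\<^sub>\<infinity>i\<in>UNIV. A i * plane_wave (\<omega> i) (\<kappa> i) \<phi>) \<le> (8 * c * infsum ?m UNIV) * S \<phi>"
    if "\<phi> \<in> schwartz" for \<phi>
  proof -
    have "cmod (\<Sum>\<^sub>\<infinity>i\<in>UNIV. A i * plane_wave (\<omega> i) (\<kappa> i) \<phi>) \<le> (\<Sum>\<^sub>\<infinity>i\<in>UNIV. 8 * c * S \<phi> * ?m i)"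
      by (rule norm_infsum_le[OF has_sum_infsum[OF sum[OF that]] has_sum_infsum[OF s'] b[OF that]])
    also have "\<dots> = 8 * c * S \<phi> * infsum ?m UNIV"
      by (rule infsum_cmult_right')
    finally show ?thesis by (simp add: mult_ac)
  qed
  have lin: "(\<Sum>\<^sub>\<infinity>i\<in>UNIV. A i * plane_wave (\<omega> i) (\<kappa> i) (\<lambda>t x. c * \<phi> t x + \<eta> t x))
      = c * (\<Sum>\<^sub>\<infinity>i\<in>UNIV. A i * plane_wave (\<omega> i) (\<kappa> i) \<phi>)
        + (\<Sum>\<^sub>\<infinity>i\<in>UNIV. A i * plane_wave (\<omega> i) (\<kappa> i) \<eta>)"
    if "\<phi> \<in> schwartz" "\<eta> \<in> schwartz" for \<phi> \<eta> c
  proof -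
    have "(\<Sum>\<^sub>\<infinity>i\<in>UNIV. A i * plane_wave (\<omega> i) (\<kappa> i) (\<lambda>t x. c * \<phi> t x + \<eta> t x))
      = (\<Sum>\<^sub>\<infinity>i\<in>UNIV. c * (A i * plane_wave (\<omega> i) (\<kappa> i) \<phi>) + A i * plane_wave (\<omega> i) (\<kappa> i) \<eta>)"
      by (intro infsum_cong, subst plane_wave_linear[OF that]) (simp add: distrib_left mult_ac)
    also have "\<dots> = c * (\<Sum>\<^sub>\<infinity>i\<in>UNIV. A i * plane_wave (\<omega> i) (\<kappa> i) \<phi>)
        + (\<Sum>\<^sub>\<infinity>i\<in>UNIV. A i * plane_wave (\<omega> i) (\<kappa> i) \<eta>)"
      by (subst infsum_add) (auto simp: infsum_cmult_right' intro!: summable_on_cmult_right sum that)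
    finally show ?thesis .
  qed
  show "plane_wave_series \<kappa> \<omega> A \<in> tempered"
    unfolding plane_wave_series_def[abs_def] tempered_def using lin bound unfolding S_def by blast
qed

text \<open>
  The partial sums over an exhausting sequence of finite sets turn the exchange into the
  dominated convergence theorem; this is where countability of the index type enters.
\<close>

lemma integral_infsum:
  fixes f :: "'i::countable \<Rightarrow> 'b \<Rightarrow> complex"
  assumes meas[measurable]: "\<And>i. f i \<in> borel_measurable M"
    and b: "\<And>i t. cmod (f i t) \<le> m i * g t"
    and m: "m summable_on UNIV" and g: "integrable M g"
  shows "(\<lambda>t. \<Sum>\<^sub>\<infinity>i\<in>UNIV. f i t) \<in> borel_measurable M"
    and "(LINT t|M. (\<Sum>\<^sub>\<infinity>i\<in>UNIV. f i t)) = (\<Sum>\<^sub>\<infinity>i\<in>UNIV. LINT t|M. f i t)"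
proof -
  define F where "F = (\<lambda>N. {i::'i. to_nat i < N})"
  have fin: "finite (F N)" for N
    unfolding F_def using finite_vimageI[OF finite_lessThan[of N] inj_to_nat[where 'a = 'i]]
    by (simp add: vimage_def)
  have lim: "(\<lambda>N. \<Sum>i\<in>F N. h i) \<longlonglongrightarrow> (\<Sum>\<^sub>\<infinity>i\<in>UNIV. h i)"
    if h: "\<And>i. cmod (h i) \<le> m i * c" for h c
  proof -
    have "(\<lambda>N. \<Sum>\<^sub>\<infinity>i\<in>UNIV. if i \<in> F N then h i else 0) \<longlonglongrightarrow> (\<Sum>\<^sub>\<infinity>i\<in>UNIV. h i)"
    proof (rule infsum_dominated_convergence)
      show "(\<lambda>i. m i * c) summable_on UNIV"
        by (rule summable_on_cmult_left[OF m])
      show "norm (if i \<in> F N then h i else 0) \<le> m i * c" for i N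
        using h[of i] norm_ge_zero[of "h i"] by (auto simp del: norm_ge_zero)
      show "(\<lambda>N. if i \<in> F N then h i else 0) \<longlonglongrightarrow> h i" for i
        by (rule tendsto_eventually, rule eventually_sequentiallyI[of "Suc (to_nat i)"]) (auto simp: F_def)
    qed
    moreover have "(\<Sum>\<^sub>\<infinity>i\<in>UNIV. if i \<in> F N then h i else 0) = (\<Sum>i\<in>F N. h i)" for N
    proof -
      have "(\<Sum>\<^sub>\<infinity>i\<in>UNIV. if i \<in> F N then h i else 0) = infsum h (F N)"
        by (rule infsum_cong_neutral) auto
      then show ?thesis using fin by simp
    qed
    ultimately show ?thesis by simp
  qed
  have fint: "integrable M (f i)" for i
    by (rule Bochner_Integration.integrable_bound[OF integrable_mult_right[OF g, of "m i"]])
      (use b meas in \<open>auto intro!: AE_I2 order_trans[OF b]\<close>)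
  show msum[measurable]: "(\<lambda>t. \<Sum>\<^sub>\<infinity>i\<in>UNIV. f i t) \<in> borel_measurable M"
    by (rule borel_measurable_LIMSEQ_metric[where f = "\<lambda>N t. \<Sum>i\<in>F N. f i t"]) (auto intro: lim b)
  have mb: "cmod (\<Sum>i\<in>F N. f i t) \<le> infsum (\<lambda>i. \<bar>m i\<bar>) UNIV * \<bar>g t\<bar>" for N t
  proof -
    have "cmod (\<Sum>i\<in>F N. f i t) \<le> (\<Sum>i\<in>F N. \<bar>m i\<bar> * \<bar>g t\<bar>)"
      by (rule sum_norm_le) (metis abs_ge_self abs_mult b order_trans)
    also have "\<dots> = (\<Sum>i\<in>F N. \<bar>m i\<bar>) * \<bar>g t\<bar>"
      by (simp add: sum_distrib_right)
    also have "\<dots> \<le> infsum (\<lambda>i. \<bar>m i\<bar>) UNIV * \<bar>g t\<bar>"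
      by (intro mult_right_mono finite_sum_le_infsum)
        (use summable_on_iff_abs_summable_on_real[of m UNIV] m fin in auto)
    finally show ?thesis .
  qed
  have "(\<lambda>N. LINT t|M. (\<Sum>i\<in>F N. f i t)) \<longlonglongrightarrow> (LINT t|M. (\<Sum>\<^sub>\<infinity>i\<in>UNIV. f i t))"
    by (rule integral_dominated_convergence[where w = "\<lambda>t. infsum (\<lambda>i. \<bar>m i\<bar>) UNIV * \<bar>g t\<bar>"])
      (use g mb in \<open>auto intro: lim b\<close>)
  moreover have "(LINT t|M. (\<Sum>i\<in>F N. f i t)) = (\<Sum>i\<in>F N. LINT t|M. f i t)" for N
    using fint by simp
  moreover have "(\<lambda>N. \<Sum>i\<in>F N. LINT t|M. f i t) \<longlonglongrightarrow> (\<Sum>\<^sub>\<infinity>i\<in>UNIV. LINT t|M. f i t)"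
  proof (rule lim[where c = "LINT t|M. g t"])
    fix i
    have "cmod (LINT t|M. f i t) \<le> (LINT t|M. m i * g t)"
      by (rule order_trans[OF integral_norm_bound Bochner_Integration.integral_mono])
        (use fint g b in \<open>auto intro: integrable_norm\<close>)
    then show "cmod (LINT t|M. f i t) \<le> m i * (LINT t|M. g t)"
      by simp
  qed
  ultimately show "(LINT t|M. (\<Sum>\<^sub>\<infinity>i\<in>UNIV. f i t)) = (\<Sum>\<^sub>\<infinity>i\<in>UNIV. LINT t|M. f i t)"
    using LIMSEQ_unique by auto
qed

lemma time_dist_wave_slice:
  fixes \<kappa> :: "'i::countable \<Rightarrow> int"
  assumes a: "sobolev_amplitudes r \<kappa> a" and \<phi>: "\<phi> \<in> schwartz"
  shows "time_dist (wave_slice \<kappa> \<omega> a) \<phi> = plane_wave_series \<kappa> \<omega> a \<phi>"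
proof -
  obtain l :: nat where l: "real l \<ge> 2 - r"
    using real_arch_simple by blast
  define C where "C = 2 ^ l * (decay_seminorm 0 0 \<phi> + decay_seminorm 0 l \<phi>)"
  let ?m = "\<lambda>i. cmod (a i) / japanese (of_int (\<kappa> i)) ^ l"
  let ?f = "\<lambda>i t. a i * cis (t * \<omega> i) * test_coeff (\<kappa> i) (\<phi> t)"
  have m: "?m summable_on UNIV"
    by (rule amplitudes_summable[OF a l])
  have g: "integrable lborel (\<lambda>t::real. C / (1 + t\<^sup>2))"
    using integrable_mult_right[OF integrable_inverse_square, of C] by simp
  have fm: "?f i \<in> borel_measurable lborel" for i
    using integrable_mult_right[OF integrable_cis_times[OF schwartz_test_coeff_integrable[OF \<phi>]], of "a i"]
    by (auto simp: mult.assoc dest: borel_measurable_integrable)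
  have b: "cmod (?f i t) \<le> ?m i * (C / (1 + t\<^sup>2))" for i t
  proof -
    have "cmod (test_coeff (\<kappa> i) (\<phi> t)) \<le> 2 ^ l * (decay_seminorm 0 0 \<phi> / (1 + t\<^sup>2)
        + decay_seminorm 0 l \<phi> / (1 + t\<^sup>2)) / japanese (of_int (\<kappa> i)) ^ l"
    proof (rule test_coeff_decay[OF schwartz_slice_smooth[OF \<phi>]])
      show "cmod (\<phi> t x) \<le> decay_seminorm 0 0 \<phi> / (1 + t\<^sup>2)" for x
        using schwartz_decay[OF \<phi>, of 0 0 t x] by simp
      show "cmod ((vderiv ^^ l) (\<phi> t) x) \<le> decay_seminorm 0 l \<phi> / (1 + t\<^sup>2)" for x
        using schwartz_decay[OF \<phi>, of 0 l t x] by (simp add: Dx_funpow)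
    qed
    also have "\<dots> = C / (1 + t\<^sup>2) / japanese (of_int (\<kappa> i)) ^ l"
      by (simp add: C_def flip: add_divide_distrib)
    finally have "cmod (a i) * cmod (test_coeff (\<kappa> i) (\<phi> t))
        \<le> cmod (a i) * (C / (1 + t\<^sup>2) / japanese (of_int (\<kappa> i)) ^ l)"
      by (rule mult_left_mono) simp
    then show ?thesis by (simp add: norm_mult mult_ac)
  qed
  have "time_dist (wave_slice \<kappa> \<omega> a) \<phi> = (LINT t|lborel. (\<Sum>\<^sub>\<infinity>i\<in>UNIV. ?f i t))"
    unfolding time_dist_def wave_slice_def
    by (rule integral_completion[OF integral_infsum(1)[OF fm b m g]])
  also have "\<dots> = (\<Sum>\<^sub>\<infinity>i\<in>UNIV. LINT t|lborel. ?f i t)"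
    by (rule integral_infsum(2)[OF fm b m g])
  also have "\<dots> = plane_wave_series \<kappa> \<omega> a \<phi>"
    by (simp add: plane_wave_series_def plane_wave_lborel[OF schwartz_test_coeff_integrable[OF \<phi>]] mult.assoc)
  finally show ?thesis .
qed

text \<open>
  Only continuity in \<open>x\<close> and integrability in time are asked of \<open>\<phi>\<close>, so that the formula also
  applies to Bessel potentials of Schwartz functions.
\<close>

lemma fun_dist_trig_sum:
  assumes fin: "finite I"
    and c: "\<And>t. continuous_on UNIV (\<phi> t)" and i: "\<And>k. integrable lborel (\<lambda>t. test_coeff k (\<phi> t))"
  shows "fun_dist (\<lambda>t x. \<Sum>i\<in>I. A i * cis (t * \<omega> i) * cis (of_int (\<kappa> i) * x)) \<phi>
    = (\<Sum>i\<in>I. A i * plane_wave (\<omega> i) (\<kappa> i) \<phi>)"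
proof -
  have "torus_dist (\<lambda>x. \<Sum>i\<in>I. A i * cis (t * \<omega> i) * cis (of_int (\<kappa> i) * x)) (\<phi> t)
      = (\<Sum>i\<in>I. A i * (cis (t * \<omega> i) * test_coeff (\<kappa> i) (\<phi> t)))" for t
  proof -
    have "torus_dist (\<lambda>x. \<Sum>i\<in>I. A i * cis (t * \<omega> i) * cis (of_int (\<kappa> i) * x)) (\<phi> t)
      = torus_integral (\<lambda>x. \<Sum>i\<in>I. A i * cis (t * \<omega> i) * (cis (of_int (\<kappa> i) * x) * \<phi> t x))"
      by (simp add: torus_dist_def sum_distrib_right mult.assoc)
    also have "\<dots> = (\<Sum>i\<in>I. torus_integral (\<lambda>x. A i * cis (t * \<omega> i) * (cis (of_int (\<kappa> i) * x) * \<phi> t x)))"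
      by (rule torus_integral_sum) (intro continuous_intros c)
    finally show ?thesis
      by (simp add: torus_integral_cmult test_coeff_def mult.assoc)
  qed
  then have "fun_dist (\<lambda>t x. \<Sum>i\<in>I. A i * cis (t * \<omega> i) * cis (of_int (\<kappa> i) * x)) \<phi>
      = (LINT t|lebesgue. (\<Sum>i\<in>I. A i * (cis (t * \<omega> i) * test_coeff (\<kappa> i) (\<phi> t))))"
    by (simp add: fun_dist_def time_dist_def)
  also have "\<dots> = (LINT t|lborel. (\<Sum>i\<in>I. A i * (cis (t * \<omega> i) * test_coeff (\<kappa> i) (\<phi> t))))"
    by (intro integral_completion borel_measurable_integrable Bochner_Integration.integrable_sum
        integrable_mult_right integrable_cis_times i)
  also have "\<dots> = (\<Sum>i\<in>I. A i * plane_wave (\<omega> i) (\<kappa> i) \<phi>)"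
    by (subst Bochner_Integration.integral_sum)
      (auto intro!: integrable_mult_right integrable_cis_times i simp: plane_wave_lborel[OF i])
  finally show ?thesis .
qed

section \<open>Bessel potentials in time\<close>

lemma Gamma_scaled_integral:
  fixes p b :: real
  assumes p: "p > 0" and b: "b > 0"
  shows "has_bochner_integral lborel (\<lambda>u. indicator {0..} u * (u powr (p - 1) * exp (- (b * u)))) (Gamma p * b powr (- p))"
proof -
  let ?h = "\<lambda>u::real. indicator {0..} u * (u powr (p - 1) / exp u)"
  have "(\<integral>\<^sup>+u. ennreal (?h u) \<partial>lborel) = ennreal (Gamma p)"
    using nn_integral_has_integral_lebesgue[OF _ Gamma_integral_real[OF p]] by simp
  then have "has_bochner_integral lborel ?h (Gamma p)"
    by (intro has_bochner_integral_nn_integral) (use p in \<open>auto simp: Gamma_real_nonneg intro: less_imp_le Gamma_real_pos\<close>)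
  then have "has_bochner_integral lborel (\<lambda>u. ?h (0 + b * u)) (Gamma p /\<^sub>R \<bar>b\<bar>)"
    using b by (subst lborel_has_bochner_integral_real_affine_iff[symmetric]) auto
  then have "has_bochner_integral lborel (\<lambda>u. b powr (1 - p) * ?h (0 + b * u)) (b powr (1 - p) * (Gamma p /\<^sub>R \<bar>b\<bar>))"
    by (rule has_bochner_integral_mult_right)
  moreover have "b powr (1 - p) * ?h (0 + b * u) = indicator {0..} u * (u powr (p - 1) * exp (- (b * u)))" for u
  proof (cases "u \<ge> 0")
    case True
    have "b powr (1 - p) * b powr (p - 1) = 1"
      using b by (simp flip: powr_add)
    then show ?thesis
      using True b by (simp add: powr_mult exp_minus divide_inverse)
  next
    case False
    then have "\<not> b * u \<ge> 0"
      using b by (simp add: zero_le_mult_iff)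
    with False show ?thesis by simp
  qed
  moreover have "b powr (1 - p) * (Gamma p /\<^sub>R \<bar>b\<bar>) = Gamma p * b powr (- p)"
    using b by (simp add: powr_diff powr_minus divide_inverse)
  ultimately show ?thesis by (simp only:)
qed

text \<open>
  If \<open>U\<close> has the Gamma distribution with parameter \<open>s / 2\<close> and \<open>Z\<close> is an independent standard normal
  variable, then \<open>sqrt (2 U) Z\<close> has the characteristic function
  \<open>E exp (- U w\<^sup>2) = (1 + w\<^sup>2) powr (- s / 2)\<close>, by the Laplace transform of the Gamma density.
\<close>

lemma bessel_measure_exists:
  fixes s :: real
  assumes s: "s > 0"
  shows "\<exists>\<mu>. real_distribution \<mu> \<and> (\<forall>w. char \<mu> w = of_real (japanese w powr (- s)))"
proof -
  define p where "p = s / 2"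
  have p: "p > 0" using s by (simp add: p_def)
  have Gp: "Gamma p > 0" using p by (rule Gamma_real_pos)
  define d where "d = (\<lambda>u::real. indicator {0..} u * (u powr (p - 1) * exp (- u)) / Gamma p)"
  have d0: "0 \<le> d u" for u
    using Gp by (simp add: d_def)
  have [measurable]: "d \<in> borel_measurable borel"
    unfolding d_def by measurable
  define \<gamma> where "\<gamma> = density lborel (\<lambda>u. ennreal (d u))"
  have laplace: "has_bochner_integral lborel (\<lambda>u. d u * exp (- (c * u))) ((1 + c) powr (- p))" if "c \<ge> 0" for c
  proof -
    have "has_bochner_integral lborel
        (\<lambda>u. (indicator {0..} u * (u powr (p - 1) * exp (- ((1 + c) * u)))) / Gamma p)
        ((Gamma p * (1 + c) powr (- p)) / Gamma p)"
      by (intro has_bochner_integral_divide_zero Gamma_scaled_integral p) (use that in auto)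
    moreover have "(indicator {0..} u * (u powr (p - 1) * exp (- ((1 + c) * u)))) / Gamma p
        = d u * exp (- (c * u))" for u
      by (simp add: d_def distrib_right mult_exp_exp)
    ultimately show ?thesis
      using Gp by simp
  qed
  have "(\<integral>\<^sup>+u. ennreal (d u) \<partial>lborel) = 1"
    using laplace[of 0] d0 nn_integral_eq_integral[of lborel d]
    by (simp add: has_bochner_integral_iff)
  then interpret \<gamma>: prob_space \<gamma>
    by (intro prob_spaceI) (simp add: \<gamma>_def emeasure_density)
  interpret N: real_distribution std_normal_distribution
    by (rule real_dist_normal_dist)
  interpret \<gamma>N: pair_prob_space \<gamma> std_normal_distribution ..
  have [measurable_cong, simp]: "sets \<gamma> = sets borel"
    by (simp add: \<gamma>_def)
  define X where "X = (\<lambda>(u, z). sqrt (2 * u) * z :: real)"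
  have X [measurable]: "X \<in> borel_measurable (\<gamma> \<Otimes>\<^sub>M std_normal_distribution)"
    unfolding X_def by measurable
  define \<mu> where "\<mu> = distr (\<gamma> \<Otimes>\<^sub>M std_normal_distribution) borel X"
  have "char \<mu> w = of_real (japanese w powr (- s))" for w
  proof -
    have [measurable]: "(\<lambda>x. iexp (w * x)) \<in> borel_measurable borel"
      by (intro borel_measurable_continuous_onI continuous_intros)
    have "char \<mu> w = (LINT q|(\<gamma> \<Otimes>\<^sub>M std_normal_distribution). iexp (w * X q))"
      unfolding char_def \<mu>_def by (rule integral_distr) auto
    also have "\<dots> = (LINT u|\<gamma>. LINT z|std_normal_distribution. iexp (w * X (u, z)))"
    proof (rule \<gamma>N.integral_fst'[symmetric])
      show "integrable (\<gamma> \<Otimes>\<^sub>M std_normal_distribution) (\<lambda>q. iexp (w * X q))"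
        by (rule \<gamma>N.P.integrable_const_bound[where B = 1]) auto
    qed
    also have "\<dots> = (LINT u|\<gamma>. char std_normal_distribution (w * sqrt (2 * u)))"
      by (simp add: char_def X_def mult_ac)
    also have "\<dots> = (LINT u|lborel. d u *\<^sub>R of_real (exp (- (w * sqrt (2 * u))\<^sup>2 / 2)))"
      unfolding \<gamma>_def char_std_normal_distribution
      by (rule integral_density) (use d0 in auto)
    also have "\<dots> = (LINT u|lborel. of_real (d u * exp (- (w\<^sup>2 * u))))"
      by (intro Bochner_Integration.integral_cong) (auto simp: d_def scaleR_conv_of_real power_mult_distrib indicator_def)
    also have "\<dots> = of_real (LINT u|lborel. d u * exp (- (w\<^sup>2 * u)))"
      by (rule integral_complex_of_real)
    also have "(LINT u|lborel. d u * exp (- (w\<^sup>2 * u))) = (1 + w\<^sup>2) powr (- p)"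
      using laplace[of "w\<^sup>2"] by (simp add: has_bochner_integral_iff)
    also have "(1 + w\<^sup>2) powr (- p) = japanese w powr (- s)"
      by (simp add: japanese_def p_def powr_powr flip: powr_half_sqrt)
    finally show ?thesis .
  qed
  moreover have "real_distribution \<mu>"
    unfolding \<mu>_def by (rule \<gamma>N.P.real_distribution_distr) simp
  ultimately show ?thesis by blast
qed

text \<open>
  A Gaussian factor \<open>exp (- (e w)\<^sup>2 / 2)\<close> in the inversion integral corresponds to averaging \<open>f\<close> over
  a normal distribution of standard deviation \<open>e\<close> around \<open>t\<close>; then \<open>e\<close> tends to zero on both sides.
\<close>

lemma Fourier_inversion:
  fixes f :: "real \<Rightarrow> complex"
  assumes cont: "continuous_on UNIV f" and f: "\<And>t. cmod (f t) \<le> C / (1 + t\<^sup>2)"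
    and F_def: "\<And>w. F w = (LINT t|lborel. f t * cis (- (t * w)))"
    and F: "\<And>w. cmod (F w) \<le> C' / (1 + w\<^sup>2)"
  shows "F \<in> borel_measurable borel"
    and "(LINT w|lborel. F w * cis (t * w)) / of_real (2 * pi) = f t"
proof -
  interpret N: real_distribution std_normal_distribution
    by (rule real_dist_normal_dist)
  have [measurable]: "f \<in> borel_measurable borel"
    by (rule borel_measurable_continuous_onI[OF cont])
  have F_eq: "F = (\<lambda>w. LINT t|lborel. f t * cis (- (t * w)))"
    by (rule ext) (rule F_def)
  show Fm [measurable]: "F \<in> borel_measurable borel"
    unfolding F_eq by measurable
  have fi: "integrable lborel f"
    by (rule decaying_integrable(1)[OF _ f]) simp
  have i: "integrable lborel (\<lambda>t::real. C / (1 + t\<^sup>2))" for C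
    using integrable_mult_right[OF integrable_inverse_square, of C] by simp
  have C: "0 \<le> C"
    using order_trans[OF norm_ge_zero f[of 0]] by simp
  have fb: "cmod (f t) \<le> C" for t
  proof -
    have "C / (1 + t\<^sup>2) \<le> C"
      using C by (simp add: divide_le_eq mult_le_cancel_left1 add_pos_nonneg)
    with f[of t] show ?thesis by simp
  qed
  let ?g = "\<lambda>e y. exp (- ((e * y)\<^sup>2) / 2) :: real"
  \<comment> \<open>dilating by \<open>e\<close> turns the Gaussian factor into the standard normal density, whose characteristic
    function is again Gaussian\<close>
  have reg: "(LINT w|lborel. F w * cis (t * w) * of_real (?g e w))
      = of_real (2 * pi) * (LINT y|std_normal_distribution. f (t + e * y))" if e: "e > 0" for e
  proof -
    have "(LINT w|lborel. F w * cis (t * w) * of_real (?g e w))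
        = \<bar>1 / e\<bar> *\<^sub>R (LINT y|lborel. F (0 + 1 / e * y) * cis (t * (0 + 1 / e * y)) * of_real (?g e (0 + 1 / e * y)))"
      using e by (intro lborel_integral_real_affine) auto
    also have "\<dots> = (1 / e) *\<^sub>R (LINT y|lborel. of_real (sqrt (2 * pi)) * (std_normal_density y *\<^sub>R (F (y / e) * cis (t * y / e))))"
      using e by (simp add: std_normal_density_def scaleR_conv_of_real field_simps)
    also have "\<dots> = (of_real (sqrt (2 * pi)) / of_real e) * (LINT y|std_normal_distribution. F (y / e) * cis (t * y / e))"
      by (subst integral_density) (auto simp: scaleR_conv_of_real)
    also have "(LINT y|std_normal_distribution. F (y / e) * cis (t * y / e))
        = (LINT y|std_normal_distribution. LINT r|lborel. f r * cis ((t - r) / e * y))"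
    proof (intro Bochner_Integration.integral_cong refl)
      fix y
      have "F (y / e) * cis (t * y / e) = (LINT r|lborel. f r * cis (- (r * (y / e))) * cis (t * y / e))"
        by (simp add: F_def)
      also have "\<dots> = (LINT r|lborel. f r * cis ((t - r) / e * y))"
        by (intro Bochner_Integration.integral_cong refl)
          (simp add: mult.assoc cis_mult left_diff_distrib diff_divide_distrib)
      finally show "F (y / e) * cis (t * y / e) = (LINT r|lborel. f r * cis ((t - r) / e * y))" .
    qed
    also have "\<dots> = (LINT r|lborel. LINT y|std_normal_distribution. f r * cis ((t - r) / e * y))"
    proof -
      interpret P: pair_sigma_finite lborel std_normal_distribution ..
      have "integrable (lborel \<Otimes>\<^sub>M std_normal_distribution) (\<lambda>(r, y). f r * cis ((t - r) / e * y))"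
        by (rule integrable_prob_pair[OF N.prob_space_axioms _ _ i[of C]])
          (use f in \<open>auto simp: norm_mult\<close>)
      from P.Fubini_integral[OF this] show ?thesis by simp
    qed
    also have "\<dots> = (LINT r|lborel. f r * of_real (exp (- (((t - r) / e)\<^sup>2) / 2)))"
    proof -
      have "(LINT y|std_normal_distribution. cis (c * y)) = of_real (exp (- (c\<^sup>2) / 2))" for c
        using fun_cong[OF char_std_normal_distribution, of c] by (simp add: char_def cis_conv_exp)
      then show ?thesis by (simp only: integral_mult_right_zero)
    qed
    also have "\<dots> = \<bar>e\<bar> *\<^sub>R (LINT y|lborel. f (t + e * y) * of_real (exp (- (((t - (t + e * y)) / e)\<^sup>2) / 2)))"
      using e by (intro lborel_integral_real_affine) auto
    also have "\<dots> = e *\<^sub>R (LINT y|lborel. of_real (sqrt (2 * pi)) * (std_normal_density y *\<^sub>R f (t + e * y)))"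
      using e by (simp add: std_normal_density_def scaleR_conv_of_real field_simps)
    also have "\<dots> = of_real e * of_real (sqrt (2 * pi)) * (LINT y|std_normal_distribution. f (t + e * y))"
      by (subst integral_density) (auto simp: scaleR_conv_of_real)
    finally have "(LINT w|lborel. F w * cis (t * w) * of_real (?g e w))
        = (of_real (sqrt (2 * pi)) / of_real e) * (of_real e * of_real (sqrt (2 * pi))
            * (LINT y|std_normal_distribution. f (t + e * y)))" .
    also have "\<dots> = (of_real (sqrt (2 * pi)) * of_real (sqrt (2 * pi)))
            * (LINT y|std_normal_distribution. f (t + e * y))"
      using e by (simp add: field_simps)
    also have "of_real (sqrt (2 * pi)) * of_real (sqrt (2 * pi)) = (of_real (2 * pi) :: complex)"
      by (simp flip: of_real_mult)
    finally show ?thesis .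
  qed
  have "(\<lambda>n. LINT w|lborel. F w * cis (t * w) * of_real (?g (1 / real (Suc n)) w))
      \<longlonglongrightarrow> (LINT w|lborel. F w * cis (t * w) * of_real (exp 0))"
  proof (rule integral_dominated_convergence[OF _ _ i[of C']])
    show "AE w in lborel. (\<lambda>n. F w * cis (t * w) * of_real (?g (1 / real (Suc n)) w))
        \<longlonglongrightarrow> F w * cis (t * w) * of_real (exp 0)"
    proof (intro AE_I2 tendsto_intros)
      fix w :: real
      have "(\<lambda>n. 1 / real (Suc n)) \<longlonglongrightarrow> 0"
        by real_asymp
      then have "(\<lambda>n. - ((1 / real (Suc n) * w)\<^sup>2) / 2) \<longlonglongrightarrow> - ((0 * w)\<^sup>2) / 2"
        by (intro tendsto_intros) auto
      then show "(\<lambda>n. - ((1 / real (Suc n) * w)\<^sup>2) / 2) \<longlonglongrightarrow> 0"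
        by simp
    qed
    show "AE w in lborel. norm (F w * cis (t * w) * of_real (?g (1 / real (Suc n)) w)) \<le> C' / (1 + w\<^sup>2)" for n
    proof (intro AE_I2)
      fix w :: real
      have "cmod (F w) * ?g (1 / real (Suc n)) w \<le> C' / (1 + w\<^sup>2) * 1"
        using order_trans[OF norm_ge_zero F[of w]] by (intro mult_mono F) auto
      then show "norm (F w * cis (t * w) * of_real (?g (1 / real (Suc n)) w)) \<le> C' / (1 + w\<^sup>2)"
        by (simp add: norm_mult)
    qed
  qed measurable
  moreover have "(\<lambda>n. LINT y|std_normal_distribution. f (t + 1 / real (Suc n) * y))
      \<longlonglongrightarrow> (LINT y|std_normal_distribution. f (t + 0 * y))"
  proof (rule integral_dominated_convergence[where w = "\<lambda>_. C"])
    show "AE y in std_normal_distribution. (\<lambda>n. f (t + 1 / real (Suc n) * y)) \<longlonglongrightarrow> f (t + 0 * y)"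
    proof (intro AE_I2)
      fix y :: real
      have "(\<lambda>n. t + 1 / real (Suc n) * y) \<longlonglongrightarrow> t + 0 * y"
        by real_asymp
      then show "(\<lambda>n. f (t + 1 / real (Suc n) * y)) \<longlonglongrightarrow> f (t + 0 * y)"
        using cont by (intro continuous_on_tendsto_compose[OF cont]) auto
    qed
  qed (use fb in auto)
  then have "(\<lambda>n. of_real (2 * pi) * (LINT y|std_normal_distribution. f (t + 1 / real (Suc n) * y)))
      \<longlonglongrightarrow> of_real (2 * pi) * (LINT y|std_normal_distribution. f (t + 0 * y))"
    by (rule tendsto_mult_left)
  ultimately have "(LINT w|lborel. F w * cis (t * w) * of_real (exp 0))
      = of_real (2 * pi) * (LINT y|std_normal_distribution. f (t + 0 * y))"
    by (subst (asm) reg) (auto dest: LIMSEQ_unique)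
  moreover have "(LINT y|std_normal_distribution. f (t + 0 * y)) = f t"
    using N.prob_space by simp
  ultimately have "(LINT w|lborel. F w * cis (t * w)) = of_real (2 * pi) * f t"
    by (simp only: exp_zero of_real_1 mult_1_right)
  then show "(LINT w|lborel. F w * cis (t * w)) / of_real (2 * pi) = f t"
    by simp
qed

text \<open>
  Inserting the inversion formula for \<open>\<phi> (t - y) x\<close> and integrating over \<open>y\<close> first produces the
  characteristic function of \<open>\<mu>\<close> as a multiplier.
\<close>

lemma Dt_bracket_test_convolution:
  assumes \<mu>: "real_distribution \<mu>" "\<And>w. char \<mu> w = of_real (japanese w powr s)"
    and \<phi>: "\<phi> \<in> schwartz"
  shows "Dt_bracket_test s \<phi> t x = (LINT y|\<mu>. \<phi> (t - y) x)"
proof -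
  interpret \<mu>: real_distribution \<mu> by fact
  define f where "f = (\<lambda>t. \<phi> t x)"
  define F where "F = (\<lambda>w. LINT t|lborel. f t * cis (- (t * w)))"
  have cf: "continuous_on UNIV f"
    unfolding f_def using schwartz_continuous_compose[OF \<phi>, of UNIV "\<lambda>t. t" "\<lambda>_. x" 0 0]
    by (simp add: continuous_on_const continuous_on_id)
  have f: "cmod (f t) \<le> decay_seminorm 0 0 \<phi> / (1 + t\<^sup>2)" for t
    using schwartz_decay[OF \<phi>, of 0 0 t x] by (simp add: f_def)
  define C' where "C' = pi * decay_seminorm 0 0 \<phi> + pi * decay_seminorm 2 0 \<phi>"
  have F: "cmod (F w) \<le> C' / (1 + w\<^sup>2)" for w
  proof -
    have eq: "F w = (LINT t|lborel. cis (t * (- w)) * (Dx ^^ 0) \<phi> t x)"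
      by (simp add: F_def f_def mult.commute)
    have "(1 + w\<^sup>2) * cmod (F w) \<le> C'"
      using time_integral_bound[OF \<phi>, of "- w" 0 0 x] time_integral_bound[OF \<phi>, of "- w" 2 0 x]
      unfolding eq C'_def by (simp add: distrib_right)
    then show ?thesis
      by (simp add: pos_le_divide_eq add_pos_nonneg mult.commute)
  qed
  note Fm [measurable] = Fourier_inversion(1)[OF cf f fun_cong[OF F_def] F]
  note inv = Fourier_inversion(2)[OF cf f fun_cong[OF F_def] F]
  have [measurable]: "f \<in> borel_measurable borel"
    by (rule borel_measurable_continuous_onI[OF cf])
  have tf: "time_fourier \<phi> w x = F w" for w
    unfolding time_fourier_def F_def f_def[symmetric, THEN fun_cong]
    by (rule integral_completion) measurable
  have i: "integrable lborel (\<lambda>t::real. C' / (1 + t\<^sup>2))"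
    using integrable_mult_right[OF integrable_inverse_square, of C'] by simp
  have int: "integrable (lborel \<Otimes>\<^sub>M \<mu>) (\<lambda>(w, y). F w * cis ((t - y) * w))"
    by (rule integrable_prob_pair[OF \<mu>.prob_space_axioms _ _ i]) (use F in \<open>auto simp: norm_mult\<close>)
  interpret P: pair_sigma_finite lborel \<mu> ..
  have "(LINT y|\<mu>. f (t - y)) = (LINT y|\<mu>. (LINT w|lborel. F w * cis ((t - y) * w)) / of_real (2 * pi))"
    by (simp only: inv)
  also have "\<dots> = (LINT y|\<mu>. (LINT w|lborel. F w * cis ((t - y) * w))) / of_real (2 * pi)"
    by simp
  also have "(LINT y|\<mu>. (LINT w|lborel. F w * cis ((t - y) * w)))
      = (LINT w|lborel. (LINT y|\<mu>. F w * cis ((t - y) * w)))"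
    by (rule P.Fubini_integral[OF int])
  also have "\<dots> = (LINT w|lborel. of_real (japanese w powr s) * F w * cis (t * w))"
  proof (intro Bochner_Integration.integral_cong refl)
    fix w
    have "(LINT y|\<mu>. F w * cis ((t - y) * w)) = (LINT y|\<mu>. F w * cis (t * w) * cis ((- w) * y))"
      by (simp add: cis_mult algebra_simps)
    also have "\<dots> = F w * cis (t * w) * char \<mu> (- w)"
      by (subst integral_mult_right_zero) (simp add: char_def cis_conv_exp)
    finally show "(LINT y|\<mu>. F w * cis ((t - y) * w)) = of_real (japanese w powr s) * F w * cis (t * w)"
      by (simp add: \<mu>(2) mult_ac)
  qed
  also have "\<dots> = (LINT w|lebesgue. of_real (japanese w powr s) * time_fourier \<phi> w x * cis (t * w))"
    unfolding tf by (rule integral_completion[symmetric]) measurable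
  finally show ?thesis
    by (simp add: Dt_bracket_test_def f_def)
qed

text \<open>
  Convolution with a probability measure multiplies the pairing with a plane wave by the
  characteristic function.  The first two conclusions allow the Bessel potential to be paired with
  a trigonometric polynomial, as in \<open>fun_dist_trig_sum\<close>.
\<close>

lemma Dt_bracket_test_regular:
  fixes \<phi>
  assumes s: "s > 0" and \<phi>: "\<phi> \<in> schwartz"
  defines "\<Phi> \<equiv> Dt_bracket_test (- s) \<phi>"
  shows "continuous_on UNIV (\<Phi> t)"
    and "integrable lborel (\<lambda>t. test_coeff k (\<Phi> t))"
    and "plane_wave w k \<Phi> = of_real (japanese w powr (- s)) * plane_wave w k \<phi>"
proof -
  obtain \<mu> where \<mu>: "real_distribution \<mu>" "\<And>w. char \<mu> w = of_real (japanese w powr (- s))"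
    using bessel_measure_exists[OF s] by blast
  interpret \<mu>: real_distribution \<mu> by fact
  have \<Phi>: "\<Phi> t x = (LINT y|\<mu>. \<phi> (t - y) x)" for t x
    unfolding \<Phi>_def by (rule Dt_bracket_test_convolution[OF \<mu> \<phi>])
  have cont: "continuous_on S (\<lambda>z. \<phi> (a z) (b z))" if "continuous_on S a" "continuous_on S b"
    for S :: "'z::topological_space set" and a b
    using schwartz_continuous_compose[OF \<phi> that, of 0 0] by simp
  have contR: "continuous_on S (\<lambda>z. \<phi> (a z) (b z))" if "continuous_on S a" "continuous_on S b"
    for S :: "real set" and a b
    using schwartz_continuous_compose[OF \<phi> that, of 0 0] by simp
  have bdd: "cmod (\<phi> t x) \<le> decay_seminorm 0 0 \<phi>" for t x
    using schwartz_bounded[OF \<phi>, of 0 0 t x] by simp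
  have [measurable]: "(\<lambda>y. \<phi> (t - y) x) \<in> borel_measurable borel" for t x
    by (intro borel_measurable_continuous_onI contR continuous_intros)
  show c\<Phi>: "continuous_on UNIV (\<Phi> t)" for t
  proof (rule continuous_on_sequentiallyI)
    fix u :: "nat \<Rightarrow> real" and a assume u: "u \<longlonglongrightarrow> a"
    show "(\<lambda>n. \<Phi> t (u n)) \<longlonglongrightarrow> \<Phi> t a"
      unfolding \<Phi>
    proof (rule integral_dominated_convergence[where w = "\<lambda>_. decay_seminorm 0 0 \<phi>"])
      show "AE y in \<mu>. (\<lambda>n. \<phi> (t - y) (u n)) \<longlonglongrightarrow> \<phi> (t - y) a"
        by (intro AE_I2 continuous_on_tendsto_compose[OF contR u, of UNIV "\<lambda>_. t - _" "\<lambda>x. x"])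
          (auto intro: continuous_intros)
    qed (use bdd in auto)
  qed
  define h where "h = (\<lambda>t. test_coeff k (\<phi> t))"
  have hi: "integrable lborel h"
    unfolding h_def by (rule schwartz_test_coeff_integrable[OF \<phi>])
  have [measurable]: "h \<in> borel_measurable borel"
    using borel_measurable_integrable[OF hi] by simp
  interpret C\<mu>: pair_sigma_finite circle_measure \<mu> ..
  interpret C\<mu>': pair_prob_space circle_measure \<mu> ..
  interpret \<mu>L: pair_sigma_finite \<mu> lborel ..
  have tc: "test_coeff k (\<Phi> t) = (LINT y|\<mu>. h (t - y))" for t
  proof -
    have "continuous_on UNIV (\<lambda>p. cis (of_int k * fst p) * \<phi> (t - snd p) (fst p))"
      by (intro continuous_intros cont)
    then have "(\<lambda>p. cis (of_int k * fst p) * \<phi> (t - snd p) (fst p)) \<in> borel_measurable (borel \<Otimes>\<^sub>M borel)"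
      by (simp add: borel_prod borel_measurable_continuous_onI)
    then have [measurable]: "(\<lambda>(x, y). cis (of_int k * x) * \<phi> (t - y) x) \<in> borel_measurable (circle_measure \<Otimes>\<^sub>M \<mu>)"
      by (simp add: case_prod_unfold cong: measurable_cong_sets)
    have int: "integrable (circle_measure \<Otimes>\<^sub>M \<mu>) (\<lambda>(x, y). cis (of_int k * x) * \<phi> (t - y) x)"
      by (rule C\<mu>'.P.integrable_const_bound[where B = "decay_seminorm 0 0 \<phi>"])
        (use bdd in \<open>auto simp: norm_mult\<close>)
    have "test_coeff k (\<Phi> t) = (LINT x|circle_measure. cis (of_int k * x) * \<Phi> t x)"
      unfolding test_coeff_def
      by (intro torus_integral_circle borel_measurable_continuous_onI continuous_intros c\<Phi>)
    also have "\<dots> = (LINT x|circle_measure. (LINT y|\<mu>. cis (of_int k * x) * \<phi> (t - y) x))"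
      by (simp add: \<Phi>)
    also have "\<dots> = (LINT y|\<mu>. (LINT x|circle_measure. cis (of_int k * x) * \<phi> (t - y) x))"
      by (rule C\<mu>.Fubini_integral[OF int, symmetric])
    also have "\<dots> = (LINT y|\<mu>. h (t - y))"
      unfolding h_def test_coeff_def
      by (intro Bochner_Integration.integral_cong refl torus_integral_circle[symmetric]
          borel_measurable_continuous_onI continuous_intros contR)
    finally show ?thesis .
  qed
  have shift: "has_bochner_integral lborel (\<lambda>t. g (t - y)) (LINT t|lborel. g t)"
    if "integrable lborel g" for g :: "real \<Rightarrow> 'c::{banach, second_countable_topology}" and y
    using lborel_has_bochner_integral_real_affine_iff[of 1 g "LINT t|lborel. g t" "- y"]
      has_bochner_integral_integrable[OF that] by simp
  \<comment> \<open>a translate of \<open>h\<close> has no majorant uniform in \<open>y\<close>, but its norm does not depend on \<open>y\<close>; hence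
    the integral over time is the inner one\<close>
  have hint: "integrable (\<mu> \<Otimes>\<^sub>M lborel) (\<lambda>(y, t). cis (t * w) * h (t - y))" for w
  proof (rule \<mu>L.Fubini_integrable)
    have "(LINT t|lborel. norm (case (y, t) of (y, t) \<Rightarrow> cis (t * w) * h (t - y))) = (LINT t|lborel. norm (h t))" for y
      using shift[OF integrable_norm[OF hi], of y] by (simp add: norm_mult has_bochner_integral_iff)
    then show "integrable \<mu> (\<lambda>y. LINT t|lborel. norm (case (y, t) of (y, t) \<Rightarrow> cis (t * w) * h (t - y)))"
      by simp
    show "AE y in \<mu>. integrable lborel (\<lambda>t. case (y, t) of (y, t) \<Rightarrow> cis (t * w) * h (t - y))"
      using shift[OF hi] by (auto simp: has_bochner_integral_iff intro!: integrable_cis_times)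
  qed measurable
  show i\<Phi>: "integrable lborel (\<lambda>t. test_coeff k (\<Phi> t))"
    using \<mu>L.integrable_snd[OF hint[of 0]] by (simp add: tc)
  have "plane_wave w k \<Phi> = (LINT t|lborel. (LINT y|\<mu>. cis (t * w) * h (t - y)))"
    by (simp add: plane_wave_lborel[OF i\<Phi>] tc)
  also have "\<dots> = (LINT y|\<mu>. (LINT t|lborel. cis (t * w) * h (t - y)))"
    by (rule \<mu>L.Fubini_integral[OF hint])
  also have "\<dots> = (LINT y|\<mu>. cis (w * y) * (LINT t|lborel. cis (t * w) * h t))"
  proof (intro Bochner_Integration.integral_cong refl)
    fix y
    have "cis (w * y) * cis ((t - y) * w) = cis (t * w)" for t
      by (simp add: cis_mult algebra_simps)
    then have "(LINT t|lborel. cis (t * w) * h (t - y))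
        = (LINT t|lborel. cis (w * y) * (cis ((t - y) * w) * h (t - y)))"
      by (simp flip: mult.assoc)
    also have "\<dots> = cis (w * y) * (LINT t|lborel. cis (t * w) * h t)"
      using shift[OF integrable_cis_times[OF hi, of w], of y]
      by (subst integral_mult_right_zero) (simp add: has_bochner_integral_iff)
    finally show "(LINT t|lborel. cis (t * w) * h (t - y)) = cis (w * y) * (LINT t|lborel. cis (t * w) * h t)" .
  qed
  also have "\<dots> = char \<mu> w * plane_wave w k \<phi>"
    by (subst integral_mult_left_zero)
      (simp add: char_def cis_conv_exp h_def plane_wave_lborel[OF schwartz_test_coeff_integrable[OF \<phi>]])
  finally show "plane_wave w k \<Phi> = of_real (japanese w powr (- s)) * plane_wave w k \<phi>"
    by (simp add: \<mu>(2))
qed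

text \<open>
  Let \<open>r = |m| - |n|\<close>.  For \<open>r > 0\<close>, monotonicity of \<open>z powr (\<alpha> - 1)\<close> gives
  \<open>|m| powr \<alpha> - |n| powr \<alpha> \<ge> |m| powr (\<alpha> - 1) * r\<close>, whose power \<open>- s1\<close> is
  \<open>|m| powr (- 2 \<sigma>) * r powr (- s1)\<close>.  This cancels the two weights, and \<open>r\<close> is at most \<open>|m - n|\<close> and
  equal to \<open>|m - n|\<close> or \<open>|m + n|\<close>.  For \<open>r = 0\<close> the phase vanishes and \<open>s2 \<ge> 2 \<sigma>\<close> is used.
\<close>

section \<open>The dispersive gain\<close>

lemma dispersive_weight_ordered:
  fixes m n :: int
  assumes \<alpha>: "\<alpha> > 1" and \<sigma>: "\<sigma> > 0" and s1: "s1 = 2 * \<sigma> / (\<alpha> - 1)" and s2: "s2 \<ge> 2 * \<sigma>"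
    and ne: "m \<noteq> n" and le: "\<bar>n\<bar> \<le> \<bar>m\<bar>"
  shows "japanese (of_int (m - n)) powr (- s2) *
      (japanese (of_int m) powr \<sigma> * japanese (of_int n) powr \<sigma> *
       japanese (\<bar>of_int m\<bar> powr \<alpha> - \<bar>of_int n\<bar> powr \<alpha>) powr (- s1))
    \<le> 2 powr (2 * \<sigma> + s1) *
      (japanese (of_int (m - n)) powr (- (s1 + s2)) + japanese (of_int (m + n)) powr (- (s1 + s2)))"
    (is "?L \<le> ?R")
proof (cases "\<bar>n\<bar> = \<bar>m\<bar>")
  case True
  then have n: "n = - m"
    using ne by linarith
  have s1': "s1 > 0" using \<alpha> \<sigma> by (simp add: s1)
  have diff: "m - n = 2 * m" and double: "2 * \<sigma> = \<sigma> + \<sigma>"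
    using n by simp_all
  have "?L = japanese (of_int (2 * m)) powr (- s2) * japanese (of_int m) powr (2 * \<sigma>)"
    unfolding diff double powr_add by (simp add: n)
  also have "\<dots> \<le> japanese (of_int m) powr (- s2) * japanese (of_int m) powr (2 * \<sigma>)"
    using s2 \<sigma> by (intro mult_right_mono powr_mono2' japanese_mono) auto
  also have "\<dots> = japanese (of_int m) powr (2 * \<sigma> - s2)"
    by (simp flip: powr_add)
  also have "\<dots> \<le> japanese (of_int m) powr 0"
    using s2 japanese_ge_1 by (intro powr_mono) auto
  also have "\<dots> = 1 * 1" by simp
  also have "\<dots> \<le> ?R"
    using \<sigma> s1' by (intro mult_mono ge_one_powr_ge_zero) (auto simp: n)
  finally show ?thesis .
next
  case False
  define x y r where "x = real_of_int \<bar>m\<bar>" and "y = real_of_int \<bar>n\<bar>" and "r = x - y"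
  have y: "0 \<le> y" and x: "x \<ge> 1" and r: "r \<ge> 1" and yx: "y \<le> x"
    using False le by (auto simp: x_def y_def r_def)
  have s1': "s1 > 0" and s2': "s2 > 0" using \<alpha> \<sigma> s2 by (auto simp: s1)
  have Jm: "japanese (of_int m) \<le> 2 * x" and Jn: "japanese (of_int n) \<le> 2 * x"
    using japanese_le[of "of_int m"] japanese_le[of "of_int n"] x yx by (auto simp: x_def y_def)
  have "japanese (of_int m) powr \<sigma> * japanese (of_int n) powr \<sigma> \<le> (2 * x) powr \<sigma> * (2 * x) powr \<sigma>"
    using Jm Jn \<sigma> by (intro mult_mono powr_mono2) auto
  also have "\<dots> = (2 * x) powr (2 * \<sigma>)"
    by (simp flip: powr_add)
  also have "\<dots> = 2 powr (2 * \<sigma>) * x powr (2 * \<sigma>)"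
    using x by (simp add: powr_mult)
  finally have A: "japanese (of_int m) powr \<sigma> * japanese (of_int n) powr \<sigma> \<le> 2 powr (2 * \<sigma>) * x powr (2 * \<sigma>)" .
  have pow: "z powr \<alpha> = z powr (\<alpha> - 1) * z" if "z \<ge> 0" for z :: real
    using that powr_mult_base[of z "\<alpha> - 1"] by (simp add: mult.commute)
  have "x powr (\<alpha> - 1) * r = x powr (\<alpha> - 1) * x - x powr (\<alpha> - 1) * y"
    by (simp add: r_def right_diff_distrib)
  also have "\<dots> \<le> x powr (\<alpha> - 1) * x - y powr (\<alpha> - 1) * y"
    using y yx \<alpha> by (intro diff_left_mono mult_right_mono powr_mono2) auto
  also have "\<dots> = x powr \<alpha> - y powr \<alpha>"
    using pow[of x] pow[of y] x y by simp
  also have "\<dots> \<le> japanese (x powr \<alpha> - y powr \<alpha>)"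
    using japanese_ge_abs[of "x powr \<alpha> - y powr \<alpha>"] by linarith
  finally have "japanese (x powr \<alpha> - y powr \<alpha>) powr (- s1) \<le> (x powr (\<alpha> - 1) * r) powr (- s1)"
    using x r s1' by (intro powr_mono2') auto
  also have "\<dots> = x powr (- (2 * \<sigma>)) * r powr (- s1)"
  proof -
    have "(\<alpha> - 1) * (- s1) = - (2 * \<sigma>)"
      using \<alpha> by (simp add: s1)
    then show ?thesis
      using x r by (simp add: powr_mult powr_powr del: mult_minus_right)
  qed
  finally have B: "japanese (x powr \<alpha> - y powr \<alpha>) powr (- s1) \<le> x powr (- (2 * \<sigma>)) * r powr (- s1)" .
  \<comment> \<open>\<open>r\<close> is a positive integer, so \<open>\<langle>r\<rangle> \<le> 1 + r \<le> 2 r\<close>\<close>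
  have "r powr (- s1) \<le> (japanese r / 2) powr (- s1)"
    using r s1' japanese_le[of r] by (intro powr_mono2') auto
  also have "\<dots> = 2 powr s1 * japanese r powr (- s1)"
    by (simp add: powr_divide powr_minus field_simps)
  finally have C: "r powr (- s1) \<le> 2 powr s1 * japanese r powr (- s1)" .
  have D: "japanese (of_int (m - n)) powr (- s2) \<le> japanese r powr (- s2)"
    using r s2' by (intro powr_mono2' japanese_mono) (auto simp: r_def x_def y_def)
  have E: "japanese r = japanese (of_int (m - n)) \<or> japanese r = japanese (of_int (m + n))"
  proof -
    have "r = of_int (m - n) \<or> r = - of_int (m - n) \<or> r = of_int (m + n) \<or> r = - of_int (m + n)"
      unfolding r_def x_def y_def by (auto simp: abs_if)
    then show ?thesis
      by (metis japanese_minus)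
  qed
  have "?L = japanese (of_int (m - n)) powr (- s2) *
      (japanese (of_int m) powr \<sigma> * japanese (of_int n) powr \<sigma> *
       japanese (x powr \<alpha> - y powr \<alpha>) powr (- s1))"
    by (simp add: x_def y_def)
  also have "\<dots> \<le> japanese r powr (- s2) * ((2 powr (2 * \<sigma>) * x powr (2 * \<sigma>)) * (x powr (- (2 * \<sigma>)) * r powr (- s1)))"
    by (intro mult_mono[OF D mult_mono[OF A B]]) auto
  also have "\<dots> = japanese r powr (- s2) * (2 powr (2 * \<sigma>) * r powr (- s1))"
  proof -
    have "x powr (2 * \<sigma>) * x powr (- (2 * \<sigma>)) = 1"
      using x by (simp flip: powr_add)
    then show ?thesis
      by (simp add: mult_ac)
  qed
  also have "\<dots> \<le> japanese r powr (- s2) * (2 powr (2 * \<sigma>) * (2 powr s1 * japanese r powr (- s1)))"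
    by (intro mult_left_mono C) auto
  also have "\<dots> = 2 powr (2 * \<sigma> + s1) * japanese r powr (- (s1 + s2))"
    by (simp add: powr_add mult_ac flip: powr_add[of "japanese r"])
  also have "\<dots> \<le> ?R"
    using E by (intro mult_left_mono) auto
  finally show ?thesis .
qed

lemma dispersive_weight:
  fixes m n :: int
  assumes \<alpha>: "\<alpha> > 1" and \<sigma>: "\<sigma> > 0" and s1: "s1 = 2 * \<sigma> / (\<alpha> - 1)" and s2: "s2 \<ge> 2 * \<sigma>"
    and ne: "m \<noteq> n"
  shows "japanese (of_int (m - n)) powr (- s2) *
      (japanese (of_int m) powr \<sigma> * japanese (of_int n) powr \<sigma> *
       japanese (\<bar>of_int m\<bar> powr \<alpha> - \<bar>of_int n\<bar> powr \<alpha>) powr (- s1))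
    \<le> 2 powr (2 * \<sigma> + s1) *
      (japanese (of_int (m - n)) powr (- (s1 + s2)) + japanese (of_int (m + n)) powr (- (s1 + s2)))"
proof (cases "\<bar>n\<bar> \<le> \<bar>m\<bar>")
  case True
  then show ?thesis by (rule dispersive_weight_ordered[OF assms])
next
  case False
  have sym: "japanese (a - b) = japanese (b - a)" for a b
    using japanese_minus[of "a - b"] by simp
  show ?thesis
    using dispersive_weight_ordered[OF \<alpha> \<sigma> s1 s2, of n m] False ne
    by (simp add: sym[of "of_int m"] sym[of "\<bar>of_int m\<bar> powr \<alpha>"] add.commute mult_ac)
qed

lemma fibre_minus: "bij_betw (\<lambda>n. (n + j, n)) UNIV ((\<lambda>(m, n). m - n :: int) -` {j})"
  by (rule bij_betwI[where g = snd]) auto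

text \<open>
  On the fibre \<open>m - n = j\<close> the weight \<open>\<langle>m - n\<rangle> powr (- p)\<close> is constant and the sum of \<open>c m * c n\<close> is
  at most the squared norm \<open>E\<close> of \<open>c\<close>.  For the weight \<open>\<langle>m + n\<rangle> powr (- p)\<close>, the Cauchy-Schwarz
  inequality separates it from the products: its squares have a sum bounded independently of \<open>j\<close>, and
  the sums of \<open>(c m * c n)\<^sup>2\<close> over the fibres add up to \<open>E\<^sup>2\<close>.  Both parts use \<open>2 p > 1\<close>.
\<close>

lemma convolution_amplitudes:
  fixes c :: "int \<Rightarrow> real" and b :: "int \<times> int \<Rightarrow> complex"
  assumes c: "\<And>n. 0 \<le> c n" "(\<lambda>n. (c n)\<^sup>2) summable_on UNIV"
    and p: "p > 1 / 2"
    and b: "\<And>m n. japanese (of_int (m - n)) powr r * cmod (b (m, n))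
      \<le> K * (c m * c n * (japanese (of_int (m - n)) powr (- p) + japanese (of_int (m + n)) powr (- p)))"
  shows "sobolev_amplitudes r (\<lambda>(m, n). m - n) b"
proof -
  let ?\<kappa> = "\<lambda>(m, n). m - n :: int"
  let ?J = "\<lambda>k::int. japanese (of_int k)"
  define E where "E = (\<Sum>\<^sub>\<infinity>n\<in>UNIV. (c n)\<^sup>2)"
  define V where "V = (\<Sum>\<^sub>\<infinity>k\<in>UNIV. ?J k powr (- (2 * p)))"
  define Z where "Z = (\<lambda>j. \<Sum>\<^sub>\<infinity>n\<in>UNIV. (c (n + j) * c n)\<^sup>2)"
  define X where "X = (\<lambda>j. \<Sum>\<^sub>\<infinity>n\<in>UNIV. c (n + j) * c n)"
  define Y where "Y = (\<lambda>j. \<Sum>\<^sub>\<infinity>n\<in>UNIV. (c (n + j) * c n) * ?J (n + j + n) powr (- p))"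
  have V: "(\<lambda>k. ?J k powr (- (2 * p))) summable_on UNIV"
    by (rule summable_on_japanese) (use p in simp)
  have shift_bij: "bij_betw (\<lambda>n. n + j) UNIV (UNIV :: int set)" for j
    by (rule bij_betwI[where g = "\<lambda>n. n - j"]) auto
  have shift: "(\<lambda>n. (c (n + j))\<^sup>2) summable_on UNIV" "(\<Sum>\<^sub>\<infinity>n\<in>UNIV. (c (n + j))\<^sup>2) = E" for j
    using summable_on_reindex_bij_betw[OF shift_bij[of j], of "\<lambda>n. (c n)\<^sup>2"] c(2)
      infsum_reindex_bij_betw[OF shift_bij[of j], of "\<lambda>n. (c n)\<^sup>2"] by (simp_all add: E_def)
  have E: "0 \<le> E"
    by (simp add: E_def infsum_nonneg)
  have Xs: "(\<lambda>n. c (n + j) * c n) summable_on UNIV" for j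
    by (rule infsum_Cauchy_Schwarz(1)[OF c(1) shift(1) c])
  have X: "X j \<le> E" for j
  proof -
    have "(X j)\<^sup>2 \<le> E\<^sup>2"
      using infsum_Cauchy_Schwarz(2)[OF c(1) shift(1)[of j] c]
      by (simp add: X_def shift(2) power2_eq_square[of E]) (simp add: E_def)
    then show ?thesis
      using E by (rule power2_le_imp_le)
  qed
  \<comment> \<open>the product family of \<open>(c m)\<^sup>2 * (c n)\<^sup>2\<close> is summable; the pairs are sorted by their difference \<open>j\<close>\<close>
  have Zs: "(\<lambda>n. (c (n + j) * c n)\<^sup>2) summable_on UNIV" "Z summable_on UNIV" for j
  proof -
    have "(\<lambda>(m, n). (c m)\<^sup>2 * (c n)\<^sup>2) summable_on UNIV \<times> UNIV"
    proof (rule summable_on_SigmaI)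
      show "((\<lambda>n. case (m, n) of (m, n) \<Rightarrow> (c m)\<^sup>2 * (c n)\<^sup>2) has_sum (c m)\<^sup>2 * E) UNIV" for m
        using has_sum_cmult_right[OF has_sum_infsum[OF c(2)], of "(c m)\<^sup>2"] by (simp add: E_def)
      show "(\<lambda>m. (c m)\<^sup>2 * E) summable_on UNIV"
        by (rule summable_on_cmult_left[OF c(2)])
    qed simp
    moreover have "bij_betw (\<lambda>(j, n). (n + j, n)) (UNIV \<times> UNIV) (UNIV \<times> (UNIV :: int set))"
      by (rule bij_betwI[where g = "\<lambda>(m, n). (m - n, n)"]) auto
    ultimately have *: "(\<lambda>(j, n). (c (n + j) * c n)\<^sup>2) summable_on (UNIV \<times> UNIV)"
      using summable_on_reindex_bij_betw[of "\<lambda>(j, n). (n + j, n)" "UNIV \<times> UNIV" "UNIV \<times> UNIV"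
          "\<lambda>(m, n). (c m)\<^sup>2 * (c n)\<^sup>2"] by (simp add: case_prod_unfold power_mult_distrib)
    show "(\<lambda>n. (c (n + j) * c n)\<^sup>2) summable_on UNIV"
      using summable_on_SigmaD1[OF *] by simp
    show "Z summable_on UNIV"
      unfolding Z_def using summable_on_Sigma_banach[of "\<lambda>j n. (c (n + j) * c n)\<^sup>2" UNIV "\<lambda>_. UNIV"] * by simp
  qed
  \<comment> \<open>on the fibre, \<open>m + n = 2 n + j\<close> takes each integer value at most once\<close>
  have inj: "inj (\<lambda>n. n + j + n)" for j :: int
    by (auto simp: inj_def)
  have Vs: "(\<lambda>n. (?J (n + j + n) powr (- p))\<^sup>2) summable_on UNIV"
      "(\<Sum>\<^sub>\<infinity>n\<in>UNIV. (?J (n + j + n) powr (- p))\<^sup>2) \<le> V" for j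
  proof -
    have eq: "(?J k powr (- p))\<^sup>2 = ?J k powr (- (2 * p))" for k
      by (simp add: power2_eq_square flip: powr_add)
    have sub: "(\<lambda>k. ?J k powr (- (2 * p))) summable_on range (\<lambda>n. n + j + n)"
      by (rule summable_on_subset_banach[OF V]) simp
    show "(\<lambda>n. (?J (n + j + n) powr (- p))\<^sup>2) summable_on UNIV"
      using summable_on_reindex[OF inj, of "\<lambda>k. ?J k powr (- (2 * p))" j] sub
      unfolding eq o_def by simp
    have "(\<Sum>\<^sub>\<infinity>n\<in>UNIV. (?J (n + j + n) powr (- p))\<^sup>2) = infsum (\<lambda>k. ?J k powr (- (2 * p))) (range (\<lambda>n. n + j + n))"
      using infsum_reindex[OF inj, of "\<lambda>k. ?J k powr (- (2 * p))" j] unfolding eq o_def by simp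
    also have "\<dots> \<le> V"
      unfolding V_def by (rule infsum_mono_neutral[OF sub V]) auto
    finally show "(\<Sum>\<^sub>\<infinity>n\<in>UNIV. (?J (n + j + n) powr (- p))\<^sup>2) \<le> V" .
  qed
  have Ys: "(\<lambda>n. (c (n + j) * c n) * ?J (n + j + n) powr (- p)) summable_on UNIV" for j
    by (rule infsum_Cauchy_Schwarz(1)[OF _ Zs(1) _ Vs(1)]) (use c in auto)
  have Y: "(Y j)\<^sup>2 \<le> Z j * V" for j
  proof -
    have "(Y j)\<^sup>2 \<le> Z j * (\<Sum>\<^sub>\<infinity>n\<in>UNIV. (?J (n + j + n) powr (- p))\<^sup>2)"
      unfolding Y_def Z_def
      by (rule infsum_Cauchy_Schwarz(2)[OF _ Zs(1) _ Vs(1)]) (use c in auto)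
    also have "\<dots> \<le> Z j * V"
      by (intro mult_left_mono Vs) (auto simp: Z_def intro: infsum_nonneg)
    finally show ?thesis .
  qed
  have K: "?J j powr r * cmod (b (n + j, n))
      \<le> K * (?J j powr (- p) * (c (n + j) * c n) + (c (n + j) * c n) * ?J (n + j + n) powr (- p))" for j n
    using b[of "n + j" n] by (simp add: algebra_simps)
  have dom: "(\<lambda>n. K * (?J j powr (- p) * (c (n + j) * c n) + (c (n + j) * c n) * ?J (n + j + n) powr (- p)))
      summable_on UNIV" for j
    by (intro summable_on_cmult_right summable_on_add Xs Ys)
  have Js: "(\<lambda>n. ?J j powr r * cmod (b (n + j, n))) summable_on UNIV" for j
    by (rule norm_dominated_summable(2)[OF dom]) (use K in auto)
  have fib: "(\<lambda>n. cmod (b (n + j, n))) summable_on UNIV" for j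
    using summable_on_cmult_right[OF Js[of j], of "1 / ?J j powr r"] by simp
  have fibs: "(\<lambda>i. cmod (b i)) summable_on ?\<kappa> -` {j}" for j
    using summable_on_reindex_bij_betw[OF fibre_minus[of j], of "\<lambda>i. cmod (b i)"] fib[of j] by simp
  have mass: "?J j powr r * fibre_mass ?\<kappa> b j \<le> K * (?J j powr (- p) * X j + Y j)" for j
  proof -
    have "fibre_mass ?\<kappa> b j = (\<Sum>\<^sub>\<infinity>n\<in>UNIV. cmod (b (n + j, n)))"
      unfolding fibre_mass_def
      using infsum_reindex_bij_betw[OF fibre_minus[of j], of "\<lambda>i. cmod (b i)"] by simp
    then have "?J j powr r * fibre_mass ?\<kappa> b j = (\<Sum>\<^sub>\<infinity>n\<in>UNIV. ?J j powr r * cmod (b (n + j, n)))"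
      by (simp add: infsum_cmult_right')
    also have "\<dots> \<le> (\<Sum>\<^sub>\<infinity>n\<in>UNIV. K * (?J j powr (- p) * (c (n + j) * c n)
        + (c (n + j) * c n) * ?J (n + j + n) powr (- p)))"
      by (rule infsum_mono[OF Js dom K])
    also have "\<dots> = K * (?J j powr (- p) * X j + Y j)"
      unfolding X_def Y_def
      by (simp only: infsum_cmult_right' infsum_add[OF summable_on_cmult_right[OF Xs] Ys])
    finally show ?thesis .
  qed
  have sq: "(?J j powr r * fibre_mass ?\<kappa> b j)\<^sup>2
      \<le> 2 * K\<^sup>2 * E\<^sup>2 * ?J j powr (- (2 * p)) + 2 * K\<^sup>2 * V * Z j" for j
  proof -
    have X0: "0 \<le> X j"
      unfolding X_def using c(1) by (intro infsum_nonneg) simp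
    have "(?J j powr r * fibre_mass ?\<kappa> b j)\<^sup>2 \<le> (K * (?J j powr (- p) * X j + Y j))\<^sup>2"
      by (intro power_mono mass) simp
    also have "\<dots> \<le> K\<^sup>2 * (2 * (?J j powr (- p) * X j)\<^sup>2 + 2 * (Y j)\<^sup>2)"
      unfolding power_mult_distrib[of K] using sum_squares_bound[of "?J j powr (- p) * X j" "Y j"]
      by (intro mult_left_mono) (auto simp: power2_sum)
    also have "\<dots> \<le> K\<^sup>2 * (2 * (?J j powr (- p) * E)\<^sup>2 + 2 * (Z j * V))"
      using X X0 by (intro mult_left_mono add_mono Y power_mono) auto
    also have "(?J j powr (- p) * E)\<^sup>2 = E\<^sup>2 * ?J j powr (- (2 * p))"
      by (simp add: power2_eq_square mult_ac flip: powr_add)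
    finally show ?thesis
      by (simp add: algebra_simps)
  qed
  have "(\<lambda>j. (?J j powr r * fibre_mass ?\<kappa> b j)\<^sup>2) summable_on UNIV"
  proof (rule summable_on_comparison_test[OF _ sq])
    show "(\<lambda>j. 2 * K\<^sup>2 * E\<^sup>2 * ?J j powr (- (2 * p)) + 2 * K\<^sup>2 * V * Z j) summable_on UNIV"
      by (intro summable_on_add summable_on_cmult_right V Zs)
  qed simp
  then show ?thesis
    using fibs by (simp add: sobolev_amplitudes_def)
qed

text \<open>
  Bounds the Sobolev norms of the remainders, uniformly in time.
\<close>

lemma amplitudes_tendsto_0:
  assumes a: "sobolev_amplitudes r \<kappa> a"
    and le: "\<And>N i. cmod (b N i) \<le> cmod (a i)" and lim: "\<And>i. (\<lambda>N. b N i) \<longlonglongrightarrow> 0"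
  shows "(\<lambda>N::nat. \<Sum>\<^sub>\<infinity>j\<in>UNIV. (japanese (of_int j) powr r * fibre_mass \<kappa> (b N) j)\<^sup>2) \<longlonglongrightarrow> 0"
proof -
  have q: "(\<lambda>j. (japanese (of_int j) powr r * fibre_mass \<kappa> a j)\<^sup>2) summable_on UNIV"
    and fib: "\<And>j. (\<lambda>i. cmod (a i)) summable_on \<kappa> -` {j}"
    using a by (auto simp: sobolev_amplitudes_def)
  have m: "(\<lambda>N. fibre_mass \<kappa> (b N) j) \<longlonglongrightarrow> (\<Sum>\<^sub>\<infinity>i\<in>\<kappa> -` {j}. cmod 0)" for j
    unfolding fibre_mass_def
    by (rule infsum_dominated_convergence[OF _ fib]) (simp add: le, rule tendsto_norm, rule lim)
  have "(\<lambda>N. \<Sum>\<^sub>\<infinity>j\<in>UNIV. (japanese (of_int j) powr r * fibre_mass \<kappa> (b N) j)\<^sup>2)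
      \<longlonglongrightarrow> (\<Sum>\<^sub>\<infinity>j\<in>(UNIV :: int set). (japanese (of_int j) powr r * (\<Sum>\<^sub>\<infinity>i\<in>\<kappa> -` {j}. cmod 0))\<^sup>2)"
  proof (rule infsum_dominated_convergence[OF _ q])
    fix N j
    have "(japanese (of_int j) powr r * fibre_mass \<kappa> (b N) j)\<^sup>2
        \<le> (japanese (of_int j) powr r * fibre_mass \<kappa> a j)\<^sup>2"
      by (intro power_mono mult_left_mono sobolev_amplitudes_mono(2)[OF a le]) auto
    then show "norm ((japanese (of_int j) powr r * fibre_mass \<kappa> (b N) j)\<^sup>2)
        \<le> (japanese (of_int j) powr r * fibre_mass \<kappa> a j)\<^sup>2"
      by simp
  qed (intro tendsto_intros m)
  then show ?thesis by simp
qed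

section \<open>Trigonometric polynomials and the inequality of Bessel\<close>

definition trig_poly :: "int set \<Rightarrow> (int \<Rightarrow> complex) \<Rightarrow> real \<Rightarrow> complex" where
  "trig_poly B d x = (\<Sum>n\<in>B. d n * cis (of_int n * x))"

lemma continuous_on_trig_poly: "continuous_on S (trig_poly B d)"
  unfolding trig_poly_def[abs_def] by (intro continuous_intros)

lemma fourier_coeff_trig_poly:
  assumes "finite B"
  shows "fourier_coeff (trig_poly B d) n = (if n \<in> B then d n else 0)"
proof -
  have "fourier_coeff (trig_poly B d) n
      = torus_integral (\<lambda>x. \<Sum>m\<in>B. d m * (cis (of_int m * x) * cis (- (of_int n * x))))"
    by (simp add: fourier_coeff_def trig_poly_def sum_distrib_right mult.assoc)
  also have "\<dots> = (\<Sum>m\<in>B. torus_integral (\<lambda>x. d m * (cis (of_int m * x) * cis (- (of_int n * x)))))"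
    by (rule torus_integral_sum) (intro continuous_intros)
  also have "\<dots> = (\<Sum>m\<in>B. d m * test_coeff m (\<lambda>x. cis (- (of_int n * x))))"
    by (simp add: torus_integral_cmult test_coeff_def)
  also have "\<dots> = (if n \<in> B then d n else 0)"
    using assms by (simp add: test_coeff_cis if_distrib cong: if_cong)
  finally show ?thesis .
qed

lemma Dx_multiplier_trig_poly:
  assumes "finite B"
  shows "Dx_multiplier m (trig_poly B d) = trig_poly B (\<lambda>n. m n * d n)"
proof (rule ext)
  fix x
  have "Dx_multiplier m (trig_poly B d) x = (\<Sum>\<^sub>\<infinity>n\<in>B. m n * d n * cis (of_int n * x))"
    unfolding Dx_multiplier_def
    by (rule infsum_cong_neutral) (auto simp: fourier_coeff_trig_poly[OF assms])
  then show "Dx_multiplier m (trig_poly B d) x = trig_poly B (\<lambda>n. m n * d n) x"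
    using assms by (simp add: trig_poly_def)
qed

lemma cmod_trig_poly_squared:
  "of_real ((cmod (trig_poly B d x))\<^sup>2)
    = (\<Sum>(m, n)\<in>B \<times> B. d m * cnj (d n) * cis (of_int (m - n) * x))"
proof -
  have "of_real ((cmod (trig_poly B d x))\<^sup>2) = trig_poly B d x * cnj (trig_poly B d x)"
    by (rule complex_norm_square)
  also have "\<dots> = (\<Sum>m\<in>B. \<Sum>n\<in>B. (d m * cis (of_int m * x)) * cnj (d n * cis (of_int n * x)))"
    by (simp add: trig_poly_def sum_product)
  also have "\<dots> = (\<Sum>m\<in>B. \<Sum>n\<in>B. d m * cnj (d n) * cis (of_int (m - n) * x))"
  proof (intro sum.cong refl)
    fix m n
    have "cis (of_int m * x) * cis (- (of_int n * x)) = cis (of_int (m - n) * x)"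
      by (simp add: cis_mult algebra_simps)
    then show "(d m * cis (of_int m * x)) * cnj (d n * cis (of_int n * x))
        = d m * cnj (d n) * cis (of_int (m - n) * x)"
      by (simp add: cis_cnj mult_ac)
  qed
  finally show ?thesis
    by (simp add: sum.cartesian_product)
qed

lemma torus_integral_cmod_trig_poly:
  assumes "finite B"
  shows "torus_integral (\<lambda>x. of_real ((cmod (trig_poly B d x))\<^sup>2)) = of_real (\<Sum>n\<in>B. (cmod (d n))\<^sup>2)"
proof -
  have "torus_integral (\<lambda>x. of_real ((cmod (trig_poly B d x))\<^sup>2))
      = (\<Sum>p\<in>B \<times> B. torus_integral (\<lambda>x. case p of (m, n) \<Rightarrow> d m * cnj (d n) * cis (of_int (m - n) * x)))"
    unfolding cmod_trig_poly_squared
    by (rule torus_integral_sum) (auto simp: case_prod_unfold intro!: continuous_intros)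
  also have "\<dots> = (\<Sum>(m, n)\<in>B \<times> B. if m = n then d m * cnj (d n) else 0)"
  proof (intro sum.cong refl)
    fix p :: "int \<times> int"
    obtain m n where p: "p = (m, n)" by (cases p)
    show "torus_integral (\<lambda>x. case p of (m, n) \<Rightarrow> d m * cnj (d n) * cis (of_int (m - n) * x))
        = (case p of (m, n) \<Rightarrow> if m = n then d m * cnj (d n) else 0)"
      unfolding p prod.case torus_integral_cmult torus_integral_cis by simp
  qed
  also have "\<dots> = (\<Sum>m\<in>B. \<Sum>n\<in>B. if m = n then d m * cnj (d n) else 0)"
    by (simp add: sum.cartesian_product)
  also have "\<dots> = (\<Sum>m\<in>B. d m * cnj (d m))"
    using assms by (intro sum.cong refl) simp
  also have "\<dots> = of_real (\<Sum>n\<in>B. (cmod (d n))\<^sup>2)"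
    by (simp only: of_real_sum complex_norm_square)
  finally show ?thesis .
qed

text \<open>
  The square of \<open>u\<close> minus its partial Fourier sum has a nonnegative integral.  A product of \<open>u\<close> with a
  bounded continuous function is integrable since \<open>|u| \<le> |u|\<^sup>2 + 1\<close>.
\<close>

lemma Bessel_inequality:
  assumes u: "u \<in> L2_torus"
  shows "(\<lambda>n. (cmod (fourier_coeff u n))\<^sup>2) summable_on UNIV"
proof -
  let ?A = "{0..2 * pi} :: real set"
  have um: "u \<in> borel_measurable lebesgue" and u2: "set_integrable lebesgue ?A (\<lambda>x. (cmod (u x))\<^sup>2)"
    using u by (auto simp: L2_torus_def)
  have one: "set_integrable lebesgue ?A (\<lambda>x. 1 :: real)"
    by (rule absolutely_integrable_continuous_real) (intro continuous_intros)
  have prod_int: "set_integrable lebesgue ?A (\<lambda>x. u x * k x)" if k: "continuous_on UNIV k" "\<And>x. cmod (k x) \<le> C" for k C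
    unfolding set_integrable_def
  proof (rule Bochner_Integration.integrable_bound)
    have "set_integrable lebesgue ?A (\<lambda>x. C * ((cmod (u x))\<^sup>2 + 1))"
      by (rule set_integrable_mult_right, rule set_integral_add(1)[OF u2 one])
    then show "integrable lebesgue (\<lambda>x. indicator ?A x *\<^sub>R (C * ((cmod (u x))\<^sup>2 + 1)))"
      by (simp add: set_integrable_def)
    have [measurable]: "k \<in> borel_measurable lebesgue" "?A \<in> sets lebesgue"
      using borel_measurable_continuous_onI[OF k(1)] by (auto intro: measurable_completion)
    note um [measurable]
    show "(\<lambda>x. indicator ?A x *\<^sub>R (u x * k x)) \<in> borel_measurable lebesgue"
      by measurable
    show "AE x in lebesgue. norm (indicator ?A x *\<^sub>R (u x * k x))
        \<le> norm (indicator ?A x *\<^sub>R (C * ((cmod (u x))\<^sup>2 + 1)))"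
    proof (intro AE_I2)
      fix x
      have C: "0 \<le> C"
        using order_trans[OF norm_ge_zero k(2)] .
      have "cmod (u x) \<le> (cmod (u x))\<^sup>2 + 1"
        using sum_squares_bound[of "cmod (u x)" 1] by (simp add: power2_eq_square) (smt (verit) norm_ge_zero)
      then have "cmod (u x) * cmod (k x) \<le> ((cmod (u x))\<^sup>2 + 1) * C"
        using k(2)[of x] by (intro mult_mono) auto
      then show "norm (indicator ?A x *\<^sub>R (u x * k x)) \<le> norm (indicator ?A x *\<^sub>R (C * ((cmod (u x))\<^sup>2 + 1)))"
        using C by (auto simp: indicator_def norm_mult mult.commute abs_mult)
    qed
  qed
  let ?c = "fourier_coeff u"
  define E where "E = (LINT x:?A|lebesgue. (cmod (u x))\<^sup>2) / (2 * pi)"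
  have "(\<Sum>n\<in>B. (cmod (?c n))\<^sup>2) \<le> E" if B: "finite B" for B
  proof -
    let ?S = "trig_poly B ?c"
    let ?b = "\<Sum>n\<in>B. (cmod (?c n))\<^sup>2"
    let ?w = "\<lambda>x. u x * cnj (?S x)"
    have w_eq: "?w x = (\<Sum>n\<in>B. cnj (?c n) * (u x * cis (- (of_int n * x))))" for x
      by (simp add: trig_poly_def sum_distrib_left cis_cnj mult_ac)
    have ui: "set_integrable lebesgue ?A (\<lambda>x. cnj (?c n) * (u x * cis (- (of_int n * x))))" for n
      by (intro set_integrable_mult_right prod_int[where C = 1] continuous_intros) auto
    have wi: "set_integrable lebesgue ?A ?w"
      using ui unfolding set_integrable_def w_eq scaleR_sum_right
      by (intro Bochner_Integration.integrable_sum)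
    have coeff: "(LINT x:?A|lebesgue. u x * cis (- (of_int n * x))) = ?c n * of_real (2 * pi)" for n
      by (simp add: fourier_coeff_def torus_integral_def)
    have "(LINT x:?A|lebesgue. ?w x)
        = (\<Sum>n\<in>B. (LINT x:?A|lebesgue. cnj (?c n) * (u x * cis (- (of_int n * x)))))"
      using ui unfolding set_integrable_def set_lebesgue_integral_def w_eq scaleR_sum_right
      by (intro Bochner_Integration.integral_sum)
    also have "\<dots> = (\<Sum>n\<in>B. of_real ((cmod (?c n))\<^sup>2) * of_real (2 * pi))"
      unfolding set_integral_mult_right coeff complex_norm_square by (simp add: mult_ac)
    finally have wI: "(LINT x:?A|lebesgue. ?w x) = of_real (2 * pi * ?b)"
      by (simp add: sum_distrib_left mult_ac)
    have Si: "set_integrable lebesgue ?A (\<lambda>x. (cmod (?S x))\<^sup>2)"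
      by (rule absolutely_integrable_continuous_real) (intro continuous_intros continuous_on_trig_poly)
    have SI: "(LINT x:?A|lebesgue. (cmod (?S x))\<^sup>2) = 2 * pi * ?b"
    proof -
      have "complex_of_real (LINT x:?A|lebesgue. (cmod (?S x))\<^sup>2) / of_real (2 * pi) = of_real ?b"
        using torus_integral_cmod_trig_poly[OF B, of ?c]
        by (simp only: torus_integral_def set_integral_complex_of_real)
      then have "complex_of_real (LINT x:?A|lebesgue. (cmod (?S x))\<^sup>2) = of_real (2 * pi * ?b)"
        by (simp add: field_simps)
      then show ?thesis by (simp only: of_real_eq_iff)
    qed
    have wr: "set_integrable lebesgue ?A (\<lambda>x. Re (?w x))" "(LINT x:?A|lebesgue. Re (?w x)) = 2 * pi * ?b"
    proof -
      have r: "indicator ?A x *\<^sub>R Re (?w x) = Re (indicator ?A x *\<^sub>R ?w x)" for x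
        by simp
      show "set_integrable lebesgue ?A (\<lambda>x. Re (?w x))"
        using wi unfolding set_integrable_def r by (rule integrable_Re)
      have "(LINT x:?A|lebesgue. Re (?w x)) = Re (LINT x:?A|lebesgue. ?w x)"
        using wi unfolding set_integrable_def set_lebesgue_integral_def r by (rule integral_Re)
      then show "(LINT x:?A|lebesgue. Re (?w x)) = 2 * pi * ?b"
        by (simp add: wI)
    qed
    have "0 \<le> (LINT x:?A|lebesgue. (cmod (u x - ?S x))\<^sup>2)"
      by (simp add: set_lebesgue_integral_def)
    also have "\<dots> = (LINT x:?A|lebesgue. ((cmod (u x))\<^sup>2 + (cmod (?S x))\<^sup>2) - 2 * Re (?w x))"
    proof -
      have "(cmod (z - w))\<^sup>2 = ((cmod z)\<^sup>2 + (cmod w)\<^sup>2) - 2 * Re (z * cnj w)" for z w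
        unfolding cmod_power2 by (simp add: power2_eq_square algebra_simps)
      then show ?thesis by (simp only:)
    qed
    also have "\<dots> = (LINT x:?A|lebesgue. (cmod (u x))\<^sup>2) + 2 * pi * ?b - 2 * (2 * pi * ?b)"
      by (simp only: set_integral_diff(2)[OF set_integral_add(1)[OF u2 Si] set_integrable_mult_right[OF wr(1)]]
          set_integral_add(2)[OF u2 Si] set_integral_mult_right SI wr(2))
    finally have "2 * pi * ?b \<le> (LINT x:?A|lebesgue. (cmod (u x))\<^sup>2)"
      by linarith
    then show ?thesis
      by (simp add: E_def field_simps)
  qed
  then show ?thesis
    by (intro nonneg_bdd_above_summable_on bdd_aboveI[where M = E]) auto
qed

section \<open>The renormalized square as a superposition of plane waves\<close>

definition pair_freq :: "int \<times> int \<Rightarrow> int" where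
  "pair_freq = (\<lambda>(m, n). m - n)"

definition pair_phase :: "real \<Rightarrow> int \<times> int \<Rightarrow> real" where
  "pair_phase \<alpha> = (\<lambda>(m, n). \<bar>of_int m\<bar> powr \<alpha> - \<bar>of_int n\<bar> powr \<alpha>)"

text \<open>
  The renormalization removes the diagonal pairs, hence the amplitude zero there.
\<close>

definition wick_amplitude :: "real \<Rightarrow> (int \<Rightarrow> complex) \<Rightarrow> int \<times> int \<Rightarrow> complex" where
  "wick_amplitude \<sigma> c = (\<lambda>(m, n). if m = n then 0 else
     of_real (japanese (of_int m) powr \<sigma> * japanese (of_int n) powr \<sigma>) * c m * cnj (c n))"

definition pair_box :: "nat \<Rightarrow> (int \<times> int) set" where
  "pair_box N = {- int N..int N} \<times> {- int N..int N}"

lemma finite_pair_box [simp]: "finite (pair_box N)"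
  by (simp add: pair_box_def)

text \<open>
  The square of the Sobolev norm of the truncated datum is the diagonal part of the double sum,
  because the propagator does not change the moduli of the coefficients.
\<close>

lemma renorm_square_waves:
  "renorm_square \<alpha> \<sigma> u N t x = (\<Sum>i\<in>pair_box N. wick_amplitude \<sigma> (fourier_coeff u) i *
     cis (t * pair_phase \<alpha> i) * cis (of_int (pair_freq i) * x))"
proof -
  let ?c = "fourier_coeff u"
  let ?B = "{- int N..int N}"
  let ?d = "\<lambda>n. of_real (japanese (of_int n) powr \<sigma>) * (cis (t * \<bar>of_int n\<bar> powr \<alpha>) * ?c n)"
  let ?f = "\<lambda>m n. ?d m * cnj (?d n) * cis (of_int (m - n) * x)"
  have proj: "freq_proj N u = trig_poly ?B ?c"
    by (simp add: fun_eq_iff freq_proj_def trig_poly_def)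
  have D: "Dx_bracket \<sigma> (propagator \<alpha> t (freq_proj N u)) = trig_poly ?B ?d"
    by (simp add: Dx_bracket_def propagator_def proj Dx_multiplier_trig_poly)
  have "dist_coeff (torus_dist (freq_proj N u)) n = fourier_coeff (freq_proj N u) n" for n
    by (simp add: dist_coeff_def torus_dist_def fourier_coeff_def)
  then have "(sobolev_norm \<sigma> (torus_dist (freq_proj N u)))\<^sup>2
      = (\<Sum>\<^sub>\<infinity>n\<in>UNIV. (japanese (of_int n) powr \<sigma> * cmod (if n \<in> ?B then ?c n else 0))\<^sup>2)"
    by (simp add: sobolev_norm_def proj fourier_coeff_trig_poly infsum_nonneg)
  also have "\<dots> = (\<Sum>\<^sub>\<infinity>n\<in>?B. (japanese (of_int n) powr \<sigma> * cmod (?c n))\<^sup>2)"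
    by (rule infsum_cong_neutral) auto
  also have "\<dots> = (\<Sum>n\<in>?B. (cmod (?d n))\<^sup>2)"
    by (simp add: norm_mult)
  finally have norm: "(sobolev_norm \<sigma> (torus_dist (freq_proj N u)))\<^sup>2 = (\<Sum>n\<in>?B. (cmod (?d n))\<^sup>2)" .
  have diag: "(\<Sum>(m, n)\<in>pair_box N. if m = n then ?f m n else 0) = of_real (\<Sum>n\<in>?B. (cmod (?d n))\<^sup>2)"
  proof -
    have "(\<Sum>(m, n)\<in>pair_box N. if m = n then ?f m n else 0) = (\<Sum>m\<in>?B. \<Sum>n\<in>?B. if m = n then ?f m n else 0)"
      by (simp only: pair_box_def sum.cartesian_product)
    also have "\<dots> = (\<Sum>m\<in>?B. ?f m m)"
      by (intro sum.cong refl) (subst sum.delta', auto)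
    also have "\<dots> = (\<Sum>m\<in>?B. ?d m * cnj (?d m))"
      by simp
    finally show ?thesis
      by (simp only: of_real_sum complex_norm_square)
  qed
  have "renorm_square \<alpha> \<sigma> u N t x
      = (\<Sum>(m, n)\<in>pair_box N. ?f m n) - (\<Sum>(m, n)\<in>pair_box N. if m = n then ?f m n else 0)"
    unfolding diag unfolding renorm_square_def norm D of_real_diff cmod_trig_poly_squared pair_box_def ..
  also have "\<dots> = (\<Sum>i\<in>pair_box N. (case i of (m, n) \<Rightarrow> ?f m n) - (case i of (m, n) \<Rightarrow> if m = n then ?f m n else 0))"
    by (rule sum_subtractf[symmetric])
  also have "\<dots> = (\<Sum>i\<in>pair_box N. wick_amplitude \<sigma> ?c i *
     cis (t * pair_phase \<alpha> i) * cis (of_int (pair_freq i) * x))"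
  proof (intro sum.cong refl)
    fix i :: "int \<times> int"
    obtain m n where i: "i = (m, n)" by (cases i)
    have "cis (t * \<bar>of_int m\<bar> powr \<alpha>) * cis (- (t * \<bar>of_int n\<bar> powr \<alpha>)) = cis (t * pair_phase \<alpha> i)"
      by (simp add: i pair_phase_def cis_mult algebra_simps)
    then have "?d m * cnj (?d n) = of_real (japanese (of_int m) powr \<sigma> * japanese (of_int n) powr \<sigma>)
        * ?c m * cnj (?c n) * cis (t * pair_phase \<alpha> i)"
      by (simp add: cis_cnj mult_ac)
    then show "(case i of (m, n) \<Rightarrow> ?f m n) - (case i of (m, n) \<Rightarrow> if m = n then ?f m n else 0)
      = wick_amplitude \<sigma> ?c i * cis (t * pair_phase \<alpha> i) * cis (of_int (pair_freq i) * x)"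
      by (simp add: i wick_amplitude_def pair_freq_def)
  qed
  finally show ?thesis .
qed

lemma wick_amplitudes_sobolev:
  assumes \<alpha>: "\<alpha> > 1" and \<sigma>: "\<sigma> > 0" and s1: "s1 = 2 * \<sigma> / (\<alpha> - 1)" and s2: "s2 \<ge> 2 * \<sigma>"
    and p: "s1 + s2 > 1 / 2" and c: "(\<lambda>n. (cmod (c n))\<^sup>2) summable_on UNIV"
  shows "sobolev_amplitudes (- s2) pair_freq
    (\<lambda>i. wick_amplitude \<sigma> c i * of_real (japanese (pair_phase \<alpha> i) powr (- s1)))"
  unfolding pair_freq_def
proof (rule convolution_amplitudes[OF _ c p])
  fix m n :: int
  let ?w = "japanese (of_int m) powr \<sigma> * japanese (of_int n) powr \<sigma> *
       japanese (\<bar>of_int m\<bar> powr \<alpha> - \<bar>of_int n\<bar> powr \<alpha>) powr (- s1)"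
  let ?R = "japanese (of_int (m - n)) powr (- (s1 + s2)) + japanese (of_int (m + n)) powr (- (s1 + s2))"
  have "japanese (of_int (m - n)) powr (- s2) *
      cmod (wick_amplitude \<sigma> c (m, n) * of_real (japanese (pair_phase \<alpha> (m, n)) powr (- s1)))
    \<le> (cmod (c m) * cmod (c n)) * (2 powr (2 * \<sigma> + s1) * ?R)"
  proof (cases "m = n")
    case False
    have "japanese (of_int (m - n)) powr (- s2) *
        cmod (wick_amplitude \<sigma> c (m, n) * of_real (japanese (pair_phase \<alpha> (m, n)) powr (- s1)))
      = (cmod (c m) * cmod (c n)) * (japanese (of_int (m - n)) powr (- s2) * ?w)"
      using False by (simp add: wick_amplitude_def pair_phase_def norm_mult mult_ac)
    also have "\<dots> \<le> (cmod (c m) * cmod (c n)) * (2 powr (2 * \<sigma> + s1) * ?R)"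
      by (intro mult_left_mono dispersive_weight[OF \<alpha> \<sigma> s1 s2 False]) auto
    finally show ?thesis .
  qed (simp add: wick_amplitude_def)
  then show "japanese (of_int (m - n)) powr (- s2) *
      cmod (wick_amplitude \<sigma> c (m, n) * of_real (japanese (pair_phase \<alpha> (m, n)) powr (- s1)))
    \<le> 2 powr (2 * \<sigma> + s1) * (cmod (c m) * cmod (c n) * ?R)"
    by (simp add: mult_ac)
qed simp

text \<open>
  An integer power of \<open>\<langle>\<omega>\<rangle>\<close> above \<open>s\<close> is available from integration by parts in time.
\<close>

lemma plane_wave_series_amplitudes:
  assumes a: "sobolev_amplitudes r \<kappa> (\<lambda>i. A i * of_real (japanese (\<omega> i) powr (- s)))" and s: "s > 0"
  shows "\<phi> \<in> schwartz \<Longrightarrow> (\<lambda>i. A i * plane_wave (\<omega> i) (\<kappa> i) \<phi>) summable_on UNIV"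
    and "plane_wave_series \<kappa> \<omega> A \<in> tempered"
proof -
  obtain l :: nat where l: "real l \<ge> 2 - r"
    using real_arch_simple by blast
  obtain k :: nat where k: "real k \<ge> s"
    using real_arch_simple by blast
  have "(\<lambda>i. cmod (A i) / (japanese (\<omega> i) ^ k * japanese (of_int (\<kappa> i)) ^ l)) summable_on UNIV"
  proof (rule norm_dominated_summable(2)[OF amplitudes_summable[OF a l]])
    fix i
    have "1 / japanese (\<omega> i) ^ k = japanese (\<omega> i) powr (- real k)"
      by (simp add: powr_minus powr_realpow divide_inverse)
    also have "\<dots> \<le> japanese (\<omega> i) powr (- s)"
      using k japanese_ge_1 by (intro powr_mono) auto
    finally have "cmod (A i) * (1 / japanese (\<omega> i) ^ k) / japanese (of_int (\<kappa> i)) ^ l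
        \<le> cmod (A i) * japanese (\<omega> i) powr (- s) / japanese (of_int (\<kappa> i)) ^ l"
      by (intro divide_right_mono mult_left_mono) auto
    then show "norm (cmod (A i) / (japanese (\<omega> i) ^ k * japanese (of_int (\<kappa> i)) ^ l))
        \<le> cmod (A i * of_real (japanese (\<omega> i) powr (- s))) / japanese (of_int (\<kappa> i)) ^ l"
      by (simp add: norm_mult)
  qed
  from plane_wave_series_tempered[OF this]
  show "\<phi> \<in> schwartz \<Longrightarrow> (\<lambda>i. A i * plane_wave (\<omega> i) (\<kappa> i) \<phi>) summable_on UNIV"
    "plane_wave_series \<kappa> \<omega> A \<in> tempered"
    by simp_all
qed

text \<open>
  The operator acts by duality on the test function, where it multiplies the pairing with each
  wave by \<open>\<langle>\<omega>\<rangle> powr (- s)\<close>; this factor is moved to the amplitudes.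
\<close>

lemma wave_slice_density:
  fixes \<kappa> :: "'i::countable \<Rightarrow> int"
  assumes a: "sobolev_amplitudes r \<kappa> (\<lambda>i. A i * of_real (japanese (\<omega> i) powr (- s)))" and s: "s > 0"
    and T: "\<And>\<phi>. \<phi> \<in> schwartz \<Longrightarrow> T (Dt_bracket_test (- s) \<phi>) = plane_wave_series \<kappa> \<omega> A (Dt_bracket_test (- s) \<phi>)"
  shows "wave_slice \<kappa> \<omega> (\<lambda>i. A i * of_real (japanese (\<omega> i) powr (- s))) \<in> Dt_density (- s) r T"
  unfolding Dt_density_def
proof (intro CollectI conjI ballI wave_slice_Linf(1)[OF a])
  fix \<phi> assume \<phi>: "\<phi> \<in> schwartz"
  show "Dt_bracket (- s) T \<phi> = time_dist (wave_slice \<kappa> \<omega> (\<lambda>i. A i * of_real (japanese (\<omega> i) powr (- s)))) \<phi>"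
    unfolding Dt_bracket_def T[OF \<phi>] time_dist_wave_slice[OF a \<phi>] plane_wave_series_def
    by (simp add: Dt_bracket_test_regular(3)[OF s \<phi>] mult.assoc)
qed

text \<open>
  Truncation becomes a cut-off of the amplitudes, so that the approximations and the limit are
  series over the same index set.
\<close>

lemma fun_dist_renorm_square:
  assumes "\<And>t. continuous_on UNIV (\<phi> t)" "\<And>k. integrable lborel (\<lambda>t. test_coeff k (\<phi> t))"
  shows "fun_dist (renorm_square \<alpha> \<sigma> u N) \<phi> = plane_wave_series pair_freq (pair_phase \<alpha>)
    (\<lambda>i. if i \<in> pair_box N then wick_amplitude \<sigma> (fourier_coeff u) i else 0) \<phi>"
proof -
  have "renorm_square \<alpha> \<sigma> u N = (\<lambda>t x. \<Sum>i\<in>pair_box N. wick_amplitude \<sigma> (fourier_coeff u) i *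
     cis (t * pair_phase \<alpha> i) * cis (of_int (pair_freq i) * x))"
    by (intro ext) (rule renorm_square_waves)
  then have "fun_dist (renorm_square \<alpha> \<sigma> u N) \<phi>
      = (\<Sum>i\<in>pair_box N. wick_amplitude \<sigma> (fourier_coeff u) i * plane_wave (pair_phase \<alpha> i) (pair_freq i) \<phi>)"
    by (simp only: fun_dist_trig_sum[OF finite_pair_box assms])
  also have "\<dots> = (\<Sum>\<^sub>\<infinity>i\<in>pair_box N. wick_amplitude \<sigma> (fourier_coeff u) i * plane_wave (pair_phase \<alpha> i) (pair_freq i) \<phi>)"
    by simp
  also have "\<dots> = plane_wave_series pair_freq (pair_phase \<alpha>)
      (\<lambda>i. if i \<in> pair_box N then wick_amplitude \<sigma> (fourier_coeff u) i else 0) \<phi>"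
    unfolding plane_wave_series_def by (rule infsum_cong_neutral) auto
  finally show ?thesis .
qed

lemma Linf_norm_nonneg: "0 \<le> Linf_norm r g"
proof -
  have "esssup lebesgue (\<lambda>t::real. 0 :: ereal) = 0"
    by (rule esssup_const) simp
  moreover have "esssup lebesgue (\<lambda>t::real. 0) \<le> Linf_norm r g"
    unfolding Linf_norm_def
    by (rule esssup_mono) (auto simp: sobolev_norm_def intro!: infsum_nonneg)
  ultimately show ?thesis by simp
qed

lemma eventually_in_pair_box: "\<forall>\<^sub>F N in sequentially. i \<in> pair_box N"
proof (rule eventually_sequentiallyI)
  fix N assume "nat (\<bar>fst i\<bar> + \<bar>snd i\<bar>) \<le> N"
  then show "i \<in> pair_box N"
    by (cases i) (auto simp: pair_box_def)
qed

text \<open>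
  The limit is the series of all waves with \<open>m \<noteq> n\<close>.  It is the same for all
  \<open>s2\<close>; its temperedness and the convergence on test functions come from one sufficiently
  large order in space, \<open>2 \<sigma> + 1\<close>.
\<close>

section \<open>Existence of the renormalized square\<close>

theorem theorem1p1:
  fixes \<alpha> \<sigma> :: real and u\<^sub>0 :: "real \<Rightarrow> complex"
  assumes "\<alpha> > 1" and "u\<^sub>0 \<in> L2_torus" and "\<sigma> > 0"
  shows "\<exists>wick \<in> tempered.
    tempered_tendsto (\<lambda>N. fun_dist (renorm_square \<alpha> \<sigma> u\<^sub>0 N)) wick \<and>
    (\<forall>s\<^sub>1 s\<^sub>2 :: real.
       s\<^sub>1 = 2 * \<sigma> / (\<alpha> - 1) \<longrightarrow>
       (if \<sigma> > 1 / 4 - 1 / (4 * \<alpha>) then s\<^sub>2 = 2 * \<sigma>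
        else s\<^sub>2 > 0 \<and> s\<^sub>2 > 1 / 2 - 2 * \<sigma> / (\<alpha> - 1)) \<longrightarrow>
       wick \<in> W_space (- s\<^sub>1) (- s\<^sub>2) \<and>
       W_tendsto (- s\<^sub>1) (- s\<^sub>2) (\<lambda>N. fun_dist (renorm_square \<alpha> \<sigma> u\<^sub>0 N)) wick)"
proof -
  note \<alpha> = assms(1) and \<sigma> = assms(3)
  define s1 where "s1 = 2 * \<sigma> / (\<alpha> - 1)"
  have s1: "s1 > 0"
    using \<alpha> \<sigma> by (simp add: s1_def)
  let ?\<kappa> = pair_freq and ?\<omega> = "pair_phase \<alpha>"
  define A where "A = wick_amplitude \<sigma> (fourier_coeff u\<^sub>0)"
  define AN where "AN = (\<lambda>N i. if i \<in> pair_box N then A i else 0)"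
  let ?J = "\<lambda>i. complex_of_real (japanese (?\<omega> i) powr (- s1))"
  let ?T = "\<lambda>N. fun_dist (renorm_square \<alpha> \<sigma> u\<^sub>0 N)"
  define wick where "wick = plane_wave_series ?\<kappa> ?\<omega> A"
  have amp: "sobolev_amplitudes (- s2) ?\<kappa> (\<lambda>i. A i * ?J i)" if "s2 \<ge> 2 * \<sigma>" "s1 + s2 > 1 / 2" for s2
    unfolding A_def
    by (rule wick_amplitudes_sobolev[OF \<alpha> \<sigma> s1_def that Bessel_inequality[OF assms(2)]])
  have ampN: "sobolev_amplitudes (- s2) ?\<kappa> (\<lambda>i. AN N i * ?J i)"
    if "s2 \<ge> 2 * \<sigma>" "s1 + s2 > 1 / 2" for s2 N
    by (rule sobolev_amplitudes_mono(1)[OF amp[OF that]]) (simp add: AN_def norm_mult)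
  have "2 * \<sigma> + 1 \<ge> 2 * \<sigma>" "s1 + (2 * \<sigma> + 1) > 1 / 2"
    using s1 \<sigma> by auto
  note some = amp[OF this] ampN[OF this]
  have TN: "?T N \<phi> = plane_wave_series ?\<kappa> ?\<omega> (AN N) \<phi>"
    if "\<And>t. continuous_on UNIV (\<phi> t)" "\<And>k. integrable lborel (\<lambda>t. test_coeff k (\<phi> t))" for N \<phi>
    unfolding AN_def A_def by (rule fun_dist_renorm_square[OF that])
  have reg: "continuous_on UNIV (\<phi> t)" "integrable lborel (\<lambda>t. test_coeff k (\<phi> t))"
    if "\<phi> \<in> schwartz" for \<phi> t k
    using that by (auto intro: torus_smooth_continuous schwartz_slice_smooth schwartz_test_coeff_integrable)
  have TN_schwartz: "?T N \<phi> = plane_wave_series ?\<kappa> ?\<omega> (AN N) \<phi>" if "\<phi> \<in> schwartz" for N \<phi>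
    by (rule TN) (use reg[OF that] in auto)
  \<comment> \<open>the class of test functions admitted by \<open>TN\<close> is closed under linear combinations, which linearity of
    the approximations as tempered distributions refers to\<close>
  have TN_comb: "?T N (\<lambda>t x. c * \<phi> t x + \<eta> t x) = plane_wave_series ?\<kappa> ?\<omega> (AN N) (\<lambda>t x. c * \<phi> t x + \<eta> t x)"
    if "\<phi> \<in> schwartz" "\<eta> \<in> schwartz" for N \<phi> \<eta> c
    by (rule TN) (use reg[OF that(1)] reg[OF that(2)] in \<open>auto simp: test_coeff_linear intro!: continuous_intros\<close>)
  have TN_pot: "?T N (Dt_bracket_test (- s1) \<phi>) = plane_wave_series ?\<kappa> ?\<omega> (AN N) (Dt_bracket_test (- s1) \<phi>)"
    if "\<phi> \<in> schwartz" for N \<phi>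
    by (rule TN) (use Dt_bracket_test_regular[OF s1 that] in auto)
  have temp: "wick \<in> tempered"
    unfolding wick_def by (rule plane_wave_series_amplitudes(2)[OF some(1) s1])
  have tempN: "?T N \<in> tempered" for N
    using plane_wave_series_amplitudes(2)[OF some(2) s1, of N]
    by (simp add: tempered_def TN_schwartz TN_comb)
  have "tempered_tendsto ?T wick"
    unfolding tempered_tendsto_def
  proof
    fix \<phi> assume \<phi>: "\<phi> \<in> schwartz"
    have sum: "(\<lambda>i. A i * plane_wave (?\<omega> i) (?\<kappa> i) \<phi>) summable_on UNIV"
      by (rule plane_wave_series_amplitudes(1)[OF some(1) s1 \<phi>])
    have "(\<lambda>N. plane_wave_series ?\<kappa> ?\<omega> (AN N) \<phi>) \<longlonglongrightarrow> wick \<phi>"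
      unfolding wick_def plane_wave_series_def
    proof (rule infsum_dominated_convergence)
      show "(\<lambda>i. cmod (A i * plane_wave (?\<omega> i) (?\<kappa> i) \<phi>)) summable_on UNIV"
        using sum by (simp only: summable_on_iff_abs_summable_on_complex)
      show "(\<lambda>N. AN N i * plane_wave (?\<omega> i) (?\<kappa> i) \<phi>) \<longlonglongrightarrow> A i * plane_wave (?\<omega> i) (?\<kappa> i) \<phi>" for i
        by (rule tendsto_eventually, rule eventually_mono[OF eventually_in_pair_box[of i]]) (simp add: AN_def)
    qed (simp add: AN_def norm_mult)
    then show "(\<lambda>N. ?T N \<phi>) \<longlonglongrightarrow> wick \<phi>"
      by (simp add: TN_schwartz[OF \<phi>])
  qed
  moreover have "wick \<in> W_space (- s1) (- s2) \<and> W_tendsto (- s1) (- s2) ?T wick"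
    if s2: "if \<sigma> > 1 / 4 - 1 / (4 * \<alpha>) then s2 = 2 * \<sigma> else s2 > 0 \<and> s2 > 1 / 2 - 2 * \<sigma> / (\<alpha> - 1)" for s2
  proof -
    have s2': "s2 \<ge> 2 * \<sigma>" "s1 + s2 > 1 / 2"
    proof -
      have sum: "s1 + 2 * \<sigma> = 2 * \<sigma> * \<alpha> / (\<alpha> - 1)"
        using \<alpha> by (simp add: s1_def field_simps)
      \<comment> \<open>the threshold for \<open>\<sigma>\<close> is where \<open>s1 + 2 \<sigma> = 1 / 2\<close>\<close>
      have crit: "\<sigma> > 1 / 4 - 1 / (4 * \<alpha>) \<longleftrightarrow> s1 + 2 * \<sigma> > 1 / 2"
        using \<alpha> unfolding sum by (simp add: field_simps)
      show "s2 \<ge> 2 * \<sigma>" "s1 + s2 > 1 / 2"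
        using s2 crit unfolding s1_def[symmetric] by (auto split: if_splits)
    qed
    note a = amp[OF s2'] and aN = ampN[OF s2']
    have W: "wick \<in> W_space (- s1) (- s2)"
      using temp wave_slice_density[OF a s1, of wick] unfolding W_space_def wick_def by auto
    have WN: "?T N \<in> W_space (- s1) (- s2)" for N
      using tempN wave_slice_density[OF aN s1 TN_pot] unfolding W_space_def by blast
    \<comment> \<open>the amplitudes of the difference vanish inside the box and are those of the limit, up to sign,
      outside\<close>
    define B where "B = (\<lambda>N i. AN N i - A i)"
    have Ble: "cmod (B N i * ?J i) \<le> cmod (A i * ?J i)" for N i
      by (simp add: B_def AN_def norm_mult)
    have b: "sobolev_amplitudes (- s2) ?\<kappa> (\<lambda>i. B N i * ?J i)" for N
      by (rule sobolev_amplitudes_mono(1)[OF a Ble])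
    define Q where "Q = (\<lambda>N. \<Sum>\<^sub>\<infinity>j\<in>UNIV. (japanese (of_int j) powr (- s2) * fibre_mass ?\<kappa> (\<lambda>i. B N i * ?J i) j)\<^sup>2)"
    have "Q \<longlonglongrightarrow> 0"
      unfolding Q_def
    proof (rule amplitudes_tendsto_0[OF a Ble])
      show "(\<lambda>N. B N i * ?J i) \<longlonglongrightarrow> 0" for i
        by (rule tendsto_eventually, rule eventually_mono[OF eventually_in_pair_box[of i]])
          (simp add: B_def AN_def)
    qed
    then have lim: "(\<lambda>N. ereal (sqrt (Q N))) \<longlonglongrightarrow> 0"
      using tendsto_real_sqrt[of Q 0] by (simp add: zero_ereal_def)
    have upper: "W_norm (- s1) (- s2) (\<lambda>\<phi>. ?T N \<phi> - wick \<phi>) \<le> ereal (sqrt (Q N))" for N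
    proof -
      let ?g = "wave_slice ?\<kappa> ?\<omega> (\<lambda>i. B N i * ?J i)"
      have "?g \<in> Dt_density (- s1) (- s2) (\<lambda>\<phi>. ?T N \<phi> - wick \<phi>)"
      proof (rule wave_slice_density[OF b s1])
        fix \<phi> assume \<phi>: "\<phi> \<in> schwartz"
        let ?\<Phi> = "Dt_bracket_test (- s1) \<phi>"
        have s: "(\<lambda>i. A' i * plane_wave (?\<omega> i) (?\<kappa> i) ?\<Phi>) summable_on UNIV"
          if "sobolev_amplitudes (- s2) ?\<kappa> (\<lambda>i. A' i * ?J i)" for A'
        proof -
          have "(\<lambda>i. (A' i * ?J i) * plane_wave (?\<omega> i) (?\<kappa> i) \<phi>) summable_on UNIV"
          proof (rule norm_dominated_summable(2))
            show "(\<lambda>i. cmod (A' i * plane_wave (?\<omega> i) (?\<kappa> i) \<phi>)) summable_on UNIV"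
              using plane_wave_series_amplitudes(1)[OF that s1 \<phi>]
              by (simp only: summable_on_iff_abs_summable_on_complex)
            fix i
            have "japanese (?\<omega> i) powr (- s1) \<le> japanese (?\<omega> i) powr 0"
              using s1 japanese_ge_1 by (intro powr_mono) auto
            then have "cmod (A' i) * cmod (plane_wave (?\<omega> i) (?\<kappa> i) \<phi>) * japanese (?\<omega> i) powr (- s1)
                \<le> cmod (A' i) * cmod (plane_wave (?\<omega> i) (?\<kappa> i) \<phi>) * 1"
              by (intro mult_left_mono) auto
            then show "norm ((A' i * ?J i) * plane_wave (?\<omega> i) (?\<kappa> i) \<phi>)
                \<le> cmod (A' i * plane_wave (?\<omega> i) (?\<kappa> i) \<phi>)"
              by (simp add: norm_mult mult_ac)
          qed
          then show ?thesis
            by (simp add: Dt_bracket_test_regular(3)[OF s1 \<phi>] mult.assoc)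
        qed
        show "?T N ?\<Phi> - wick ?\<Phi> = plane_wave_series ?\<kappa> ?\<omega> (B N) ?\<Phi>"
          unfolding TN_pot[OF \<phi>] wick_def plane_wave_series_def B_def left_diff_distrib
          by (rule infsum_diff[symmetric]) (intro s a aN)+
      qed
      then have "W_norm (- s1) (- s2) (\<lambda>\<phi>. ?T N \<phi> - wick \<phi>) \<le> Linf_norm (- s2) ?g"
        unfolding W_norm_def by (rule INF_lower)
      also have "\<dots> \<le> ereal (sqrt (Q N))"
        unfolding Q_def by (rule wave_slice_Linf(2)[OF b])
      finally show ?thesis .
    qed
    have lower: "0 \<le> W_norm (- s1) (- s2) (\<lambda>\<phi>. ?T N \<phi> - wick \<phi>)" for N
      unfolding W_norm_def by (intro INF_greatest Linf_norm_nonneg)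
    have "(\<lambda>N. W_norm (- s1) (- s2) (\<lambda>\<phi>. ?T N \<phi> - wick \<phi>)) \<longlonglongrightarrow> 0"
      by (rule tendsto_sandwich[OF _ _ tendsto_const lim]) (use lower upper in auto)
    then show ?thesis
      using W WN by (simp add: W_tendsto_def)
  qed
  ultimately show ?thesis
    using temp unfolding s1_def by blast
qed

end
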